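(* Let $1\le k\le n/2$ and let $Q_0,Q_1\in\mathrm{Gr}(k,n)$ be such that $d(Q_0,Q_1)<\sqrt2\,\pi$. Write $Q_0=V_0I_{k,n-k}V_0^{\mathsf T}$, $Q_1=V_1I_{k,n-k}V_1^{\mathsf T}$ with $V_0,V_1\in\mathrm{O}(n)$, let \[ V_0^{\mathsf T}V_1=\begin{bmatrix}U & 0 \\ 0 & V\end{bmatrix}\begin{bmatrix}\cos\Theta & \sin\Theta & 0 \\ -\sin\Theta & \cos\Theta & 0 \\ 0 & 0 & I_{n-2k}\end{bmatrix}\begin{bmatrix}W & 0 \\ 0 & Z\end{bmatrix}^{\mathsf T} \] be a CS decomposition, where $U,W\in\mathrm{O}(k)$, $V,Z\in\mathrm{O}(n-k)$, $\Theta=\operatorname{diag}(\theta_1,\dots,\theta_k)$, $\theta_i\in[0,\pi/2]$, and let $B=-2U[\Theta,0]V^{\mathsf T}\in\mathbb{R}^{k\times(n-k)}$ with $0\in\mathbb{R}^{k\times(n-2k)}$. Then the logarithmic map at $Q_0$ of $Q_1$ is \[ \log_{Q_0}(Q_1)=V_0\begin{bmatrix}0 & B \\ B^{\mathsf T} & 0\end{bmatrix}V_0^{\mathsf T}. \]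
   Context: $\mathrm{Gr}(k,n)=\{Q\in\mathrm{O}(n):Q^{\mathsf T}=Q,\ \operatorname{tr}(Q)=2k-n\}$, an embedded submanifold of $\mathbb{R}^{n\times n}$, equipped with the Riemannian metric $\langle X,Y\rangle_Q=\operatorname{tr}(XY)$ for $X,Y\in\mathbb{T}_Q\mathrm{Gr}(k,n)$ (tangent vectors are symmetric matrices); $d$ is the associated geodesic distance. $I_{k,n-k}=\operatorname{diag}(I_k,-I_{n-k})$. $\cos\Theta$ and $\sin\Theta$ are the diagonal matrices $\operatorname{diag}(\cos\theta_i)$, $\operatorname{diag}(\sin\theta_i)$. For a point $x$ of a Riemannian manifold $M$, the injectivity radius at $x$ is the largest $r$ such that the Riemannian exponential map $\exp_x$ is a diffeomorphism from the open ball $\mathrm{B}_r(0)\subseteq\mathbb{T}_xM$ onto its image; the logarithmic map $\log_x:\exp_x(\mathrm{B}_r(0))\to\mathbb{T}_xM$ is the inverse of $\exp_x|_{\mathrm{B}_r(0)}$ for this $r$. *)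

theory Defs
  imports "HOL-Analysis.Analysis"
begin

section \<open>Smooth maps between subsets of Euclidean spaces\<close>

text \<open>\<open>Ck_on k S f\<close> is meant for open \<open>S\<close>. All iterated directional derivatives up to order \<open>k\<close>
  are required to exist and be continuous, which in finite dimension is the class \<open>C\<^sup>k\<close>.\<close>

primrec Ck_on :: "nat \<Rightarrow> 'a::euclidean_space set \<Rightarrow> ('a \<Rightarrow> 'b::euclidean_space) \<Rightarrow> bool" where
  "Ck_on 0 S f \<longleftrightarrow> continuous_on S f"
| "Ck_on (Suc k) S f \<longleftrightarrow>
     (\<forall>x\<in>S. f differentiable (at x)) \<and> (\<forall>v. Ck_on k S (\<lambda>x. frechet_derivative f (at x) v))"

text \<open>On an arbitrary set, smooth means: locally the restriction of a smooth map defined on an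
  open subset of the ambient space. For maps between embedded submanifolds (and open subsets of
  linear subspaces) this is the usual notion.\<close>

definition smooth_on :: "'a::euclidean_space set \<Rightarrow> ('a \<Rightarrow> 'b::euclidean_space) \<Rightarrow> bool" where
  "smooth_on S f \<longleftrightarrow>
     (\<forall>x\<in>S. \<exists>U h. open U \<and> x \<in> U \<and> (\<forall>k. Ck_on k U h) \<and> (\<forall>y\<in>S \<inter> U. f y = h y))"

definition diffeomorphism_on_image :: "'a::euclidean_space set \<Rightarrow> ('a \<Rightarrow> 'b::euclidean_space) \<Rightarrow> bool" where
  "diffeomorphism_on_image S f \<longleftrightarrow>
     inj_on f S \<and> smooth_on S f \<and> smooth_on (f ` S) (inv_into S f)"

section \<open>Riemannian geometry of embedded submanifolds\<close>

text \<open>Throughout, \<open>M\<close> is an embedded submanifold of a Euclidean space and \<open>g\<close> is a symmetric bilinear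
  form on the ambient space, the same at every point, whose restriction to each tangent space
  of \<open>M\<close> is the Riemannian metric.\<close>

definition tangent_space :: "'a::euclidean_space set \<Rightarrow> 'a \<Rightarrow> 'a set" where
  "tangent_space M x =
     {v. \<exists>c \<epsilon>. \<epsilon> > 0 \<and> smooth_on {-\<epsilon><..<\<epsilon>} c \<and> c ` {-\<epsilon><..<\<epsilon>} \<subseteq> M \<and>
           c 0 = x \<and> (c has_vector_derivative v) (at (0::real))}"

definition metric_norm :: "('a \<Rightarrow> 'a \<Rightarrow> real) \<Rightarrow> 'a \<Rightarrow> real" where
  "metric_norm g v = sqrt (g v v)"

text \<open>The infimum ranges over the rectifiable piecewise \<open>C\<^sup>1\<close> curves in \<open>M\<close> from \<open>x\<close> to \<open>y\<close>. Stating the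
  length with \<open>has_integral\<close> excludes curves of infinite length: a library \<open>valid_path\<close> may have
  unbounded speed near its break points, and \<open>integral\<close> is \<open>0\<close> on non-integrable functions.
  Points in different components have distance \<open>\<infinity>\<close>.\<close>

definition geodesic_dist :: "('a::euclidean_space \<Rightarrow> 'a \<Rightarrow> real) \<Rightarrow> 'a set \<Rightarrow> 'a \<Rightarrow> 'a \<Rightarrow> ereal" where
  "geodesic_dist g M x y =
     Inf {ereal L | L c. valid_path c \<and> path_image c \<subseteq> M \<and> pathstart c = x \<and> pathfinish c = y \<and>
            ((\<lambda>t. metric_norm g (vector_derivative c (at t))) has_integral L) {0..1}}"

text \<open>As \<open>g\<close> is constant on the ambient space, the Levi-Civita connection of \<open>M\<close> is characterised by
  \<open>g (\<nabla>\<^sub>X Y) Z = g (D\<^sub>X Y) Z\<close> for tangential \<open>Z\<close>, with \<open>D\<close> the ambient directional derivative (this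
  connection is metric and torsion-free). So vanishing covariant acceleration means that the
  ambient acceleration is \<open>g\<close>-orthogonal to the tangent space.\<close>

definition geodesic_on :: "('a::euclidean_space \<Rightarrow> 'a \<Rightarrow> real) \<Rightarrow> 'a set \<Rightarrow> real set \<Rightarrow> (real \<Rightarrow> 'a) \<Rightarrow> bool" where
  "geodesic_on g M I c \<longleftrightarrow>
     smooth_on I c \<and> c ` I \<subseteq> M \<and>
     (\<forall>t\<in>I. \<forall>Y\<in>tangent_space M (c t).
        g (vector_derivative (\<lambda>s. vector_derivative c (at s)) (at t)) Y = 0)"

definition geodesic_to :: "('a::euclidean_space \<Rightarrow> 'a \<Rightarrow> real) \<Rightarrow> 'a set \<Rightarrow> 'a \<Rightarrow> 'a \<Rightarrow> 'a \<Rightarrow> bool" where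
  "geodesic_to g M x v y \<longleftrightarrow>
     (\<exists>c a b. a < 0 \<and> 1 < b \<and> geodesic_on g M {a<..<b} c \<and>
        c 0 = x \<and> vector_derivative c (at 0) = v \<and> c 1 = y)"

definition exp_domain :: "('a::euclidean_space \<Rightarrow> 'a \<Rightarrow> real) \<Rightarrow> 'a set \<Rightarrow> 'a \<Rightarrow> 'a set" where
  "exp_domain g M x = {v \<in> tangent_space M x. \<exists>y. geodesic_to g M x v y}"

definition riem_exp :: "('a::euclidean_space \<Rightarrow> 'a \<Rightarrow> real) \<Rightarrow> 'a set \<Rightarrow> 'a \<Rightarrow> 'a \<Rightarrow> 'a" where
  "riem_exp g M x v = (THE y. geodesic_to g M x v y)"

definition tangent_ball :: "('a::euclidean_space \<Rightarrow> 'a \<Rightarrow> real) \<Rightarrow> 'a set \<Rightarrow> 'a \<Rightarrow> ereal \<Rightarrow> 'a set" where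
  "tangent_ball g M x r = {v \<in> tangent_space M x. ereal (metric_norm g v) < r}"

text \<open>The supremum is a maximum, since the open balls are nested and the condition is
  preserved by increasing unions.\<close>

definition injectivity_radius :: "('a::euclidean_space \<Rightarrow> 'a \<Rightarrow> real) \<Rightarrow> 'a set \<Rightarrow> 'a \<Rightarrow> ereal" where
  "injectivity_radius g M x =
     Sup {r. tangent_ball g M x r \<subseteq> exp_domain g M x \<and>
             diffeomorphism_on_image (tangent_ball g M x r) (riem_exp g M x)}"

definition log_domain :: "('a::euclidean_space \<Rightarrow> 'a \<Rightarrow> real) \<Rightarrow> 'a set \<Rightarrow> 'a \<Rightarrow> 'a set" where
  "log_domain g M x = riem_exp g M x ` tangent_ball g M x (injectivity_radius g M x)"

definition riem_log :: "('a::euclidean_space \<Rightarrow> 'a \<Rightarrow> real) \<Rightarrow> 'a set \<Rightarrow> 'a \<Rightarrow> 'a \<Rightarrow> 'a" where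
  "riem_log g M x = inv_into (tangent_ball g M x (injectivity_radius g M x)) (riem_exp g M x)"

section \<open>The Grassmannian in the involution model\<close>

definition Grassmannian :: "nat \<Rightarrow> (real^'n^'n) set" where
  "Grassmannian k =
     {Q. orthogonal_matrix Q \<and> transpose Q = Q \<and> trace Q = 2 * real k - real CARD('n)}"

definition trace_metric :: "real^'n^'n \<Rightarrow> real^'n^'n \<Rightarrow> real" where
  "trace_metric X Y = trace (X ** Y)"

section \<open>Block matrices\<close>

text \<open>The index type \<open>'k + 'l\<close> splits the \<open>n = CARD('k) + CARD('l)\<close> coordinates into the first \<open>k\<close>
  and the last \<open>n - k\<close>. Note that \<open>real^'l^'k\<close> is the type of \<open>k \<times> (n-k)\<close> matrices.\<close>

definition block_mat ::
  "real^'k::finite^'k \<Rightarrow> real^'l::finite^'k \<Rightarrow> real^'k^'l \<Rightarrow> real^'l^'l \<Rightarrow> real^('k+'l)^('k+'l)" where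
  "block_mat A B C D = (\<chi> i j.
     case i of
       Inl a \<Rightarrow> (case j of Inl b \<Rightarrow> A $ a $ b | Inr b \<Rightarrow> B $ a $ b)
     | Inr a \<Rightarrow> (case j of Inl b \<Rightarrow> C $ a $ b | Inr b \<Rightarrow> D $ a $ b))"

definition signature_mat :: "real^('k::finite+'l::finite)^('k+'l)" where
  "signature_mat = block_mat (mat 1) 0 0 (- mat 1)"

definition diag_mat :: "('k::finite \<Rightarrow> real) \<Rightarrow> real^'k^'k" where
  "diag_mat d = (\<chi> i j. if i = j then d i else 0)"

text \<open>The further splitting of the last \<open>n - k\<close> coordinates into \<open>k\<close> and \<open>n - 2k\<close> cannot be done with
  a sum type, because types are nonempty and \<open>n = 2k\<close> is allowed. Instead an injection
  \<open>e :: 'k \<Rightarrow> 'l\<close> says which of the \<open>n - k\<close> coordinates are the first \<open>k\<close>, and in which order;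
  the coordinates outside \<open>range e\<close> are the remaining \<open>n - 2k\<close>. Thus \<open>diag_pad_zero e d\<close> is
  \<open>[diag d, 0]\<close> and \<open>diag_pad_one e d\<close> is \<open>diag (diag d, I)\<close>.\<close>

definition diag_pad_zero :: "('k::finite \<Rightarrow> 'l::finite) \<Rightarrow> ('k \<Rightarrow> real) \<Rightarrow> real^'l^'k" where
  "diag_pad_zero e d = (\<chi> i j. if j = e i then d i else 0)"

definition diag_pad_one :: "('k::finite \<Rightarrow> 'l::finite) \<Rightarrow> ('k \<Rightarrow> real) \<Rightarrow> real^'l^'l" where
  "diag_pad_one e d = diag_mat (\<lambda>j. if j \<in> range e then d (inv e j) else 1)"

definition CS_mat :: "('k::finite \<Rightarrow> 'l::finite) \<Rightarrow> ('k \<Rightarrow> real) \<Rightarrow> real^('k+'l)^('k+'l)" where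
  "CS_mat e \<theta> = block_mat
     (diag_mat (\<lambda>i. cos (\<theta> i)))                        (diag_pad_zero e (\<lambda>i. sin (\<theta> i)))
     (- transpose (diag_pad_zero e (\<lambda>i. sin (\<theta> i))))   (diag_pad_one e (\<lambda>i. cos (\<theta> i)))"

end

theory Submission
  imports Defs
begin

text \<open>A tangent vector at \<open>q\<close> is a symmetric \<open>x\<close> anticommuting with \<open>q\<close>, and for a geodesic \<open>c\<close> the
  product \<open>c c'\<close> is constant, so the geodesics are \<open>t \<mapsto> q exp (t q x)\<close>. For \<open>p = exp\<^sub>q x\<close>, the matrix
  \<open>Y = angle_mat q p = (2 - q p - p q) / 4\<close> equals \<open>sin\<^sup>2 (\<bar>x\<bar> / 2)\<close> and \<open>(p - q p q) / 2\<close> equals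
  \<open>x sin \<bar>x\<bar> / \<bar>x\<bar>\<close>, where \<open>\<bar>x\<bar>\<close> is the square root of \<open>x\<^sup>2\<close>. Since \<open>\<phi> / sin \<phi>\<close> is a power series
  in \<open>sin\<^sup>2 (\<phi> / 2)\<close> with radius of convergence 1, \<open>x\<close> is a smooth function of \<open>p\<close> as long as
  \<open>\<bar>x\<bar> < \<pi>\<close>. This holds for \<open>tr x\<^sup>2 < 2 \<pi>\<^sup>2\<close> because the nonzero eigenvalues of \<open>x\<^sup>2\<close> have even
  multiplicity. So the injectivity radius is at least \<open>sqrt 2 * \<pi>\<close>.

  The CS decomposition exhibits \<open>Q1\<close> as the exponential of the claimed vector \<open>v\<close>, whose operator
  norm is at most \<open>\<pi>\<close>; it remains to see that \<open>v\<close> is no longer than any curve from \<open>Q0\<close> to \<open>Q1\<close>.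
  With \<open>\<phi>\<^sup>2 = \<Sum>n. b n * sin\<^sup>2 (\<phi> / 2) ^ n\<close>, the function \<open>F p = \<Sum>n. b n * tr (Y ^ n)\<close> is the
  squared norm of \<open>v\<close> at \<open>p = Q1\<close>, and its square root is 1-Lipschitz along curves. Working with
  partial sums of \<open>F\<close>, which are polynomials in \<open>p\<close>, avoids the cut locus.\<close>

section \<open>The Banach algebra of square matrices\<close>

text \<open>The angles of a CS decomposition are at most \<pi> / 2. This bounds the operator norm of
  \<open>v\<close> by \<pi>, but its Frobenius norm only by sqrt (2 k) * \<pi>. The missing bound
  sqrt 2 * \<pi> has to come from the hypothesis on the distance, and since that speaks of an
  infimum over curves, it requires a lower bound on the length of every curve. Such a curve may pass
  through points where some angle is \<pi>. There the series of \<open>\<phi>\<^sup>2\<close> still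
  converges, but its derivative with respect to \<open>sin\<^sup>2 (\<phi> / 2)\<close>, which is 4
  \<phi> / sin \<phi>, is unbounded. For a partial sum F_m nothing blows up, and its gradient has
  norm at most 2 sqrt (F_m + t_m), where t_m is n times the tail of the coefficients
  \<open>b\<close>. Hence sqrt (F_m + t_m) is 1-Lipschitz along curves. The shift by t_m > 0 also
  makes the root differentiable at the starting point, where F_m = 0. The limit of large m loses
  nothing: t_m tends to 0 because the series of \<open>\<phi>\<^sup>2\<close> converges even at
  \<phi> = \<pi>.\<close>

typedef (overloaded) 'n matalg = "UNIV :: (real^'n::finite^'n) set"
  morphisms to_mat of_mat ..

setup_lifting type_definition_matalg

declare to_mat_inverse [simp] of_mat_inverse [OF UNIV_I, simp]

instantiation matalg :: (finite) real_algebra_1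
begin
lift_definition zero_matalg :: "'a matalg" is 0 .
lift_definition one_matalg :: "'a matalg" is "mat 1" .
lift_definition plus_matalg :: "'a matalg \<Rightarrow> 'a matalg \<Rightarrow> 'a matalg" is "(+)" .
lift_definition minus_matalg :: "'a matalg \<Rightarrow> 'a matalg \<Rightarrow> 'a matalg" is "(-)" .
lift_definition uminus_matalg :: "'a matalg \<Rightarrow> 'a matalg" is uminus .
lift_definition times_matalg :: "'a matalg \<Rightarrow> 'a matalg \<Rightarrow> 'a matalg" is "(**)" .
lift_definition scaleR_matalg :: "real \<Rightarrow> 'a matalg \<Rightarrow> 'a matalg" is scaleR .
instance
proof
  fix a b c :: "'a matalg" and r s :: real
  show "(0 :: 'a matalg) \<noteq> 1"
    by transfer (auto simp: vec_eq_iff mat_def)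
  show "(a + b) * c = a * c + b * c"
    by transfer (simp add: vec_eq_iff matrix_matrix_mult_def distrib_right sum.distrib)
  show "r *\<^sub>R a * b = r *\<^sub>R (a * b)"
    by transfer (simp add: scalar_matrix_assoc)
  show "a * r *\<^sub>R b = r *\<^sub>R (a * b)"
    by transfer (simp add: matrix_scalar_ac scalar_matrix_assoc)
qed (transfer; simp add: algebra_simps matrix_mul_assoc matrix_add_ldistrib)+
end

lift_definition app :: "'n::finite matalg \<Rightarrow> real^'n \<Rightarrow> real^'n" is "(*v)" .
lift_definition tr :: "'n::finite matalg \<Rightarrow> real" is trace .
lift_definition adj :: "'n::finite matalg \<Rightarrow> 'n matalg" is transpose .

text \<open>The separate type exists for this norm. In the Frobenius norm of
  \<open>real^'n^'n\<close> the identity has norm sqrt n, while a normed algebra with unit asks for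
  norm 1. The operator norm also lets convergence of a power series in a symmetric matrix be read
  off from its eigenvalues.\<close>

instantiation matalg :: (finite) real_normed_vector
begin
definition norm_matalg :: "'a matalg \<Rightarrow> real" where "norm_matalg a = onorm (app a)"
definition sgn_matalg :: "'a matalg \<Rightarrow> 'a matalg" where "sgn_matalg a = inverse (norm a) *\<^sub>R a"
definition dist_matalg :: "'a matalg \<Rightarrow> 'a matalg \<Rightarrow> real" where "dist_matalg a b = norm (a - b)"
definition uniformity_matalg :: "('a matalg \<times> 'a matalg) filter" where
  "uniformity_matalg = (INF e\<in>{0 <..}. principal {(x, y). dist x y < e})"
definition open_matalg :: "'a matalg set \<Rightarrow> bool" where
  "open_matalg S \<longleftrightarrow> (\<forall>x\<in>S. \<forall>\<^sub>F (x', y) in uniformity. x' = x \<longrightarrow> y \<in> S)"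

lemma bounded_linear_app: "bounded_linear (app a)"
  unfolding app.rep_eq by (rule matrix_vector_mul_bounded_linear)

lemma app_add_left: "app (a + b) x = app a x + app b x"
  by transfer (simp add: matrix_vector_mult_add_rdistrib)

lemma app_scaleR_left: "app (r *\<^sub>R a) x = r *\<^sub>R app a x"
  by transfer (simp add: scaleR_matrix_vector_assoc)

lemma app_mult: "app (a * b) x = app a (app b x)"
  by transfer (simp add: matrix_vector_mul_assoc)

lemma app_one [simp]: "app 1 x = x"
  by transfer simp

lemma matalg_eqI: "a = b" if "\<And>x. app a x = app b x"
  using that by transfer (simp add: matrix_eq)

instance
proof
  fix a b :: "'a matalg" and r :: real
  show "(norm a = 0) = (a = 0)"
  proof -
    have "(norm a = 0) = (\<forall>x. app a x = 0)"
      unfolding norm_matalg_def by (rule onorm_eq_0[OF bounded_linear_app])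
    also have "\<dots> = (a = 0)"
      by transfer (metis matrix_eq matrix_vector_mult_0)
    finally show ?thesis .
  qed
  show "norm (a + b) \<le> norm a + norm b"
    unfolding norm_matalg_def using onorm_triangle[OF bounded_linear_app[of a] bounded_linear_app[of b]]
    by (simp add: app_add_left[abs_def])
  show "norm (r *\<^sub>R a) = \<bar>r\<bar> * norm a"
    unfolding norm_matalg_def app_scaleR_left[abs_def]
    by (rule onorm_scaleR[OF bounded_linear_app])
  show "sgn a = inverse (norm a) *\<^sub>R a"
    by (rule sgn_matalg_def)
qed (simp_all add: dist_matalg_def uniformity_matalg_def open_matalg_def)
end


lemma norm_app: "norm (app a x) \<le> norm a * norm x"
  unfolding norm_matalg_def by (rule onorm[OF bounded_linear_app])

lemma norm_matalg_le: "norm a \<le> b" if "\<And>x. norm (app a x) \<le> b * norm x"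
  unfolding norm_matalg_def using that by (rule onorm_le)

instance matalg :: (finite) real_normed_algebra_1
proof
  fix a b :: "'a matalg"
  show "norm (a * b) \<le> norm a * norm b"
  proof (rule norm_matalg_le)
    fix x
    have "norm (app (a * b) x) \<le> norm a * norm (app b x)"
      by (simp add: app_mult norm_app)
    also have "\<dots> \<le> norm a * (norm b * norm x)"
      by (intro mult_left_mono norm_app norm_ge_zero)
    finally show "norm (app (a * b) x) \<le> norm a * norm b * norm x"
      by (simp add: mult.assoc)
  qed
  have "app (1 :: 'a matalg) = (\<lambda>x. x)"
    by auto
  then show "norm (1 :: 'a matalg) = 1"
    unfolding norm_matalg_def using onorm_id[where 'a = "real^'a"] by simp
qed

lemma linear_of_mat: "linear of_mat"
  by (rule linearI; rule to_mat_inject[THEN iffD1])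
     (simp_all add: plus_matalg.rep_eq scaleR_matalg.rep_eq)

lemma bounded_linear_of_mat: "bounded_linear of_mat"
  using linear_of_mat linear_conv_bounded_linear by blast

text \<open>Every entry is bounded by the operator norm. Together with the continuity of
  \<open>of_mat\<close> this makes the two norms equivalent, so completeness and smoothness carry
  over between the types.\<close>

lemma bounded_linear_to_mat: "bounded_linear to_mat"
proof (rule bounded_linear_intro)
  fix a :: "'a matalg"
  have entry: "\<bar>to_mat a $ i $ j\<bar> \<le> norm a" for i j
    using matrix_component_le_onorm[of "to_mat a" i j] unfolding norm_matalg_def app.rep_eq .
  have "norm (to_mat a) \<le> (\<Sum>i\<in>UNIV. norm (to_mat a $ i))"
    by (simp add: norm_vec_def L2_set_le_sum)
  also have "\<dots> \<le> (\<Sum>i\<in>UNIV. \<Sum>j\<in>UNIV. \<bar>to_mat a $ i $ j\<bar>)"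
    by (intro sum_mono norm_le_l1_cart)
  also have "\<dots> \<le> (\<Sum>i\<in>(UNIV :: 'a set). \<Sum>j\<in>(UNIV :: 'a set). norm a)"
    by (intro sum_mono entry)
  finally show "norm (to_mat a) \<le> norm a * (real CARD('a) * real CARD('a))"
    by (simp add: mult.commute mult.left_commute)
qed (simp_all add: plus_matalg.rep_eq scaleR_matalg.rep_eq)

instance matalg :: (finite) banach
proof
  fix X :: "nat \<Rightarrow> 'a matalg"
  assume "Cauchy X"
  then have "Cauchy (\<lambda>n. to_mat (X n))"
    by (rule bounded_linear.Cauchy[OF bounded_linear_to_mat])
  then obtain l where "(\<lambda>n. to_mat (X n)) \<longlonglongrightarrow> l"
    using Cauchy_convergent convergent_def by blast
  then have "(\<lambda>n. of_mat (to_mat (X n))) \<longlonglongrightarrow> of_mat l"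
    by (rule bounded_linear.tendsto[OF bounded_linear_of_mat])
  then show "convergent X"
    by (auto simp: convergent_def)
qed

lemma bounded_bilinear_app: "bounded_bilinear app"
proof
  show "\<exists>K. \<forall>a x. norm (app a x) \<le> norm a * norm x * K"
    using norm_app by (intro exI[of _ 1]) auto
qed (simp_all add: app_add_left app_scaleR_left linear_add[OF bounded_linear.linear[OF bounded_linear_app]]
      linear_scale[OF bounded_linear.linear[OF bounded_linear_app]])

interpretation app: bounded_bilinear app
  by (rule bounded_bilinear_app)

lemma bounded_linear_matalg:
  fixes f :: "'n::finite matalg \<Rightarrow> 'b::real_normed_vector"
  assumes "linear f"
  shows "bounded_linear f"
proof -
  have "linear (\<lambda>x. f (of_mat x))"
    using linear_compose[OF linear_of_mat assms] by (simp add: o_def)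
  then have "bounded_linear (\<lambda>x. f (of_mat x))"
    using linear_conv_bounded_linear by blast
  from bounded_linear_compose[OF this bounded_linear_to_mat] show ?thesis
    by simp
qed

section \<open>Trace, adjoint and the Frobenius inner product\<close>

lemma tr_mult_commute: "tr (a * b) = tr (b * a)"
  by transfer (rule trace_mul_sym)

lemma adj_mult: "adj (a * b) = adj b * adj a"
  by transfer (rule matrix_transpose_mul)

lemma adj_adj [simp]: "adj (adj a) = a"
  by transfer simp

lemma adj_one [simp]: "adj 1 = 1"
  by transfer simp

lemma bounded_linear_tr: "bounded_linear tr"
  by (intro bounded_linear_matalg linearI; transfer; simp add: trace_def sum.distrib sum_distrib_left)

lemma bounded_linear_adj: "bounded_linear adj"
  by (intro bounded_linear_matalg linearI; transfer; simp add: transpose_def vec_eq_iff)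

lemmas tr_simps = bounded_linear.linear[OF bounded_linear_tr, THEN linear_0]
  bounded_linear.linear[OF bounded_linear_tr, THEN linear_add]
  bounded_linear.linear[OF bounded_linear_tr, THEN linear_diff]
  bounded_linear.linear[OF bounded_linear_tr, THEN linear_neg]
  bounded_linear.linear[OF bounded_linear_tr, THEN linear_scale]
  bounded_linear.linear[OF bounded_linear_tr, THEN linear_sum]

lemmas adj_simps = bounded_linear.linear[OF bounded_linear_adj, THEN linear_0]
  bounded_linear.linear[OF bounded_linear_adj, THEN linear_add]
  bounded_linear.linear[OF bounded_linear_adj, THEN linear_diff]
  bounded_linear.linear[OF bounded_linear_adj, THEN linear_neg]
  bounded_linear.linear[OF bounded_linear_adj, THEN linear_scale]
  bounded_linear.linear[OF bounded_linear_adj, THEN linear_sum]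

lemma adj_power: "adj (a ^ n) = adj a ^ n"
  by (induction n) (simp_all add: adj_mult power_commutes)

lemma inner_app: "app a x \<bullet> y = x \<bullet> app (adj a) y"
  by transfer (metis dot_lmul_matrix inner_commute transpose_matrix_vector)

text \<open>This identifies the Frobenius inner product with the Euclidean one of
  \<open>real^'n^'n\<close>, from which positivity and Cauchy-Schwarz for traces are
  inherited.\<close>

lemma tr_adj_mult: "tr (adj a * b) = to_mat a \<bullet> to_mat b"
proof (transfer)
  fix a b :: "real^'a^'a"
  have "trace (transpose a ** b) = (\<Sum>i\<in>UNIV. \<Sum>j\<in>UNIV. a $ j $ i * b $ j $ i)"
    by (simp add: trace_def matrix_matrix_mult_def transpose_def)
  also have "\<dots> = a \<bullet> b"
    by (subst sum.swap) (simp add: inner_vec_def)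
  finally show "trace (transpose a ** b) = a \<bullet> b" .
qed

lemma tr_adj_mult_ge_0: "0 \<le> tr (adj a * a)"
  by (simp add: tr_adj_mult)

lemma tr_adj_mult_eq_0: "tr (adj a * a) = 0 \<longleftrightarrow> a = 0"
  by (simp add: tr_adj_mult) (metis to_mat_inject zero_matalg.rep_eq)

lemma tr_Cauchy_Schwarz: "\<bar>tr (adj a * b)\<bar> \<le> sqrt (tr (adj a * a)) * sqrt (tr (adj b * b))"
  unfolding tr_adj_mult using Cauchy_Schwarz_ineq2[of "to_mat a" "to_mat b"]
  by (simp add: norm_eq_sqrt_inner)

section \<open>Smoothness of power series in a Banach algebra\<close>

lemma Ck_on_cong:
  assumes "open S" "\<And>x. x \<in> S \<Longrightarrow> f x = g x" "Ck_on k S f"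
  shows "Ck_on k S g"
  using assms(2,3)
proof (induction k arbitrary: f g)
  case 0
  then show ?case
    using continuous_on_cong[of S S f g] by auto
next
  case (Suc k)
  have D: "(g has_derivative frechet_derivative f (at x)) (at x)" if "x \<in> S" for x
    using Suc.prems that assms(1)
    by (metis Ck_on.simps(2) frechet_derivative_works has_derivative_transform_within_open)
  have "Ck_on k S (\<lambda>x. frechet_derivative g (at x) v)" for v
  proof (rule Suc.IH)
    show "Ck_on k S (\<lambda>x. frechet_derivative f (at x) v)"
      using Suc.prems by simp
    show "frechet_derivative f (at x) v = frechet_derivative g (at x) v" if "x \<in> S" for x
      using frechet_derivative_at[OF D[OF that]] by simp
  qed
  then show ?case
    using D by (auto simp: differentiable_def)
qed

text \<open>The coefficients of \<open>p\<close> bound the Taylor coefficients of \<open>f\<close>: the \<open>j\<close>-th derivative of \<open>f\<close>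
  has norm at most \<open>fact j * coeff p j\<close> on \<open>S\<close>, for \<open>j \<le> k\<close>. Polynomials turn the Leibniz rule
  into multiplication.\<close>

primrec majorized ::
  "nat \<Rightarrow> 'a::real_normed_vector set \<Rightarrow> ('a \<Rightarrow> 'b::real_normed_vector) \<Rightarrow> real poly \<Rightarrow> bool" where
  "majorized 0 S f p \<longleftrightarrow> (\<forall>x\<in>S. norm (f x) \<le> coeff p 0)"
| "majorized (Suc k) S f p \<longleftrightarrow> (\<forall>x\<in>S. norm (f x) \<le> coeff p 0) \<and>
     (\<exists>f'. (\<forall>x\<in>S. (f has_derivative f' x) (at x)) \<and>
           (\<forall>v. majorized k S (\<lambda>x. f' x v) (smult (norm v) (pderiv p))))"

lemma majorized_SucI:
  assumes "\<And>x. x \<in> S \<Longrightarrow> norm (f x) \<le> coeff p 0"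
    and "\<And>x. x \<in> S \<Longrightarrow> (f has_derivative f' x) (at x)"
    and "\<And>v. majorized k S (\<lambda>x. f' x v) (smult (norm v) (pderiv p))"
  shows "majorized (Suc k) S f p"
  using assms by auto

lemma majorized_bound: "majorized k S f p \<Longrightarrow> x \<in> S \<Longrightarrow> norm (f x) \<le> coeff p 0"
  by (cases k) auto

lemma majorized_Suc: "majorized (Suc k) S f p \<Longrightarrow> majorized k S f p"
proof (induction k arbitrary: f p)
  case (Suc k)
  obtain f' where f': "\<forall>x\<in>S. (f has_derivative f' x) (at x)"
    "\<And>v. majorized (Suc k) S (\<lambda>x. f' x v) (smult (norm v) (pderiv p))"
    using Suc.prems unfolding majorized.simps(2)[of "Suc k"] by blast
  have "\<forall>x\<in>S. norm (f x) \<le> coeff p 0"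
    using Suc.prems by simp
  with f'(1) Suc.IH[OF f'(2)] show ?case
    unfolding majorized.simps(2) by blast
qed auto

lemma majorized_const:
  fixes c :: "'b::real_normed_vector"
  assumes "norm c \<le> r"
  shows "majorized k S (\<lambda>x. c) [:r:]"
  using assms
proof (induction k arbitrary: c r)
  case (Suc k)
  have "majorized k S (\<lambda>x. 0 :: 'b) 0"
    using Suc.IH[of 0 0] by simp
  then show ?case
    using Suc.prems
    by (intro majorized_SucI[where f' = "\<lambda>x v. 0"]) (simp_all add: pderiv_pCons)
qed simp

lemma majorized_add:
  assumes "majorized k S f p" "majorized k S g q"
  shows "majorized k S (\<lambda>x. f x + g x) (p + q)"
  using assms
proof (induction k arbitrary: f g p q)
  case 0
  have "norm (f x + g x) \<le> coeff p 0 + coeff q 0" if "x \<in> S" for x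
    using that 0 norm_triangle_ineq[of "f x" "g x"] by fastforce
  then show ?case
    by simp
next
  case (Suc k)
  obtain f' where f': "\<forall>x\<in>S. (f has_derivative f' x) (at x)"
    "\<And>v. majorized k S (\<lambda>x. f' x v) (smult (norm v) (pderiv p))"
    using Suc.prems(1) by auto
  obtain g' where g': "\<forall>x\<in>S. (g has_derivative g' x) (at x)"
    "\<And>v. majorized k S (\<lambda>x. g' x v) (smult (norm v) (pderiv q))"
    using Suc.prems(2) by auto
  have "norm (f x + g x) \<le> coeff (p + q) 0" if "x \<in> S" for x
    using majorized_bound[OF Suc.prems(1) that] majorized_bound[OF Suc.prems(2) that]
      norm_triangle_ineq[of "f x" "g x"] by simp
  moreover have "\<forall>x\<in>S. ((\<lambda>x. f x + g x) has_derivative (\<lambda>v. f' x v + g' x v)) (at x)"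
    using f'(1) g'(1) by (intro ballI has_derivative_add) (rule bspec, assumption+)+
  moreover have "majorized k S (\<lambda>x. f' x v + g' x v) (smult (norm v) (pderiv (p + q)))" for v
    using Suc.IH[OF f'(2)[of v] g'(2)[of v]] by (simp add: pderiv_add smult_add_right)
  ultimately show ?case
    by (intro majorized_SucI[where f' = "\<lambda>x v. f' x v + g' x v"]) auto
qed

lemma majorized_mult:
  fixes f g :: "'a::real_normed_vector \<Rightarrow> 'b::real_normed_algebra"
  assumes "majorized k S f p" "majorized k S g q"
  shows "majorized k S (\<lambda>x. f x * g x) (p * q)"
  using assms
proof (induction k arbitrary: f g p q)
  case 0
  have "norm (f x * g x) \<le> coeff p 0 * coeff q 0" if "x \<in> S" for x
  proof -
    have "norm (f x * g x) \<le> norm (f x) * norm (g x)"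
      by (rule norm_mult_ineq)
    also have "\<dots> \<le> coeff p 0 * coeff q 0"
      using that 0 by (intro mult_mono' norm_ge_zero) simp_all
    finally show ?thesis .
  qed
  then show ?case
    by (auto simp: coeff_mult)
next
  case (Suc k)
  obtain f' where f': "\<forall>x\<in>S. (f has_derivative f' x) (at x)"
    "\<And>v. majorized k S (\<lambda>x. f' x v) (smult (norm v) (pderiv p))"
    using Suc.prems(1) by auto
  obtain g' where g': "\<forall>x\<in>S. (g has_derivative g' x) (at x)"
    "\<And>v. majorized k S (\<lambda>x. g' x v) (smult (norm v) (pderiv q))"
    using Suc.prems(2) by auto
  have "norm (f x * g x) \<le> coeff p 0 * coeff q 0" if "x \<in> S" for x
  proof -
    have "norm (f x * g x) \<le> norm (f x) * norm (g x)"
      by (rule norm_mult_ineq)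
    also have "\<dots> \<le> coeff p 0 * coeff q 0"
      using majorized_bound[OF Suc.prems(1) that] majorized_bound[OF Suc.prems(2) that]
      by (intro mult_mono' norm_ge_zero)
    finally show ?thesis .
  qed
  moreover have "\<forall>x\<in>S. ((\<lambda>x. f x * g x) has_derivative (\<lambda>v. f x * g' x v + f' x v * g x)) (at x)"
    using f'(1) g'(1) by (intro ballI has_derivative_mult) (rule bspec, assumption+)+
  moreover have "majorized k S (\<lambda>x. f x * g' x v + f' x v * g x) (smult (norm v) (pderiv (p * q)))" for v
  proof -
    have "majorized k S (\<lambda>x. f x * g' x v) (p * smult (norm v) (pderiv q))"
      by (rule Suc.IH[OF majorized_Suc[OF Suc.prems(1)] g'(2)])
    moreover have "majorized k S (\<lambda>x. f' x v * g x) (smult (norm v) (pderiv p) * q)"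
      by (rule Suc.IH[OF f'(2) majorized_Suc[OF Suc.prems(2)]])
    ultimately show ?thesis
      using majorized_add[of k S "\<lambda>x. f x * g' x v" "p * smult (norm v) (pderiv q)"
          "\<lambda>x. f' x v * g x" "smult (norm v) (pderiv p) * q"]
      unfolding pderiv_mult smult_add_right by (simp add: mult.commute[of q])
  qed
  ultimately show ?case
    by (intro majorized_SucI[where f' = "\<lambda>x v. f x * g' x v + f' x v * g x"]) (auto simp: coeff_mult)
qed

lemma majorized_power:
  fixes f :: "'a::real_normed_vector \<Rightarrow> 'b::real_normed_algebra_1"
  assumes "majorized k S f p"
  shows "majorized k S (\<lambda>x. f x ^ n) (p ^ n)"
proof (induction n)
  case 0
  then show ?case
    using majorized_const[of "1::'b" 1 k S] by (simp add: one_pCons)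
next
  case (Suc n)
  then show ?case
    using majorized_mult[OF assms] by simp
qed

lemma majorized_affine:
  assumes T: "bounded_linear T" and K: "\<And>x. norm (T x) \<le> norm x * K"
    and R: "\<And>x. x \<in> S \<Longrightarrow> norm (T x + b) \<le> R"
  shows "majorized k S (\<lambda>x. T x + b) [:R, K:]"
proof (cases k)
  case (Suc k')
  have "((\<lambda>x. T x + b) has_derivative T) (at x)" for x
    using has_derivative_add[OF bounded_linear_imp_has_derivative[OF T] has_derivative_const[of b]]
    by simp
  moreover have "majorized k' S (\<lambda>x. T v) (smult (norm v) (pderiv [:R, K:]))" for v
    using majorized_const[OF K[of v]] by (simp add: pderiv_pCons)
  ultimately show ?thesis
    unfolding Suc using R by (intro majorized_SucI[where f' = "\<lambda>x v. T v"]) auto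
qed (use R in auto)

text \<open>The derivative of the series in a fixed direction is a series of the same kind,
  majorized by multiples of \<open>pderiv (p n)\<close>, so the induction goes through termwise
  differentiation. Continuity of the last derivative is obtained from one further differentiation,
  hence the order \<open>Suc k\<close>. The map \<open>L\<close> is there because
  \<open>Ck_on\<close> speaks of values in a Euclidean space, whereas the series lives in the
  algebra.\<close>

lemma Ck_on_suminf_majorized:
  fixes f :: "nat \<Rightarrow> 'a::euclidean_space \<Rightarrow> 'b::banach" and L :: "'b \<Rightarrow> 'c::euclidean_space"
  assumes S: "open S" "convex S" and L: "bounded_linear L"
    and "\<And>n. majorized (Suc k) S (f n) (p n)" "\<And>j. summable (\<lambda>n. coeff (p n) j)"
  shows "Ck_on k S (\<lambda>x. L (\<Sum>n. f n x))"
  using assms(4,5)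
proof (induction k arbitrary: f p)
  \<comment> \<open>One differentiation of the series, shared by both cases of the
    induction.\<close>
  have deriv: "\<exists>f'. (\<forall>n v. majorized k S (\<lambda>x. f' n x v) (smult (norm v) (pderiv (p n)))) \<and>
      (\<forall>x\<in>S. ((\<lambda>x. L (\<Sum>n. f n x)) has_derivative (\<lambda>v. L (\<Sum>n. f' n x v))) (at x))"
    if maj: "\<And>n. majorized (Suc k) S (f n) (p n)" and summ: "\<And>j. summable (\<lambda>n. coeff (p n) j)"
    for f :: "nat \<Rightarrow> 'a \<Rightarrow> 'b" and p k
  proof -
    obtain f' where f': "\<And>n x. x \<in> S \<Longrightarrow> (f n has_derivative f' n x) (at x)"
      and f'maj: "\<And>n v. majorized k S (\<lambda>x. f' n x v) (smult (norm v) (pderiv (p n)))"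
    proof -
      have "\<forall>n. \<exists>f'. (\<forall>x\<in>S. (f n has_derivative f' x) (at x)) \<and>
          (\<forall>v. majorized k S (\<lambda>x. f' x v) (smult (norm v) (pderiv (p n))))"
        using maj by simp
      from choice[OF this] show ?thesis
        using that by blast
    qed
    have bound: "norm (f' n x v) \<le> norm v * coeff (p n) 1" if "x \<in> S" for n x v
      using majorized_bound[OF f'maj[of n v] that] by (simp add: coeff_pderiv)
    have fsum: "summable (\<lambda>n. f n x)" if "x \<in> S" for x
      by (rule summable_comparison_test'[OF summ[of 0] majorized_bound[OF maj that]])
    have f'sum: "summable (\<lambda>n. f' n x v)" if "x \<in> S" for x v
      by (rule summable_comparison_test'[OF summable_mult[OF summ[of 1], of "norm v"] bound[OF that]])
    \<comment> \<open>Weierstrass test for the derivatives: the linear coefficients of the majorants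
      bound the tail by a multiple of \<open>norm h\<close>, uniformly in \<open>x\<close>.\<close>
    have unif: "\<forall>\<^sub>F n in sequentially. \<forall>x\<in>S. \<forall>h.
        norm ((\<Sum>i<n. f' i x h) - (\<Sum>i. f' i x h)) \<le> e * norm h" if "e > 0" for e
    proof -
      have "(\<lambda>n. \<Sum>i. coeff (p (i + n)) 1) \<longlonglongrightarrow> 0"
        using suminf_exist_split2[OF summ[of 1]] .
      then have "\<forall>\<^sub>F n in sequentially. norm (\<Sum>i. coeff (p (i + n)) 1) < e"
        using that by (simp add: tendsto_iff dist_norm)
      then show ?thesis
      proof eventually_elim
        case (elim n)
        show ?case
        proof (intro ballI allI)
          fix x h assume x: "x \<in> S"
          have "norm ((\<Sum>i<n. f' i x h) - (\<Sum>i. f' i x h)) = norm (\<Sum>i. f' (i + n) x h)"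
            using suminf_split_initial_segment[OF f'sum[OF x, of h], of n]
            by (simp add: norm_minus_commute)
          also have "\<dots> \<le> (\<Sum>i. norm h * coeff (p (i + n)) 1)"
            by (intro norm_suminf_le bound x summable_mult summable_ignore_initial_segment summ)
          also have "\<dots> = norm h * (\<Sum>i. coeff (p (i + n)) 1)"
            by (intro suminf_mult summable_ignore_initial_segment summ)
          also have "\<dots> \<le> norm h * e"
            using elim by (intro mult_left_mono) auto
          finally show "norm ((\<Sum>i<n. f' i x h) - (\<Sum>i. f' i x h)) \<le> e * norm h"
            by (simp add: mult.commute)
        qed
      qed
    qed
    have "((\<lambda>x. L (\<Sum>n. f n x)) has_derivative (\<lambda>v. L (\<Sum>n. f' n x v))) (at x)" if x: "x \<in> S" for x
    proof -
      have "\<exists>g. \<forall>x\<in>S. (\<lambda>n. f n x) sums g x \<and> (g has_derivative (\<lambda>v. \<Sum>n. f' n x v)) (at x within S)"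
      proof (rule has_derivative_series[OF S(2)])
        show "(f n has_derivative f' n x) (at x within S)" if "x \<in> S" for n x
          using f'[OF that] by (rule has_derivative_at_withinI)
      qed (use unif x summable_sums[OF fsum[OF x]] in auto)
      then obtain g where g: "\<And>x. x \<in> S \<Longrightarrow> (\<lambda>n. f n x) sums g x"
        "\<And>x. x \<in> S \<Longrightarrow> (g has_derivative (\<lambda>v. \<Sum>n. f' n x v)) (at x within S)"
        by blast
      have "(g has_derivative (\<lambda>v. \<Sum>n. f' n x v)) (at x)"
        using g(2)[OF x] at_within_open[OF x S(1)] by simp
      then have "((\<lambda>x. \<Sum>n. f n x) has_derivative (\<lambda>v. \<Sum>n. f' n x v)) (at x)"
        by (rule has_derivative_transform_within_open[OF _ S(1) x]) (use g(1) sums_unique in blast)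
      then show ?thesis
        by (rule bounded_linear.has_derivative[OF L])
    qed
    with f'maj show ?thesis
      by blast
  qed
  {
    case 0
    from deriv[OF this] obtain f' where
      "\<forall>x\<in>S. ((\<lambda>x. L (\<Sum>n. f n x)) has_derivative (\<lambda>v. L (\<Sum>n. f' n x v))) (at x)"
      by blast
    then have "\<forall>x\<in>S. isCont (\<lambda>x. L (\<Sum>n. f n x)) x"
      using has_derivative_continuous by blast
    then show ?case
      by (simp add: continuous_at_imp_continuous_on)
  next
    case (Suc k)
    from deriv[OF Suc.prems] obtain f' where
      f'maj: "\<And>n v. majorized (Suc k) S (\<lambda>x. f' n x v) (smult (norm v) (pderiv (p n)))"
      and f': "\<And>x. x\<in>S \<Longrightarrow> ((\<lambda>x. L (\<Sum>n. f n x)) has_derivative (\<lambda>v. L (\<Sum>n. f' n x v))) (at x)"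
      by blast
    have "Ck_on k S (\<lambda>x. frechet_derivative (\<lambda>x. L (\<Sum>n. f n x)) (at x) v)" for v
    proof (rule Ck_on_cong[OF S(1)])
      have "summable (\<lambda>n. coeff (smult (norm v) (pderiv (p n))) j)" for j
        using summable_mult[OF Suc.prems(2)[of "Suc j"], of "norm v * real (Suc j)"]
        by (simp add: coeff_pderiv mult.assoc)
      then show "Ck_on k S (\<lambda>x. L (\<Sum>n. f' n x v))"
        by (rule Suc.IH[OF f'maj])
      show "L (\<Sum>n. f' n x v) = frechet_derivative (\<lambda>x. L (\<Sum>n. f n x)) (at x) v" if "x \<in> S" for x
        using frechet_derivative_at[OF f'[OF that]] by metis
    qed
    then show ?case
      using f' unfolding Ck_on.simps(2) differentiable_def by blast
  }
qed

section \<open>Cauchy estimates and smoothness of matrix power series\<close>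

lemma coeff_mult_nonneg:
  fixes p q :: "real poly"
  assumes "\<And>i. 0 \<le> coeff p i" "\<And>i. 0 \<le> coeff q i"
  shows "0 \<le> coeff (p * q) i"
  using assms by (simp add: coeff_mult sum_nonneg)

lemma coeff_power_nonneg:
  fixes p :: "real poly"
  assumes "\<And>i. 0 \<le> coeff p i"
  shows "0 \<le> coeff (p ^ n) i"
proof (induction n arbitrary: i)
  case 0
  then show ?case
    by (simp add: one_pCons coeff_pCons split: nat.split)
next
  case (Suc n)
  then show ?case
    using coeff_mult_nonneg[OF assms] by simp
qed

text \<open>Cauchy's estimate, which needs no complex analysis here: with nonnegative coefficients
  each term is at most the whole sum.\<close>

lemma coeff_le_poly:
  fixes p :: "real poly"
  assumes "\<And>i. 0 \<le> coeff p i" "0 < x"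
  shows "coeff p j \<le> poly p x / x ^ j"
proof (cases "j \<le> degree p")
  case True
  then have "coeff p j * x ^ j \<le> (\<Sum>i\<le>degree p. coeff p i * x ^ i)"
    using assms by (intro member_le_sum) auto
  then show ?thesis
    using assms by (simp add: poly_altdef field_simps)
next
  case False
  have "0 \<le> poly p x"
    unfolding poly_altdef using assms by (intro sum_nonneg) auto
  then show ?thesis
    using False assms by (simp add: coeff_eq_0)
qed

text \<open>Near \<open>x\<close> the \<open>n\<close>-th term is majorized by a polynomial
  \<open>p n\<close> whose value at \<epsilon> is a constant multiple of
  \<open>\<bar>a n\<bar> * \<rho> ^ n\<close>. Cauchy's estimate then makes the coefficients of each
  degree summable in \<open>n\<close>. The ball does not depend on the order, so one neighbourhood
  serves all derivatives, as \<open>smooth_on\<close> demands.\<close>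

lemma smooth_on_power_series:
  fixes T U :: "'a::euclidean_space \<Rightarrow> 'b::{real_normed_algebra_1,banach}"
    and L :: "'b \<Rightarrow> 'c::euclidean_space" and a :: "nat \<Rightarrow> real"
  assumes T: "bounded_linear T" and U: "bounded_linear U" and L: "bounded_linear L"
    and conv: "\<And>x. x \<in> D \<Longrightarrow> \<exists>\<rho> > norm (T x + b). summable (\<lambda>n. \<bar>a n\<bar> * \<rho> ^ n)"
  shows "smooth_on D (\<lambda>x. L (\<Sum>n. a n *\<^sub>R ((U x + c) * (T x + b) ^ n)))"
  unfolding smooth_on_def
proof
  fix x assume "x \<in> D"
  then obtain \<rho> where \<rho>: "norm (T x + b) < \<rho>" "summable (\<lambda>n. \<bar>a n\<bar> * \<rho> ^ n)"
    using conv by blast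
  obtain K where K: "0 < K" "\<And>x. norm (T x) \<le> norm x * K"
    using bounded_linear.pos_bounded[OF T] by blast
  obtain K' where K': "0 < K'" "\<And>x. norm (U x) \<le> norm x * K'"
    using bounded_linear.pos_bounded[OF U] by blast
  \<comment> \<open>Half of the gap to \<rho> is spent on letting the argument vary in the ball, the
    other half on evaluating the majorant at \<epsilon>; thus
    \<open>R + K * \<epsilon> = \<rho>\<close>.\<close>
  define \<epsilon> where "\<epsilon> = (\<rho> - norm (T x + b)) / (2 * K)"
  define R where "R = norm (T x + b) + \<epsilon> * K"
  define R' where "R' = norm (U x + c) + \<epsilon> * K'"
  define S where "S = ball x \<epsilon>"
  have \<epsilon>: "0 < \<epsilon>"
    using \<rho> K by (simp add: \<epsilon>_def)
  have R\<rho>: "R + K * \<epsilon> = \<rho>"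
    using K by (simp add: R_def \<epsilon>_def field_simps)
  have R: "0 \<le> R" and R': "0 \<le> R'"
    using \<epsilon> K K' by (simp_all add: R_def R'_def)
  have near: "norm (F y + d) \<le> norm (F x + d) + \<epsilon> * M"
    if "bounded_linear F" "\<And>x. norm (F x) \<le> norm x * M" "0 < M" "y \<in> S" for F :: "'a \<Rightarrow> 'b" and M d y
  proof -
    have eq: "F y + d = (F x + d) + F (y - x)"
      using bounded_linear.linear[OF that(1)] by (simp add: linear_diff)
    have "norm (F y + d) \<le> norm (F x + d) + norm (y - x) * M"
      unfolding eq
      using that(2)[of "y - x"] norm_triangle_ineq[of "F x + d" "F (y - x)"] by auto
    also have "\<dots> \<le> norm (F x + d) + \<epsilon> * M"
      using that(3,4) by (auto simp: S_def dist_norm norm_minus_commute intro!: mult_right_mono)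
    finally show ?thesis .
  qed
  define p where "p n = [:\<bar>a n\<bar>:] * ([:R', K':] * [:R, K:] ^ n)" for n
  have maj: "majorized k S (\<lambda>x. a n *\<^sub>R ((U x + c) * (T x + b) ^ n)) (p n)" for k n
  proof -
    have "majorized k S (\<lambda>x. of_real (a n) * ((U x + c) * (T x + b) ^ n)) (p n)"
      unfolding p_def
      by (intro majorized_mult majorized_power majorized_affine majorized_const T U K(2) K'(2))
         (use near[OF T K(2,1)] near[OF U K'(2,1)] in \<open>auto simp: R_def R'_def\<close>)
    then show ?thesis
      by (simp add: scaleR_conv_of_real)
  qed
  have "summable (\<lambda>n. coeff (p n) j)" for j
  proof -
    have nn: "0 \<le> coeff [:r, s:] i" if "0 \<le> r" "0 \<le> s" for r s :: real and i
      using that by (simp add: coeff_pCons split: nat.split)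
    have nonneg: "0 \<le> coeff (p n) i" for n i
      unfolding p_def
      by (intro coeff_mult_nonneg coeff_power_nonneg nn) (use R R' K K' nn[of "\<bar>a n\<bar>" 0] in auto)
    have "coeff (p n) j \<le> (\<bar>a n\<bar> * \<rho> ^ n) * ((R' + K' * \<epsilon>) / \<epsilon> ^ j)" for n
    proof -
      have "poly (p n) \<epsilon> = \<bar>a n\<bar> * ((R' + K' * \<epsilon>) * \<rho> ^ n)"
        unfolding p_def R\<rho>[symmetric] by (simp add: algebra_simps)
      then show ?thesis
        using coeff_le_poly[OF nonneg \<epsilon>, of n j] by (simp add: mult_ac)
    qed
    then show ?thesis
      using nonneg
      by (intro summable_comparison_test'[OF summable_mult2[OF \<rho>(2), of "(R' + K' * \<epsilon>) / \<epsilon> ^ j"]])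
         (simp add: abs_of_nonneg)
  qed
  then have "\<forall>k. Ck_on k S (\<lambda>x. L (\<Sum>n. a n *\<^sub>R ((U x + c) * (T x + b) ^ n)))"
    using Ck_on_suminf_majorized[OF _ _ L maj] by (simp add: S_def)
  moreover have "open S" "x \<in> S"
    using \<epsilon> by (simp_all add: S_def)
  ultimately show "\<exists>V h. open V \<and> x \<in> V \<and> (\<forall>k. Ck_on k V h) \<and>
      (\<forall>y\<in>D \<inter> V. L (\<Sum>n. a n *\<^sub>R ((U y + c) * (T y + b) ^ n)) = h y)"
    by blast
qed

section \<open>The spectral theorem for symmetric matrices\<close>

text \<open>A maximiser \<open>u\<close> of the quadratic form on the unit sphere of
  \<open>V\<close> is an eigenvector: otherwise moving along the residual
  \<open>w = l u - a u\<close>, which lies in \<open>V\<close> by invariance, would violate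
  maximality.\<close>

lemma symmetric_eigenvector:
  fixes a :: "'n::finite matalg"
  assumes adj: "adj a = a" and V: "subspace V" "V \<noteq> {0}" "\<And>x. x \<in> V \<Longrightarrow> app a x \<in> V"
  obtains u l where "u \<in> V" "norm u = 1" "app a u = l *\<^sub>R u"
proof -
  have sym: "app a x \<bullet> y = app a y \<bullet> x" for x y
    using inner_app[of a x y] adj by (simp add: inner_commute)
  have "compact (V \<inter> sphere 0 1)"
    by (intro closed_Int_compact closed_subspace V(1) compact_sphere)
  moreover obtain z where z: "z \<in> V" "z \<noteq> 0"
    using V(1,2) subspace_0 by blast
  then have "(1 / norm z) *\<^sub>R z \<in> V \<inter> sphere 0 1"
    using V(1) by (simp add: subspace_mul)
  then have "V \<inter> sphere 0 1 \<noteq> {}"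
    by blast
  moreover have "continuous_on (V \<inter> sphere 0 1) (\<lambda>x. app a x \<bullet> x)"
    by (intro continuous_intros bounded_linear.continuous_on[OF bounded_linear_app])
  ultimately have "\<exists>u\<in>V \<inter> sphere 0 1. \<forall>x\<in>V \<inter> sphere 0 1. app a x \<bullet> x \<le> app a u \<bullet> u"
    by (rule continuous_attains_sup)
  then obtain u where u: "u \<in> V" "norm u = 1"
    and max: "\<And>x. x \<in> V \<inter> sphere 0 1 \<Longrightarrow> app a x \<bullet> x \<le> app a u \<bullet> u"
    by (metis IntD1 IntD2 mem_sphere_0)
  define l where "l = app a u \<bullet> u"
  have form: "app a x \<bullet> x \<le> l * (x \<bullet> x)" if "x \<in> V" for x
  proof (cases "x = 0")
    case False
    then have "app a ((1 / norm x) *\<^sub>R x) \<bullet> ((1 / norm x) *\<^sub>R x) \<le> l"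
      unfolding l_def using that V(1) by (intro max) (simp add: subspace_mul)
    then have "(app a x \<bullet> x) / (norm x)\<^sup>2 \<le> l"
      by (simp add: app.scaleR_right power2_eq_square)
    then show ?thesis
      using False by (simp add: divide_le_eq power2_norm_eq_inner)
  qed (simp add: app.zero_right)
  define w where "w = l *\<^sub>R u - app a u"
  have w: "w \<in> V"
    using u V by (simp add: w_def subspace_diff subspace_mul)
  have uu: "u \<bullet> u = 1"
    using u(2) by (simp add: norm_eq_1)
  have wu: "w \<bullet> u = 0"
    using uu by (simp add: w_def l_def inner_diff_left)
  have auw: "app a u \<bullet> w = - (w \<bullet> w)"
    using wu by (simp add: w_def inner_diff_left inner_diff_right inner_commute)
  define c where "c = l * (w \<bullet> w) - app a w \<bullet> w"
  \<comment> \<open>The inequality \<open>form\<close> at \<open>u - s *\<^sub>R w\<close>, expanded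
    in powers of \<open>s\<close>; the constant terms cancel.\<close>
  have quad: "2 * s * (w \<bullet> w) \<le> s\<^sup>2 * c" for s
  proof -
    have "u - s *\<^sub>R w \<in> V"
      using u(1) w V(1) by (simp add: subspace_diff subspace_mul)
    from form[OF this] show ?thesis
      using sym[of w u] auw wu uu l_def
      by (simp add: app.diff_right app.scaleR_right inner_diff_left inner_diff_right inner_commute
          c_def algebra_simps power2_eq_square)
  qed
  have "w = 0"
  proof (rule ccontr)
    assume "w \<noteq> 0"
    then have pos: "0 < w \<bullet> w"
      by simp
    \<comment> \<open>Small enough that the quadratic term cannot outweigh the linear one; adding 1
      keeps the denominator positive when \<open>c = 0\<close>.\<close>
    define s where "s = (w \<bullet> w) / (\<bar>c\<bar> + 1)"
    have s: "0 < s" "s * \<bar>c\<bar> \<le> w \<bullet> w"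
      using pos by (auto simp: s_def field_simps)
    have "2 * (w \<bullet> w) \<le> s * c"
      using quad[of s] s(1) by (simp add: power2_eq_square)
    also have "\<dots> \<le> s * \<bar>c\<bar>"
      using s(1) by (intro mult_left_mono) auto
    finally show False
      using s(2) pos by simp
  qed
  then have "app a u = l *\<^sub>R u"
    by (simp add: w_def)
  then show thesis
    using that u by blast
qed

definition orthonormal_basis :: "'a::euclidean_space set \<Rightarrow> bool" where
  "orthonormal_basis B \<longleftrightarrow> finite B \<and> (\<forall>u\<in>B. \<forall>v\<in>B. u \<bullet> v = (if u = v then 1 else 0)) \<and>
     (\<forall>x. (\<Sum>u\<in>B. (u \<bullet> x) *\<^sub>R u) = x)"

text \<open>Take an orthonormal set of eigenvectors of maximal cardinality. Its orthogonal
  complement is invariant because \<open>a\<close> is symmetric, so a nonzero complement would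
  contain one more eigenvector.\<close>

theorem symmetric_eigenbasis:
  fixes a :: "'n::finite matalg"
  assumes adj: "adj a = a"
  obtains B l where "orthonormal_basis B" "\<And>u. u \<in> B \<Longrightarrow> app a u = l u *\<^sub>R u"
proof -
  define P where "P B \<longleftrightarrow> finite B \<and> (\<forall>u\<in>B. \<forall>v\<in>B. u \<bullet> v = (if u = v then 1 else 0)) \<and>
    (\<forall>u\<in>B. \<exists>l. app a u = l *\<^sub>R u)" for B
  have bound: "card B < Suc (DIM(real^'n))" if "P B" for B
  proof -
    have "0 \<notin> B" "pairwise orthogonal B"
      using that by (auto simp: P_def pairwise_def orthogonal_def) (metis inner_zero_left zero_neq_one)
    then have "independent B"
      using pairwise_orthogonal_independent by blast
    then show ?thesis
      using independent_bound by (metis le_imp_less_Suc)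
  qed
  have "P {}"
    by (simp add: P_def)
  then obtain B where B: "P B" and max: "\<And>C. P C \<Longrightarrow> card C \<le> card B"
    using ex_has_greatest_nat[of P "{}" card "Suc (DIM(real^'n))"] bound by blast
  define V where "V = {x. \<forall>u\<in>B. u \<bullet> x = 0}"
  have sub: "subspace V"
    by (auto simp: V_def subspace_def inner_add_right)
  have inv: "app a x \<in> V" if "x \<in> V" for x
  proof -
    have "u \<bullet> app a x = 0" if "u \<in> B" for u
    proof -
      obtain l where "app a u = l *\<^sub>R u"
        using B \<open>u \<in> B\<close> unfolding P_def by blast
      then show ?thesis
        using inner_app[of a u x] \<open>x \<in> V\<close> \<open>u \<in> B\<close> adj by (simp add: V_def)
    qed
    then show ?thesis
      by (simp add: V_def)
  qed
  have V0: "V = {0}"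
  proof (rule ccontr)
    assume "V \<noteq> {0}"
    then obtain u l where u: "u \<in> V" "norm u = 1" "app a u = l *\<^sub>R u"
      using symmetric_eigenvector[OF adj sub _ inv] by blast
    have "u \<bullet> u = 1"
      using u(2) by (simp add: norm_eq_1)
    moreover have "u \<notin> B"
      using u(1) \<open>u \<bullet> u = 1\<close> by (auto simp: V_def)
    ultimately have "P (insert u B)"
      using B u by (auto simp: P_def V_def inner_commute)
    then have "card (insert u B) \<le> card B"
      by (rule max)
    then show False
      using B \<open>u \<notin> B\<close> by (simp add: P_def)
  qed
  have "(\<Sum>u\<in>B. (u \<bullet> x) *\<^sub>R u) = x" for x
  proof -
    have "v \<bullet> (x - (\<Sum>u\<in>B. (u \<bullet> x) *\<^sub>R u)) = 0" if "v \<in> B" for v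
    proof -
      have "v \<bullet> (\<Sum>u\<in>B. (u \<bullet> x) *\<^sub>R u) = (\<Sum>u\<in>B. if v = u then u \<bullet> x else 0)"
        unfolding inner_sum_right
      proof (rule sum.cong[OF refl])
        fix u assume "u \<in> B"
        then have "v \<bullet> u = (if v = u then 1 else 0)"
          using B that unfolding P_def by blast
        then show "v \<bullet> ((u \<bullet> x) *\<^sub>R u) = (if v = u then u \<bullet> x else 0)"
          by simp
      qed
      also have "\<dots> = v \<bullet> x"
        using B that by (simp add: P_def)
      finally show ?thesis
        by (simp add: inner_diff_right)
    qed
    then have "x - (\<Sum>u\<in>B. (u \<bullet> x) *\<^sub>R u) \<in> V"
      by (simp add: V_def)
    then show ?thesis
      using V0 by simp
  qed
  then have "orthonormal_basis B"
    using B by (simp add: orthonormal_basis_def P_def)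
  moreover obtain l where "\<And>u. u \<in> B \<Longrightarrow> app a u = l u *\<^sub>R u"
    using B unfolding P_def by metis
  ultimately show thesis
    by (rule that)
qed

lemma orthonormal_basis_norm:
  assumes "orthonormal_basis B"
  shows "(norm (\<Sum>u\<in>B. c u *\<^sub>R u))\<^sup>2 = (\<Sum>u\<in>B. (c u)\<^sup>2)"
proof -
  have "(norm (\<Sum>u\<in>B. c u *\<^sub>R u))\<^sup>2 = (\<Sum>u\<in>B. \<Sum>v\<in>B. c u * (c v * (u \<bullet> v)))"
    by (simp add: power2_norm_eq_inner inner_sum_left inner_sum_right inner_commute
        sum_distrib_left sum_distrib_right mult_ac)
  also have "\<dots> = (\<Sum>u\<in>B. \<Sum>v\<in>B. if u = v then (c u)\<^sup>2 else 0)"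
    using assms by (intro sum.cong) (auto simp: orthonormal_basis_def power2_eq_square)
  also have "\<dots> = (\<Sum>u\<in>B. (c u)\<^sup>2)"
    using assms by (simp add: orthonormal_basis_def)
  finally show ?thesis .
qed

lemma app_orthonormal_basis:
  assumes "orthonormal_basis B"
  shows "app a x = (\<Sum>u\<in>B. (u \<bullet> x) *\<^sub>R app a u)"
proof -
  have "app a x = app a (\<Sum>u\<in>B. (u \<bullet> x) *\<^sub>R u)"
    using assms by (simp add: orthonormal_basis_def)
  then show ?thesis
    by (simp add: app.sum_right app.scaleR_right)
qed

lemma matalg_eq_orthonormal_basis:
  assumes "orthonormal_basis B" "\<And>u. u \<in> B \<Longrightarrow> app a u = app b u"
  shows "a = b"
proof (rule matalg_eqI)
  fix x
  show "app a x = app b x"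
    unfolding app_orthonormal_basis[OF assms(1), of a x] app_orthonormal_basis[OF assms(1), of b x]
    using assms(2) by simp
qed

lemma tr_orthonormal_basis:
  fixes a :: "'n::finite matalg"
  assumes B: "orthonormal_basis B"
  shows "tr a = (\<Sum>u\<in>B. app a u \<bullet> u)"
proof -
  have "tr a = (\<Sum>i\<in>UNIV. app a (axis i 1) $ i)"
    by transfer (simp add: trace_def matrix_vector_mult_basis column_def)
  also have "\<dots> = (\<Sum>i\<in>UNIV. \<Sum>u\<in>B. u $ i * app a u $ i)"
    by (subst app_orthonormal_basis[OF B]) (simp add: inner_axis)
  also have "\<dots> = (\<Sum>u\<in>B. app a u \<bullet> u)"
    by (subst sum.swap) (simp add: inner_vec_def mult.commute)
  finally show ?thesis .
qed

lemma norm_matalg_eigenbasis_le: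
  assumes B: "orthonormal_basis B" and eig: "\<And>u. u \<in> B \<Longrightarrow> app a u = l u *\<^sub>R u"
    and r: "\<And>u. u \<in> B \<Longrightarrow> \<bar>l u\<bar> \<le> r" "0 \<le> r"
  shows "norm a \<le> r"
proof (rule norm_matalg_le)
  fix x
  have "app a x = (\<Sum>u\<in>B. ((u \<bullet> x) * l u) *\<^sub>R u)"
    unfolding app_orthonormal_basis[OF B, of a x] by (intro sum.cong) (simp_all add: eig)
  then have "(norm (app a x))\<^sup>2 = (\<Sum>u\<in>B. ((u \<bullet> x) * l u)\<^sup>2)"
    using orthonormal_basis_norm[OF B] by simp
  also have "\<dots> \<le> (\<Sum>u\<in>B. r\<^sup>2 * (u \<bullet> x)\<^sup>2)"
  proof (rule sum_mono)
    fix u assume "u \<in> B"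
    then have "(l u)\<^sup>2 \<le> r\<^sup>2"
      using r(1)[OF \<open>u \<in> B\<close>] r(2) abs_le_square_iff[of "l u" r] by simp
    then have "(l u)\<^sup>2 * (u \<bullet> x)\<^sup>2 \<le> r\<^sup>2 * (u \<bullet> x)\<^sup>2"
      by (rule mult_right_mono) simp
    then show "((u \<bullet> x) * l u)\<^sup>2 \<le> r\<^sup>2 * (u \<bullet> x)\<^sup>2"
      by (simp add: power_mult_distrib mult.commute)
  qed
  also have "\<dots> = r\<^sup>2 * (norm x)\<^sup>2"
    using orthonormal_basis_norm[OF B, of "\<lambda>u. u \<bullet> x"] B
    by (simp add: orthonormal_basis_def sum_distrib_left)
  finally have "(norm (app a x))\<^sup>2 \<le> (r * norm x)\<^sup>2"
    by (simp add: power_mult_distrib)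
  then show "norm (app a x) \<le> r * norm x"
    by (rule power2_le_imp_le) (simp add: r(2))
qed

lemma app_power_eigenvector: "app a u = l *\<^sub>R u \<Longrightarrow> app (a ^ n) u = l ^ n *\<^sub>R u"
  by (induction n) (simp_all add: app_mult app.scaleR_right)

lemma app_power_series_eigenvector:
  assumes "app a u = l *\<^sub>R u" "summable (\<lambda>n. c n *\<^sub>R a ^ n)" "summable (\<lambda>n. c n * l ^ n)"
  shows "app (\<Sum>n. c n *\<^sub>R a ^ n) u = (\<Sum>n. c n * l ^ n) *\<^sub>R u"
proof -
  have "app (\<Sum>n. c n *\<^sub>R a ^ n) u = (\<Sum>n. app (c n *\<^sub>R a ^ n) u)"
    by (rule bounded_linear.suminf[OF app.bounded_linear_left assms(2)])
  also have "\<dots> = (\<Sum>n. (c n * l ^ n) *\<^sub>R u)"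
    by (simp add: app.scaleR_left app_power_eigenvector[OF assms(1)])
  also have "\<dots> = (\<Sum>n. c n * l ^ n) *\<^sub>R u"
    by (rule bounded_linear.suminf[OF bounded_linear_scaleR_left assms(3), symmetric])
  finally show ?thesis .
qed

section \<open>The power series of \<open>\<phi> / sin \<phi>\<close> and \<open>\<phi>\<^sup>2\<close> in \<open>sin\<^sup>2 (\<phi> / 2)\<close>\<close>

text \<open>In closed form \<open>4 ^ n * (fact n)\<^sup>2 / fact (2 * n + 1)\<close>: the
  coefficients, in powers of \<open>z\<^sup>2\<close>, of arcsin z / (z sqrt (1 -
  \<open>z\<^sup>2\<close>)). For z = sin (\<phi> / 2) that function is \<phi> / sin \<phi>.\<close>

primrec arc_coeff :: "nat \<Rightarrow> real" where
  "arc_coeff 0 = 1"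
| "arc_coeff (Suc n) = arc_coeff n * (2 * real n + 2) / (2 * real n + 3)"

lemma arc_coeff_pos: "0 < arc_coeff n"
  by (induction n) (auto intro!: divide_pos_pos mult_pos_pos)

lemma arc_coeff_le_1: "arc_coeff n \<le> 1"
proof (induction n)
  case (Suc n)
  have "arc_coeff n * (2 * real n + 2) \<le> 1 * (2 * real n + 3)"
    using Suc arc_coeff_pos[of n] by (intro mult_mono) auto
  then show ?case
    by (simp add: field_simps)
qed simp

lemma summable_arc_coeff: "\<bar>y\<bar> < 1 \<Longrightarrow> summable (\<lambda>n. arc_coeff n * y ^ n)"
proof (rule summable_comparison_test'[of "\<lambda>n. \<bar>y\<bar> ^ n" 0])
  show "norm (arc_coeff n * y ^ n) \<le> \<bar>y\<bar> ^ n" for n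
    using arc_coeff_le_1[of n] arc_coeff_pos[of n]
    by (simp add: abs_mult power_abs mult_left_le_one_le)
qed (simp add: summable_geometric)

definition arc_series :: "real \<Rightarrow> real" where
  "arc_series y = (\<Sum>n. arc_coeff n * y ^ n)"

text \<open>The recursion of \<open>arc_coeff\<close>, multiplied by \<open>y ^ Suc n\<close> and
  summed, is this differential equation, which \<phi> / sin \<phi> satisfies as a function of
  \<open>y = sin\<^sup>2 (\<phi> / 2)\<close>.\<close>

lemma arc_series_deriv:
  assumes "\<bar>y\<bar> < 1"
  obtains D where "(arc_series has_real_derivative D) (at y)"
    and "2 * y * (1 - y) * D + (1 - 2 * y) * arc_series y = 1"
proof
  define c where "c n = diffs arc_coeff n * y ^ n" for n
  have "((\<lambda>y. \<Sum>n. arc_coeff n * y ^ n) has_real_derivative (\<Sum>n. c n)) (at y)"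
    unfolding c_def by (rule termdiffs_strong'[of 1]) (use summable_arc_coeff assms in auto)
  then show "(arc_series has_real_derivative (\<Sum>n. c n)) (at y)"
    by (simp add: arc_series_def[abs_def])
  have c: "summable c"
    unfolding c_def by (rule termdiff_converges[where K = 1]) (use summable_arc_coeff assms in auto)
  have s: "summable (\<lambda>n. arc_coeff n * y ^ n)"
    by (rule summable_arc_coeff[OF assms])
  have cy: "(\<lambda>n. real n * arc_coeff n * y ^ n) sums (y * (\<Sum>n. c n))"
  proof -
    have "(\<lambda>n. y * c n) sums (y * (\<Sum>n. c n))"
      using c by (intro sums_mult summable_sums)
    then have "(\<lambda>n. real (Suc n) * arc_coeff (Suc n) * y ^ Suc n) sums (y * (\<Sum>n. c n))"
      by (simp add: c_def diffs_def mult_ac)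
    then show ?thesis
      using sums_Suc_iff[of "\<lambda>n. real n * arc_coeff n * y ^ n"] by simp
  qed
  have f: "(\<lambda>n. (2 * real n + 1) * arc_coeff n * y ^ n) sums (2 * (y * (\<Sum>n. c n)) + arc_series y)"
    using sums_add[OF sums_mult[OF cy, of 2] summable_sums[OF s]]
    by (simp add: arc_series_def algebra_simps)
  \<comment> \<open>The same series is summed twice: here through the recursion, and below by
    shifting the index in \<open>f\<close>, where the omitted term of index 0 accounts for the
    \<open>- 1\<close>.\<close>
  have "(\<lambda>n. (2 * real n + 3) * arc_coeff (Suc n) * y ^ Suc n) sums
      (2 * y * (y * (\<Sum>n. c n)) + 2 * y * arc_series y)"
  proof -
    have "(\<lambda>n. 2 * y * (real n * arc_coeff n * y ^ n) + 2 * y * (arc_coeff n * y ^ n)) sums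
        (2 * y * (y * (\<Sum>n. c n)) + 2 * y * arc_series y)"
      unfolding arc_series_def using cy s by (intro sums_add sums_mult summable_sums)
    moreover have "2 * y * (real n * arc_coeff n * y ^ n) + 2 * y * (arc_coeff n * y ^ n) =
        (2 * real n + 3) * arc_coeff (Suc n) * y ^ Suc n" for n
      by (simp add: field_simps)
    ultimately show ?thesis
      by simp
  qed
  moreover have "(\<lambda>n. (2 * real n + 3) * arc_coeff (Suc n) * y ^ Suc n) sums
      (2 * (y * (\<Sum>n. c n)) + arc_series y - 1)"
    using f sums_Suc_iff[of "\<lambda>n. (2 * real n + 1) * arc_coeff n * y ^ n"
        "2 * (y * (\<Sum>n. c n)) + arc_series y - 1"]
    by (simp add: algebra_simps)
  ultimately have "2 * y * (y * (\<Sum>n. c n)) + 2 * y * arc_series y = 2 * (y * (\<Sum>n. c n)) + arc_series y - 1"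
    by (rule sums_unique2)
  then show "2 * y * (1 - y) * (\<Sum>n. c n) + (1 - 2 * y) * arc_series y = 1"
    by (simp add: algebra_simps)
qed

lemma DERIV_0_imp_eq:
  fixes F :: "real \<Rightarrow> real"
  assumes "a \<le> b" "\<And>x. a \<le> x \<Longrightarrow> x \<le> b \<Longrightarrow> (F has_real_derivative 0) (at x)"
  shows "F b = F a"
proof -
  have "\<exists>c. \<forall>x\<in>{a..b}. F x = c"
    by (rule has_field_derivative_zero_constant)
       (auto intro: has_field_derivative_at_within assms(2))
  then show ?thesis
    using assms(1) by auto
qed

lemma sin_half_sq_less_1:
  assumes "0 \<le> \<phi>" "\<phi> < pi"
  shows "(sin (\<phi> / 2))\<^sup>2 < 1"
proof -
  have "0 < cos (\<phi> / 2)"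
    using assms by (intro cos_gt_zero_pi) auto
  then have "0 < (cos (\<phi> / 2))\<^sup>2"
    by simp
  then show ?thesis
    using sin_cos_squared_add[of "\<phi> / 2"] by linarith
qed

lemma DERIV_sin_half_sq: "((\<lambda>\<phi>. (sin (\<phi> / 2))\<^sup>2) has_real_derivative sin \<phi> / 2) (at \<phi>)"
  by (auto intro!: derivative_eq_intros) (use sin_double[of "\<phi> / 2"] in simp)

lemma cos_sin_half_sq: "cos \<phi> = 1 - 2 * (sin (\<phi> / 2))\<^sup>2" for \<phi> :: real
  using cos_double_sin[of "\<phi> / 2"] by simp

lemma sin_sq_sin_half_sq: "(sin \<phi>)\<^sup>2 = 4 * (sin (\<phi> / 2))\<^sup>2 * (1 - (sin (\<phi> / 2))\<^sup>2)" for \<phi> :: real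
proof -
  have "sin \<phi> = 2 * sin (\<phi> / 2) * cos (\<phi> / 2)"
    using sin_double[of "\<phi> / 2"] by simp
  then show ?thesis
    by (simp add: power_mult_distrib cos_squared_eq)
qed

text \<open>By cos \<phi> = 1 - 2 y and \<open>(sin \<phi>)\<^sup>2 = 4 * y * (1 - y)\<close> the
  differential equation says that the left side has derivative 1 in \<phi>; both sides vanish at
  0.\<close>

lemma sin_arc_series:
  assumes "0 \<le> \<phi>" "\<phi> < pi"
  shows "sin \<phi> * arc_series ((sin (\<phi> / 2))\<^sup>2) = \<phi>"
proof -
  define F where "F x = sin x * arc_series ((sin (x / 2))\<^sup>2) - x" for x
  have "(F has_real_derivative 0) (at x)" if "0 \<le> x" "x \<le> \<phi>" for x
  proof -
    define y where "y = (sin (x / 2))\<^sup>2"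
    have "\<bar>y\<bar> < 1"
      using sin_half_sq_less_1[of x] that assms by (simp add: y_def)
    then obtain D where D: "(arc_series has_real_derivative D) (at y)"
      and ode: "2 * y * (1 - y) * D + (1 - 2 * y) * arc_series y = 1"
      by (rule arc_series_deriv)
    have "((\<lambda>x. arc_series ((sin (x / 2))\<^sup>2)) has_real_derivative D * (sin x / 2)) (at x)"
      using DERIV_chain2[OF D[unfolded y_def] DERIV_sin_half_sq] .
    then have "(F has_real_derivative cos x * arc_series y + (D * (sin x / 2)) * sin x - 1) (at x)"
      unfolding F_def[abs_def] y_def by (auto intro!: derivative_eq_intros)
    moreover have "cos x * arc_series y + (D * (sin x / 2)) * sin x - 1 = 0"
    proof -
      have "D * (sin x / 2) * sin x = D * (sin x)\<^sup>2 / 2"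
        by (simp add: power2_eq_square)
      also have "\<dots> = 2 * y * (1 - y) * D"
        using sin_sq_sin_half_sq[of x] by (simp add: y_def)
      finally have "D * (sin x / 2) * sin x = 2 * y * (1 - y) * D" .
      moreover have "cos x = 1 - 2 * y"
        using cos_sin_half_sq[of x] by (simp add: y_def)
      ultimately show ?thesis
        using ode by (simp only:)
    qed
    ultimately show ?thesis
      by simp
  qed
  then have "F \<phi> = F 0"
    using assms by (intro DERIV_0_imp_eq)
  then show ?thesis
    by (simp add: F_def)
qed

text \<open>Termwise integral of \<open>4 * arc_series\<close>, without constant term: since y =
  \<open>sin\<^sup>2 (\<phi> / 2)\<close> has derivative sin \<phi> / 2, the derivative of
  \<open>\<phi>\<^sup>2\<close> with respect to y is 4 \<phi> / sin \<phi>.\<close>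

definition arc_sq_coeff :: "nat \<Rightarrow> real" where
  "arc_sq_coeff n = (if n = 0 then 0 else 4 * arc_coeff (n - 1) / n)"

lemma arc_sq_coeff_ge_0: "0 \<le> arc_sq_coeff n"
  using arc_coeff_pos[of "n - 1"] by (simp add: arc_sq_coeff_def)

lemma diffs_arc_sq_coeff: "diffs arc_sq_coeff n = 4 * arc_coeff n"
  by (simp add: diffs_def arc_sq_coeff_def)

lemma summable_arc_sq_coeff:
  assumes "\<bar>y\<bar> < 1"
  shows "summable (\<lambda>n. arc_sq_coeff n * y ^ n)"
proof (rule summable_comparison_test'[of "\<lambda>n. 4 * \<bar>y\<bar> ^ n" 0])
  show "norm (arc_sq_coeff n * y ^ n) \<le> 4 * \<bar>y\<bar> ^ n" for n
  proof -
    have "arc_sq_coeff n \<le> 4"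
      using arc_coeff_le_1[of "n - 1"] by (auto simp: arc_sq_coeff_def field_simps)
    then show ?thesis
      using arc_sq_coeff_ge_0[of n] by (simp add: abs_mult power_abs mult_right_mono)
  qed
qed (use assms in \<open>intro summable_mult, simp add: summable_geometric\<close>)

text \<open>Below \<pi> the difference of both sides has derivative 0. The endpoint \<phi> = \<pi>
  corresponds to y = 1, on the circle of convergence, and is reached through nonnegativity of the
  coefficients: partial sums at 1 are limits from the left and so at most \<open>pi\<^sup>2\<close>,
  while the full sum at 1 dominates \<open>x\<^sup>2\<close> for every x < \<pi>. The endpoint
  matters because a CS angle may equal \<pi> / 2.\<close>

lemma arc_sq_sums:
  assumes "0 \<le> \<phi>" "\<phi> \<le> pi"
  shows "(\<lambda>n. arc_sq_coeff n * (sin (\<phi> / 2))\<^sup>2 ^ n) sums \<phi>\<^sup>2"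
proof -
  define G where "G y = (\<Sum>n. arc_sq_coeff n * y ^ n)" for y
  have less: "G ((sin (\<phi> / 2))\<^sup>2) = \<phi>\<^sup>2" if \<phi>: "0 \<le> \<phi>" "\<phi> < pi" for \<phi>
  proof -
    define F where "F x = G ((sin (x / 2))\<^sup>2) - x\<^sup>2" for x
    have "(F has_real_derivative 0) (at x)" if "0 \<le> x" "x \<le> \<phi>" for x
    proof -
      define y where "y = (sin (x / 2))\<^sup>2"
      have y: "\<bar>y\<bar> < 1"
        using sin_half_sq_less_1[of x] that \<phi> by (simp add: y_def)
      have "(G has_real_derivative (\<Sum>n. diffs arc_sq_coeff n * y ^ n)) (at y)"
        unfolding G_def[abs_def]
        by (rule termdiffs_strong'[of 1]) (use summable_arc_sq_coeff y in auto)
      also have "(\<Sum>n. diffs arc_sq_coeff n * y ^ n) = 4 * arc_series y"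
        unfolding arc_series_def diffs_arc_sq_coeff mult.assoc
        by (rule suminf_mult[OF summable_arc_coeff[OF y]])
      finally have "((\<lambda>x. G ((sin (x / 2))\<^sup>2)) has_real_derivative 4 * arc_series y * (sin x / 2)) (at x)"
        unfolding y_def by (rule DERIV_chain2[OF _ DERIV_sin_half_sq])
      then have "(F has_real_derivative 4 * arc_series y * (sin x / 2) - 2 * x) (at x)"
        unfolding F_def[abs_def] by (auto intro!: derivative_eq_intros)
      moreover have "4 * arc_series y * (sin x / 2) - 2 * x = 0"
        using sin_arc_series[of x] that \<phi> by (simp add: y_def mult.commute)
      ultimately show ?thesis
        by simp
    qed
    then have "F \<phi> = F 0"
      using \<phi> by (intro DERIV_0_imp_eq)
    moreover have "G 0 = 0"
      unfolding G_def by (simp add: arc_sq_coeff_def)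
    ultimately show ?thesis
      by (simp add: F_def)
  qed
  have part: "(\<Sum>n<m. arc_sq_coeff n * (sin (\<phi> / 2))\<^sup>2 ^ n) \<le> \<phi>\<^sup>2" if \<phi>: "0 \<le> \<phi>" "\<phi> < pi" for m \<phi>
    unfolding less[OF \<phi>, symmetric] G_def
    by (rule sum_le_suminf[OF summable_arc_sq_coeff])
       (use sin_half_sq_less_1[OF \<phi>] arc_sq_coeff_ge_0 in auto)
  have part1: "(\<Sum>n<m. arc_sq_coeff n) \<le> pi\<^sup>2" for m
  proof -
    have "((\<lambda>\<phi>. \<Sum>n<m. arc_sq_coeff n * (sin (\<phi> / 2))\<^sup>2 ^ n) \<longlongrightarrow>
        (\<Sum>n<m. arc_sq_coeff n * (sin (pi / 2))\<^sup>2 ^ n)) (at_left pi)"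
      by (intro tendsto_intros) auto
    then have "(\<Sum>n<m. arc_sq_coeff n * (sin (pi / 2))\<^sup>2 ^ n) \<le> pi\<^sup>2"
    proof (rule tendsto_upperbound)
      show "\<forall>\<^sub>F \<phi> in at_left pi. (\<Sum>n<m. arc_sq_coeff n * (sin (\<phi> / 2))\<^sup>2 ^ n) \<le> pi\<^sup>2"
        unfolding eventually_at_left[OF pi_gt_zero]
      proof (intro exI[of _ 0] conjI allI impI pi_gt_zero)
        fix \<phi> :: real assume "0 < \<phi>" "\<phi> < pi"
        then have "(\<Sum>n<m. arc_sq_coeff n * (sin (\<phi> / 2))\<^sup>2 ^ n) \<le> \<phi>\<^sup>2"
          by (intro part) auto
        also have "\<dots> \<le> pi\<^sup>2"
          using \<open>0 < \<phi>\<close> \<open>\<phi> < pi\<close> by (intro power_mono) auto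
        finally show "(\<Sum>n<m. arc_sq_coeff n * (sin (\<phi> / 2))\<^sup>2 ^ n) \<le> pi\<^sup>2" .
      qed
    qed simp
    then show ?thesis
      by simp
  qed
  have summ: "summable arc_sq_coeff"
    by (rule summableI_nonneg_bounded[OF arc_sq_coeff_ge_0 part1])
  show ?thesis
  proof (cases "\<phi> < pi")
    case True
    then show ?thesis
      using less[of \<phi>] assms(1) sin_half_sq_less_1[OF assms(1) True]
      unfolding G_def by (metis abs_of_nonneg summable_arc_sq_coeff summable_sums zero_le_power2)
  next
    case False
    then have [simp]: "\<phi> = pi"
      using assms by simp
    have "x\<^sup>2 \<le> suminf arc_sq_coeff" if x: "0 \<le> x" "x < pi" for x
    proof -
      have lt: "\<bar>(sin (x / 2))\<^sup>2\<bar> < 1"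
        using sin_half_sq_less_1[OF x] by simp
      show ?thesis
        unfolding less[OF x, symmetric] G_def
        by (intro suminf_le summable_arc_sq_coeff[OF lt] summ mult_left_le arc_sq_coeff_ge_0)
           (use lt in \<open>auto intro: power_le_one[of "(sin (x / 2))\<^sup>2"]\<close>)
    qed
    then have "\<forall>\<^sub>F x in at_left pi. x\<^sup>2 \<le> suminf arc_sq_coeff"
      unfolding eventually_at_left[OF pi_gt_zero] by (intro exI[of _ 0]) auto
    then have "pi\<^sup>2 \<le> suminf arc_sq_coeff"
      by (intro tendsto_upperbound[of "\<lambda>x. x\<^sup>2" "pi\<^sup>2" "at_left pi"] tendsto_intros) auto
    moreover have "suminf arc_sq_coeff \<le> pi\<^sup>2"
      by (intro suminf_le_const[OF summ] part1)
    ultimately have "suminf arc_sq_coeff = pi\<^sup>2"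
      by simp
    then show ?thesis
      using summable_sums[OF summ] by simp
  qed
qed

lemma summable_arc_sq_coeff_1: "summable arc_sq_coeff"
  using arc_sq_sums[of pi] by (simp add: sums_iff)

text \<open>The truncation error is a power series in y with nonnegative coefficients, hence largest
  at y = 1; this makes the bound uniform in the angle.\<close>

lemma arc_sq_partial_sum_bounds:
  assumes "0 \<le> \<phi>" "\<phi> \<le> pi"
  shows "\<phi>\<^sup>2 \<le> (\<Sum>n<m. arc_sq_coeff n * (sin (\<phi> / 2))\<^sup>2 ^ n) + (\<Sum>n. arc_sq_coeff (n + m))"
proof -
  define y where "y = (sin (\<phi> / 2))\<^sup>2"
  have y: "0 \<le> y" "y \<le> 1"
    by (simp_all add: y_def abs_square_le_1)
  note s = arc_sq_sums[OF assms, folded y_def]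
  have "\<phi>\<^sup>2 = (\<Sum>n. arc_sq_coeff (n + m) * y ^ (n + m)) + (\<Sum>n<m. arc_sq_coeff n * y ^ n)"
    using suminf_split_initial_segment[OF sums_summable[OF s], of m] sums_unique[OF s] by simp
  moreover have "(\<Sum>n. arc_sq_coeff (n + m) * y ^ (n + m)) \<le> (\<Sum>n. arc_sq_coeff (n + m))"
    using y summable_ignore_initial_segment[OF summable_arc_sq_coeff_1, of m]
      summable_ignore_initial_segment[OF sums_summable[OF s], of m]
    by (intro suminf_le mult_left_le arc_sq_coeff_ge_0 power_le_one)
  ultimately show ?thesis
    by (simp add: y_def)
qed

text \<open>For the full series in place of its partial sums, this is the identity
  \<open>(sin \<phi> * arc_series y)\<^sup>2 = \<phi>\<^sup>2\<close> with \<open>y = sin\<^sup>2 (\<phi> / 2)\<close>.\<close>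

lemma arc_sq_partial_sum_deriv_bound:
  assumes y: "0 \<le> y" "y \<le> 1"
  shows "y * (1 - y) * (\<Sum>n<m. diffs arc_sq_coeff n * y ^ n)\<^sup>2
    \<le> 4 * ((\<Sum>n<Suc m. arc_sq_coeff n * y ^ n) + (\<Sum>n. arc_sq_coeff (n + Suc m)))"
proof -
  define \<phi> where "\<phi> = 2 * arcsin (sqrt y)"
  have "0 \<le> arcsin (sqrt y)" "arcsin (sqrt y) \<le> pi / 2"
    using y order_trans[of "-1" 0 "sqrt y"] arcsin_le_arcsin[of 0 "sqrt y"] arcsin_bounded[of "sqrt y"] by auto
  then have \<phi>: "0 \<le> \<phi>" "\<phi> \<le> pi"
    by (simp_all add: \<phi>_def)
  have y\<phi>: "y = (sin (\<phi> / 2))\<^sup>2"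
    using y by (simp add: \<phi>_def sin_arcsin order_trans[of "-1" 0])
  \<comment> \<open>For \<phi> < \<pi> all terms are nonnegative, so truncation only lowers
    \<open>arc_series y\<close> in \<open>sin_arc_series\<close>. For \<phi> = \<pi> the factor
    \<open>1 - y\<close> makes the left side 0.\<close>
  have "y * (1 - y) * (\<Sum>n<m. diffs arc_sq_coeff n * y ^ n)\<^sup>2 \<le> 4 * \<phi>\<^sup>2"
  proof (cases "\<phi> < pi")
    case True
    have y1: "\<bar>y\<bar> < 1"
      using sin_half_sq_less_1[OF \<phi>(1) True] y\<phi> by simp
    have sp: "(\<Sum>n<m. arc_coeff n * y ^ n) \<le> arc_series y"
      unfolding arc_series_def using summable_arc_coeff[OF y1] y arc_coeff_pos
      by (intro sum_le_suminf) (auto simp: less_imp_le)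
    have "0 \<le> (\<Sum>n<m. arc_coeff n * y ^ n)"
      using y arc_coeff_pos by (intro sum_nonneg) (auto simp: less_imp_le)
    with sp have "(\<Sum>n<m. arc_coeff n * y ^ n)\<^sup>2 \<le> (arc_series y)\<^sup>2"
      by (intro power_mono)
    then have "y * (1 - y) * (16 * (\<Sum>n<m. arc_coeff n * y ^ n)\<^sup>2) \<le> y * (1 - y) * (16 * (arc_series y)\<^sup>2)"
      using y by (intro mult_left_mono) auto
    also have "\<dots> = 4 * (sin \<phi> * arc_series y)\<^sup>2"
      using sin_sq_sin_half_sq[of \<phi>] by (simp add: y\<phi>[symmetric] power_mult_distrib)
    also have "\<dots> = 4 * \<phi>\<^sup>2"
      using sin_arc_series[OF \<phi>(1) True] by (simp add: y\<phi>)
    finally show ?thesis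
      by (simp add: diffs_arc_sq_coeff mult.assoc power_mult_distrib flip: sum_distrib_left)
  next
    case False
    then have "y = 1"
      using \<phi> y\<phi> by simp
    then show ?thesis
      by simp
  qed
  also have "\<dots> \<le> 4 * ((\<Sum>n<Suc m. arc_sq_coeff n * y ^ n) + (\<Sum>n. arc_sq_coeff (n + Suc m)))"
    using arc_sq_partial_sum_bounds[OF \<phi>, of "Suc m"] unfolding y\<phi>[symmetric] by (intro mult_left_mono) auto
  finally show ?thesis .
qed

section \<open>Geodesics of the Grassmannian\<close>

lemma exp_conj_involution:
  fixes q a :: "'a::{real_normed_algebra_1,banach}"
  assumes "q * q = 1"
  shows "exp (q * a * q) = q * exp a * q"
proof -
  have pow: "(q * a * q) ^ n = q * a ^ n * q" for n
  proof (induction n)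
    case (Suc n)
    have "(q * a * q) ^ Suc n = q * a * (q * q) * a ^ n * q"
      using Suc by (simp add: mult.assoc)
    then show ?case
      using assms by (simp add: mult.assoc)
  qed (use assms in simp)
  have "q * exp a * q = q * (\<Sum>n. a ^ n /\<^sub>R fact n) * q"
    by (simp add: exp_def)
  also have "\<dots> = (\<Sum>n. q * (a ^ n /\<^sub>R fact n) * q)"
    by (rule bounded_linear.suminf[OF bounded_linear_compose[OF bounded_linear_mult_left
          bounded_linear_mult_right] summable_exp_generic])
  also have "\<dots> = exp (q * a * q)"
    by (simp add: exp_def pow)
  finally show ?thesis ..
qed

lemma adj_exp: "adj (exp a) = exp (adj a)"
  unfolding exp_def
  by (subst bounded_linear.suminf[OF bounded_linear_adj summable_exp_generic])
     (simp add: adj_simps adj_power)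

section \<open>Reflections and the curves \<open>q exp (t q x)\<close>\<close>

definition reflection :: "'n::finite matalg \<Rightarrow> bool" where
  "reflection q \<longleftrightarrow> adj q = q \<and> q * q = 1"

lemma Grassmannian_iff:
  "M \<in> Grassmannian k \<longleftrightarrow> reflection (of_mat M) \<and> tr (of_mat M) = 2 * real k - real CARD('n)"
  for M :: "real^'n::finite^'n"
proof -
  have "adj (of_mat M) = of_mat M \<longleftrightarrow> transpose M = M"
    by (metis adj.rep_eq to_mat_inject of_mat_inverse[OF UNIV_I])
  moreover have "of_mat M * of_mat M = 1 \<longleftrightarrow> M ** M = mat 1"
    by (metis times_matalg.rep_eq one_matalg.rep_eq to_mat_inject of_mat_inverse[OF UNIV_I])
  moreover have "tr (of_mat M) = trace M"
    by (simp add: tr.rep_eq)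
  ultimately show ?thesis
    unfolding Grassmannian_def reflection_def by (auto simp: orthogonal_matrix)
qed

lemma reflection_cancel: "reflection q \<Longrightarrow> q * (q * y) = y"
  by (simp add: reflection_def flip: mult.assoc)

definition tangent_at :: "'n::finite matalg \<Rightarrow> 'n matalg \<Rightarrow> bool" where
  "tangent_at q x \<longleftrightarrow> adj x = x \<and> x * q = - (q * x)"

definition geodesic_curve :: "'n::finite matalg \<Rightarrow> 'n matalg \<Rightarrow> real \<Rightarrow> 'n matalg" where
  "geodesic_curve q x t = q * exp (t *\<^sub>R (q * x))"

context
  fixes q x :: "'n::finite matalg"
  assumes q: "reflection q" and x: "tangent_at q x"
begin

lemma reflection_square: "q * q = 1" and adj_reflection: "adj q = q" and adj_tangent: "adj x = x" and tangent_anticommute: "x * q = - (q * x)"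
  using q x by (auto simp: reflection_def tangent_at_def)

lemma reflection_conj_tangent: "q * (q * x) * q = - (q * x)"
  by (simp add: reflection_cancel[OF q] tangent_anticommute)

text \<open>Conjugation by \<open>q\<close> negates \<open>q * x\<close> and therefore inverts its
  exponential. Both the symmetry and the involutivity of \<open>geodesic_curve\<close> rest on
  this.\<close>

lemma reflection_conj_exp: "q * exp (t *\<^sub>R (q * x)) * q = exp (- (t *\<^sub>R (q * x)))"
  using exp_conj_involution[OF reflection_square, of "t *\<^sub>R (q * x)"] reflection_conj_tangent by (simp add: mult.assoc)

lemma geodesic_curve_0: "geodesic_curve q x 0 = q"
  by (simp add: geodesic_curve_def)

lemma geodesic_curve_derivative:
  "(geodesic_curve q x has_vector_derivative geodesic_curve q x t * (q * x)) (at t within S)"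
  unfolding geodesic_curve_def[abs_def] mult.assoc
  by (intro has_vector_derivative_mult_right exp_scaleR_has_vector_derivative_right)

lemma reflection_geodesic_curve: "reflection (geodesic_curve q x t)"
proof -
  have "adj (geodesic_curve q x t) = exp (- (t *\<^sub>R (q * x))) * q"
    by (simp add: geodesic_curve_def adj_mult adj_exp adj_simps adj_tangent adj_reflection tangent_anticommute)
  also have "\<dots> = geodesic_curve q x t"
    by (simp add: reflection_conj_exp[symmetric] geodesic_curve_def mult.assoc reflection_square)
  finally have "adj (geodesic_curve q x t) = geodesic_curve q x t" .
  moreover have "geodesic_curve q x t * geodesic_curve q x t = exp (- (t *\<^sub>R (q * x))) * exp (t *\<^sub>R (q * x))"
    by (simp add: geodesic_curve_def reflection_conj_exp[symmetric] mult.assoc)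
  then have "geodesic_curve q x t * geodesic_curve q x t = 1"
    using exp_minus_inverse[of "- (t *\<^sub>R (q * x))"] by simp
  ultimately show ?thesis
    by (simp add: reflection_def)
qed

lemma geodesic_curve_anticommute: "q * x * geodesic_curve q x t = - (geodesic_curve q x t * (q * x))"
proof -
  have "q * x * geodesic_curve q x t = q * (x * q) * exp (t *\<^sub>R (q * x))"
    by (simp add: geodesic_curve_def mult.assoc)
  also have "\<dots> = - (q * ((q * x) * exp (t *\<^sub>R (q * x))))"
    by (simp add: tangent_anticommute mult.assoc)
  also have "\<dots> = - (q * (exp (t *\<^sub>R (q * x)) * (q * x)))"
    by (simp only: exp_times_scaleR_commute)
  finally show ?thesis
    by (simp add: geodesic_curve_def mult.assoc)
qed

text \<open>The velocity is \<open>geodesic_curve q x t * (q * x)\<close>, a product of two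
  anticommuting factors, so its trace vanishes by cyclicity.\<close>

lemma tr_geodesic_curve: "tr (geodesic_curve q x t) = tr q"
proof -
  have zero: "tr (geodesic_curve q x s * (q * x)) = 0" for s
    using tr_mult_commute[of "geodesic_curve q x s" "q * x"] geodesic_curve_anticommute[of s]
    by (simp add: tr_simps)
  have "((\<lambda>s. tr (geodesic_curve q x s)) has_vector_derivative 0) (at s within UNIV)" for s
    using bounded_linear.has_vector_derivative[OF bounded_linear_tr geodesic_curve_derivative, of s UNIV]
    by (simp add: zero)
  then obtain c where "\<And>s. tr (geodesic_curve q x s) = c"
    using has_vector_derivative_zero_constant[of UNIV "\<lambda>s. tr (geodesic_curve q x s)"] by auto
  then show ?thesis
    using geodesic_curve_0 by metis
qed

end

lemma smooth_on_exp:
  fixes T :: "'a::euclidean_space \<Rightarrow> 'b::{real_normed_algebra_1,banach}"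
    and L :: "'b \<Rightarrow> 'c::euclidean_space"
  assumes T: "bounded_linear T" and L: "bounded_linear L"
  shows "smooth_on D (\<lambda>x. L (q * exp (T x)))"
proof -
  have "smooth_on D (\<lambda>x. L (\<Sum>n. (1 / fact n) *\<^sub>R ((0 + q) * (T x + 0) ^ n)))"
  proof (rule smooth_on_power_series[OF T bounded_linear_zero L])
    fix x
    show "\<exists>\<rho>>norm (T x + 0). summable (\<lambda>n. \<bar>1 / fact n\<bar> * \<rho> ^ n)"
      using summable_exp[of "norm (T x) + 1"] by (intro exI[of _ "norm (T x) + 1"]) (simp add: inverse_eq_divide)
  qed
  moreover have "(\<Sum>n. (1 / fact n) *\<^sub>R ((0 + q) * (T x + 0) ^ n)) = q * exp (T x)" for x
    using suminf_mult[OF summable_exp_generic[of "T x"], of q]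
    by (simp add: exp_def inverse_eq_divide)
  ultimately show ?thesis
    by simp
qed

lemma smooth_on_geodesic_curve: "smooth_on S (\<lambda>t. to_mat (geodesic_curve q x t))"
  unfolding geodesic_curve_def
  by (rule smooth_on_exp[OF bounded_linear_scaleR_left bounded_linear_to_mat])

lemma geodesic_curve_in_Grassmannian:
  assumes "M \<in> Grassmannian k" "tangent_at (of_mat M) x"
  shows "to_mat (geodesic_curve (of_mat M) x t) \<in> Grassmannian k"
  using assms reflection_geodesic_curve[OF _ assms(2)] tr_geodesic_curve[OF _ assms(2)]
  by (simp add: Grassmannian_iff)

section \<open>Tangent spaces and the classification of geodesics\<close>

lemma smooth_on_has_vector_derivative:
  fixes c :: "real \<Rightarrow> 'a::euclidean_space"
  assumes "smooth_on I c" "open I" "t \<in> I"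
  shows "(c has_vector_derivative vector_derivative c (at t)) (at t)"
    and "((\<lambda>s. vector_derivative c (at s)) has_vector_derivative
           vector_derivative (\<lambda>s. vector_derivative c (at s)) (at t)) (at t)"
proof -
  obtain U h where U: "open U" "t \<in> U" and h: "\<And>k. Ck_on k U h" and ch: "\<And>s. s \<in> I \<inter> U \<Longrightarrow> c s = h s"
    using bspec[OF assms(1)[unfolded smooth_on_def] assms(3)] by auto
  have I: "open (I \<inter> U)" "t \<in> I \<inter> U"
    using assms(2,3) U by auto
  define d where "d s = frechet_derivative h (at s) 1" for s
  have "(h has_vector_derivative d s) (at s)" if "s \<in> U" for s
  proof -
    have "h differentiable (at s)"
      using h[of 1] that by simp
    then show ?thesis
      using vector_derivative_works[of h "at s"]
      by (simp add: d_def frechet_derivative_eq_vector_derivative)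
  qed
  then have c: "(c has_vector_derivative d s) (at s)" if "s \<in> I \<inter> U" for s
    by (rule has_vector_derivative_transform_within_open[OF _ I(1) that]) (use ch that in auto)
  have vd: "vector_derivative c (at s) = d s" if "s \<in> I \<inter> U" for s
    by (rule vector_derivative_at[OF c[OF that]])
  show "(c has_vector_derivative vector_derivative c (at t)) (at t)"
    using c[OF I(2)] vd[OF I(2)] by simp
  have "d differentiable (at t)"
    using h[of 2] U(2) unfolding d_def by (simp add: numeral_2_eq_2)
  then have "(d has_vector_derivative vector_derivative d (at t)) (at t)"
    by (simp add: vector_derivative_works)
  then have dd: "((\<lambda>s. vector_derivative c (at s)) has_vector_derivative vector_derivative d (at t)) (at t)"
    by (rule has_vector_derivative_transform_within_open[OF _ I]) (simp add: vd)
  then show "((\<lambda>s. vector_derivative c (at s)) has_vector_derivative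
      vector_derivative (\<lambda>s. vector_derivative c (at s)) (at t)) (at t)"
    using vector_derivative_at[OF dd] by simp
qed

lemma has_vector_derivative_const_on_open:
  assumes "(f has_vector_derivative v) (at t)" "open I" "t \<in> I" "\<And>s. s \<in> I \<Longrightarrow> f s = k"
  shows "v = 0"
proof -
  have "((\<lambda>s. k) has_vector_derivative v) (at t)"
    by (rule has_vector_derivative_transform_within_open[OF assms(1,2,3)]) (use assms(4) in auto)
  then show ?thesis
    by (rule vector_derivative_unique_at[OF _ has_vector_derivative_const])
qed

lemma has_vector_derivative_of_mat:
  "(c has_vector_derivative v) F \<Longrightarrow> ((\<lambda>s. of_mat (c s)) has_vector_derivative of_mat v) F"
  by (rule bounded_linear.has_vector_derivative[OF bounded_linear_of_mat])

lemma reflection_curve_derivative: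
  assumes c: "(c has_vector_derivative d) (at t)" and I: "open I" "t \<in> I"
    and refl: "\<And>s. s \<in> I \<Longrightarrow> reflection (c s)"
  shows "tangent_at (c t) d"
proof -
  have "((\<lambda>s. adj (c s) - c s) has_vector_derivative adj d - d) (at t)"
    by (intro has_vector_derivative_diff c bounded_linear.has_vector_derivative[OF bounded_linear_adj])
  then have "adj d - d = 0"
    by (rule has_vector_derivative_const_on_open[OF _ I, where k = 0]) (use refl in \<open>simp add: reflection_def\<close>)
  moreover have "((\<lambda>s. c s * c s) has_vector_derivative c t * d + d * c t) (at t)"
    by (rule has_vector_derivative_mult[OF c c])
  then have "c t * d + d * c t = 0"
    by (rule has_vector_derivative_const_on_open[OF _ I, where k = 1]) (use refl in \<open>simp add: reflection_def\<close>)
  ultimately show ?thesis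
    by (simp add: tangent_at_def eq_neg_iff_add_eq_0 add.commute)
qed

text \<open>One direction differentiates \<open>c = adj c\<close> and \<open>c * c = 1\<close>; for
  the other, the geodesic curve itself is a smooth curve with the prescribed velocity.\<close>

lemma tangent_space_Grassmannian:
  "v \<in> tangent_space (Grassmannian k) M \<longleftrightarrow> M \<in> Grassmannian k \<and> tangent_at (of_mat M) (of_mat v)"
proof
  assume "v \<in> tangent_space (Grassmannian k) M"
  then obtain c \<epsilon> where c: "\<epsilon> > 0" "c ` {-\<epsilon><..<\<epsilon>} \<subseteq> Grassmannian k" "c 0 = M"
    "(c has_vector_derivative v) (at (0::real))"
    unfolding tangent_space_def by blast
  have "tangent_at (of_mat (c 0)) (of_mat v)"
  proof (rule reflection_curve_derivative[OF has_vector_derivative_of_mat[OF c(4)], of "{-\<epsilon><..<\<epsilon>}"])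
    show "reflection (of_mat (c s))" if "s \<in> {-\<epsilon><..<\<epsilon>}" for s
      using subsetD[OF c(2) imageI[OF that]] by (simp add: Grassmannian_iff)
  qed (use c(1) in auto)
  then show "M \<in> Grassmannian k \<and> tangent_at (of_mat M) (of_mat v)"
    using c by force
next
  assume *: "M \<in> Grassmannian k \<and> tangent_at (of_mat M) (of_mat v)"
  define c where "c t = to_mat (geodesic_curve (of_mat M) (of_mat v) t)" for t
  have q: "reflection (of_mat M)"
    using * by (simp add: Grassmannian_iff)
  have "(c has_vector_derivative to_mat (geodesic_curve (of_mat M) (of_mat v) 0 * (of_mat M * of_mat v))) (at 0)"
    unfolding c_def[abs_def] using * q
    by (intro bounded_linear.has_vector_derivative[OF bounded_linear_to_mat] geodesic_curve_derivative) auto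
  moreover have "geodesic_curve (of_mat M) (of_mat v) 0 * (of_mat M * of_mat v) = of_mat v"
    using * q by (simp add: geodesic_curve_0 reflection_cancel)
  ultimately have "(c has_vector_derivative v) (at 0)"
    by simp
  moreover have "smooth_on {-1<..<1} c"
    unfolding c_def by (rule smooth_on_geodesic_curve)
  moreover have "c ` {-1<..<1} \<subseteq> Grassmannian k"
    using * by (auto simp: c_def intro: geodesic_curve_in_Grassmannian)
  moreover have "c 0 = M"
    using * q by (simp add: c_def geodesic_curve_0)
  ultimately show "v \<in> tangent_space (Grassmannian k) M"
    unfolding tangent_space_def using zero_less_one by blast
qed

lemma linear_ode_unique:
  fixes c :: "real \<Rightarrow> 'a::{real_normed_algebra_1,banach}"
  assumes "\<And>t. t \<in> {a<..<b} \<Longrightarrow> (c has_vector_derivative c t * A) (at t)" "0 \<in> {a<..<b}" "t \<in> {a<..<b}"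
  shows "c t = c 0 * exp (t *\<^sub>R A)"
proof -
  have "((\<lambda>t. c t * exp (t *\<^sub>R (- A))) has_vector_derivative 0) (at s within {a<..<b})"
    if "s \<in> {a<..<b}" for s
  proof -
    have "((\<lambda>t. c t * exp (t *\<^sub>R (- A))) has_vector_derivative
        c s * (- A * exp (s *\<^sub>R (- A))) + (c s * A) * exp (s *\<^sub>R (- A))) (at s)"
      by (intro has_vector_derivative_mult assms(1) that exp_scaleR_has_vector_derivative_left)
    then show ?thesis
      by (simp add: mult.assoc has_vector_derivative_at_within)
  qed
  then obtain k where k: "\<And>s. s \<in> {a<..<b} \<Longrightarrow> c s * exp (s *\<^sub>R (- A)) = k"
    using has_vector_derivative_zero_constant[of "{a<..<b}" "\<lambda>t. c t * exp (t *\<^sub>R (- A))"] by auto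
  have "c t * exp (t *\<^sub>R (- A)) = c 0"
    using k[OF assms(2)] k[OF assms(3)] by simp
  then have "c t * (exp (- (t *\<^sub>R A)) * exp (t *\<^sub>R A)) = c 0 * exp (t *\<^sub>R A)"
    by (simp flip: mult.assoc)
  then show ?thesis
    using exp_minus_inverse[of "- (t *\<^sub>R A)"] by simp
qed

text \<open>An acceleration \<open>dd\<close> orthogonal to the tangent space commutes with
  \<open>p\<close>. Differentiating \<open>p d + d p = 0\<close> then gives
  \<open>p dd + d d = 0\<close>, which says that \<open>p d\<close> is constant, and the linear
  equation \<open>d = p A\<close> determines the curve.\<close>

lemma geodesic_on_Grassmannian:
  assumes geo: "geodesic_on trace_metric (Grassmannian k) {a<..<b} c" and "0 \<in> {a<..<b}" "t \<in> {a<..<b}"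
  shows "of_mat (c t) = geodesic_curve (of_mat (c 0)) (of_mat (vector_derivative c (at 0))) t"
proof -
  define p where "p s = of_mat (c s)" for s
  define d where "d s = of_mat (vector_derivative c (at s))" for s
  define dd where "dd s = of_mat (vector_derivative (\<lambda>s. vector_derivative c (at s)) (at s))" for s
  let ?I = "{a<..<b}"
  have smooth: "smooth_on ?I c" and inG: "\<And>s. s \<in> ?I \<Longrightarrow> c s \<in> Grassmannian k"
    using geo by (auto simp: geodesic_on_def)
  have refl: "reflection (p s)" if "s \<in> ?I" for s
    using inG[OF that] by (simp add: p_def Grassmannian_iff)
  have dp: "(p has_vector_derivative d s) (at s)" if "s \<in> ?I" for s
    unfolding p_def[abs_def] d_def
    by (intro has_vector_derivative_of_mat smooth_on_has_vector_derivative[OF smooth] that open_greaterThanLessThan)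
  have ddp: "(d has_vector_derivative dd s) (at s)" if "s \<in> ?I" for s
    unfolding d_def[abs_def] dd_def
    by (intro has_vector_derivative_of_mat smooth_on_has_vector_derivative[OF smooth] that open_greaterThanLessThan)
  have tan: "tangent_at (p s) (d s)" if "s \<in> ?I" for s
    by (rule reflection_curve_derivative[OF dp[OF that] _ that refl]) auto
  have const: "((\<lambda>s. p s * d s) has_vector_derivative 0) (at s)" if s: "s \<in> ?I" for s
  proof -
    have pp: "p s * p s = 1" "p s * (p s * y) = y" for y
      using refl[OF s] reflection_cancel[OF refl[OF s]] by (auto simp: reflection_def)
    have adj_p: "adj (p s) = p s"
      using refl[OF s] by (simp add: reflection_def)
    have "((\<lambda>s. adj (d s) - d s) has_vector_derivative adj (dd s) - dd s) (at s)"
      by (intro has_vector_derivative_diff ddp s bounded_linear.has_vector_derivative[OF bounded_linear_adj])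
    then have "adj (dd s) - dd s = 0"
      by (rule has_vector_derivative_const_on_open[OF _ _ s, where k = 0])
         (use tan in \<open>auto simp: tangent_at_def\<close>)
    then have adj_dd: "adj (dd s) = dd s"
      by simp
    have "((\<lambda>s. p s * d s + d s * p s) has_vector_derivative
        (p s * dd s + d s * d s) + (d s * d s + dd s * p s)) (at s)"
      by (intro has_vector_derivative_add has_vector_derivative_mult dp ddp s)
    then have eq: "(p s * dd s + d s * d s) + (d s * d s + dd s * p s) = 0"
      by (rule has_vector_derivative_const_on_open[OF _ _ s, where k = 0])
         (use tan in \<open>auto simp: tangent_at_def\<close>)
    \<comment> \<open>Twice the tangential component of the acceleration: the part anticommuting
      with \<open>p\<close>. Testing the geodesic equation against it gives
      \<open>tr (N * N) = 2 * tr (dd s * N) = 0\<close>, hence \<open>N = 0\<close>.\<close>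
    define N where "N = dd s - p s * dd s * p s"
    have Np: "N * p s = - (p s * N)"
      by (simp add: N_def algebra_simps pp)
    have "adj N = N"
      by (simp add: N_def adj_simps adj_mult adj_dd adj_p mult.assoc)
    then have "tangent_at (p s) N"
      using Np by (simp add: tangent_at_def)
    then have "to_mat N \<in> tangent_space (Grassmannian k) (c s)"
      using inG[OF s] by (simp add: tangent_space_Grassmannian p_def)
    then have trN: "tr (dd s * N) = 0"
      using geo s unfolding geodesic_on_def trace_metric_def
      by (auto simp: dd_def tr.rep_eq times_matalg.rep_eq)
    have pN: "p s * N = - (N * p s)"
      using Np by simp
    have "tr (p s * dd s * p s * N) = tr (dd s * (p s * N) * p s)"
      using tr_mult_commute[of "p s" "dd s * p s * N"] by (simp add: mult.assoc)
    also have "\<dots> = - tr (dd s * N * (p s * p s))"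
      unfolding pN by (simp add: mult.assoc tr_simps)
    finally have "tr (adj N * N) = 0"
      using trN \<open>adj N = N\<close> by (simp add: N_def left_diff_distrib tr_simps pp)
    then have "dd s = p s * dd s * p s"
      by (simp add: tr_adj_mult_eq_0 N_def)
    then have "dd s * p s = p s * dd s"
      by (metis mult.assoc mult.right_neutral pp(1))
    with eq have "2 *\<^sub>R (p s * dd s + d s * d s) = 0"
      by (simp add: scaleR_2 algebra_simps)
    then have "p s * dd s + d s * d s = 0"
      by simp
    then show ?thesis
      using has_vector_derivative_mult[OF dp[OF s] ddp[OF s]] by simp
  qed
  then obtain A where A: "\<And>s. s \<in> ?I \<Longrightarrow> p s * d s = A"
    using has_vector_derivative_zero_constant[of ?I "\<lambda>s. p s * d s"]
    by (metis convex_real_interval(8) has_vector_derivative_at_within)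
  have "d s = p s * A" if "s \<in> ?I" for s
    using A[OF that] reflection_cancel[OF refl[OF that]] by metis
  then have "p t = p 0 * exp (t *\<^sub>R A)"
    using dp assms by (intro linear_ode_unique) auto
  then show ?thesis
    using A[OF assms(2)] by (simp add: geodesic_curve_def p_def d_def)
qed

text \<open>With A = \<open>q * x\<close> the acceleration is c A A. As c anticommutes with A it
  commutes with A A, while it anticommutes with every tangent vector; by cyclicity the trace equals
  its own negative.\<close>

lemma geodesic_on_geodesic_curve:
  assumes M: "M \<in> Grassmannian k" and x: "tangent_at (of_mat M) x"
  shows "geodesic_on trace_metric (Grassmannian k) I (\<lambda>t. to_mat (geodesic_curve (of_mat M) x t))"
proof -
  let ?A = "of_mat M * x"
  let ?g = "geodesic_curve (of_mat M) x"
  have q: "reflection (of_mat M)"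
    using M by (simp add: Grassmannian_iff)
  have "((\<lambda>t. to_mat (?g t)) has_vector_derivative to_mat (?g t * ?A)) (at t)" for t
    by (intro bounded_linear.has_vector_derivative[OF bounded_linear_to_mat] geodesic_curve_derivative q x)
  then have 1: "vector_derivative (\<lambda>t. to_mat (?g t)) (at t) = to_mat (?g t * ?A)" for t
    by (rule vector_derivative_at)
  have "((\<lambda>t. to_mat (?g t * ?A)) has_vector_derivative to_mat (?g t * ?A * ?A)) (at t)" for t
    by (intro bounded_linear.has_vector_derivative[OF bounded_linear_to_mat]
        has_vector_derivative_mult_left geodesic_curve_derivative q x)
  then have 2: "vector_derivative (\<lambda>s. vector_derivative (\<lambda>t. to_mat (?g t)) (at s)) (at t) =
      to_mat (?g t * ?A * ?A)" for t
    unfolding 1 by (rule vector_derivative_at)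
  have "trace_metric (to_mat (?g t * ?A * ?A)) Y = 0"
    if "Y \<in> tangent_space (Grassmannian k) (to_mat (?g t))" for t Y
  proof -
    define y where "y = of_mat Y"
    have y: "?g t * y = - (y * ?g t)"
      using that by (simp add: tangent_space_Grassmannian tangent_at_def y_def)
    note anti = geodesic_curve_anticommute[OF q x, of t]
    have comm: "?A * (?A * ?g t) = ?g t * (?A * ?A)"
      unfolding anti by (simp add: anti mult_minus_right flip: mult.assoc)
    have "tr (?g t * (?A * ?A) * y) = tr (?A * ?A * (?g t * y))"
      unfolding comm[symmetric] by (simp only: mult.assoc)
    also have "\<dots> = - tr (?A * ?A * y * ?g t)"
      unfolding y by (simp add: mult.assoc tr_simps)
    also have "\<dots> = - tr (?g t * (?A * ?A) * y)"
      using tr_mult_commute[of "?A * ?A * y" "?g t"] by (simp add: mult.assoc)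
    finally have "tr (?g t * ?A * ?A * y) = 0"
      by (simp add: mult.assoc)
    then show ?thesis
      by (simp add: trace_metric_def y_def tr.rep_eq times_matalg.rep_eq)
  qed
  then show ?thesis
    unfolding geodesic_on_def 2
    using smooth_on_geodesic_curve geodesic_curve_in_Grassmannian[OF M x] by auto
qed

text \<open>Existence and uniqueness at once: the description in \<open>riem_exp\<close> is well
  defined, and the exponential map is defined on the whole tangent space.\<close>

lemma geodesic_to_Grassmannian:
  assumes "v \<in> tangent_space (Grassmannian k) M"
  shows "geodesic_to trace_metric (Grassmannian k) M v y \<longleftrightarrow>
    y = to_mat (geodesic_curve (of_mat M) (of_mat v) 1)"
proof
  assume "geodesic_to trace_metric (Grassmannian k) M v y"
  then obtain c a b where "a < 0" "1 < b" "geodesic_on trace_metric (Grassmannian k) {a<..<b} c"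
    "c 0 = M" "vector_derivative c (at 0) = v" "c 1 = y"
    unfolding geodesic_to_def by blast
  with geodesic_on_Grassmannian[of k a b c 1] show "y = to_mat (geodesic_curve (of_mat M) (of_mat v) 1)"
    by (metis greaterThanLessThan_iff less_trans zero_less_one of_mat_inverse[OF UNIV_I])
next
  assume y: "y = to_mat (geodesic_curve (of_mat M) (of_mat v) 1)"
  let ?c = "\<lambda>t. to_mat (geodesic_curve (of_mat M) (of_mat v) t)"
  have M: "M \<in> Grassmannian k" and v: "tangent_at (of_mat M) (of_mat v)"
    using assms by (simp_all add: tangent_space_Grassmannian)
  then have q: "reflection (of_mat M)"
    by (simp add: Grassmannian_iff)
  have "(?c has_vector_derivative to_mat (geodesic_curve (of_mat M) (of_mat v) 0 * (of_mat M * of_mat v))) (at 0)"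
    by (intro bounded_linear.has_vector_derivative[OF bounded_linear_to_mat] geodesic_curve_derivative q v)
  then have "vector_derivative ?c (at 0) = v"
    using q v by (simp add: geodesic_curve_0 reflection_cancel vector_derivative_at)
  moreover have "?c 0 = M"
    using q v by (simp add: geodesic_curve_0)
  ultimately show "geodesic_to trace_metric (Grassmannian k) M v y"
    unfolding geodesic_to_def using y geodesic_on_geodesic_curve[OF M v]
    by (intro exI[of _ ?c] exI[of _ "-1"] exI[of _ 2]) auto
qed

lemma riem_exp_Grassmannian:
  assumes "v \<in> tangent_space (Grassmannian k) M"
  shows "riem_exp trace_metric (Grassmannian k) M v = to_mat (geodesic_curve (of_mat M) (of_mat v) 1)"
  unfolding riem_exp_def by (rule the_equality) (simp_all add: geodesic_to_Grassmannian[OF assms])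

lemma exp_domain_Grassmannian:
  "exp_domain trace_metric (Grassmannian k) M = tangent_space (Grassmannian k) M"
  unfolding exp_domain_def using geodesic_to_Grassmannian by blast

section \<open>The logarithm on the Grassmannian\<close>

text \<open>Cauchy-Schwarz in every row: the operator norm is at most the Frobenius norm.\<close>

lemma norm_app_le_tr: "(norm (app a u))\<^sup>2 \<le> tr (adj a * a) * (norm u)\<^sup>2"
proof -
  have "(norm (app a u))\<^sup>2 = (\<Sum>i\<in>UNIV. (to_mat a $ i \<bullet> u)\<^sup>2)"
    unfolding power2_norm_eq_inner app.rep_eq inner_vec_def[of "to_mat a *v u"]
    by (simp add: matrix_vector_mul_component power2_eq_square)
  also have "\<dots> \<le> (\<Sum>i\<in>UNIV. (to_mat a $ i \<bullet> to_mat a $ i) * (u \<bullet> u))"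
    by (intro sum_mono Cauchy_Schwarz_ineq)
  also have "\<dots> = tr (adj a * a) * (norm u)\<^sup>2"
    by (simp add: tr_adj_mult inner_vec_def[of "to_mat a"] power2_norm_eq_inner sum_distrib_right)
  finally show ?thesis .
qed

text \<open>A tangent vector maps the eigenspaces of the reflection into each other, so each of them
  contributes half of its Frobenius norm.\<close>

lemma norm_app_tangent_le:
  assumes q: "reflection q" and x: "tangent_at q x"
  shows "(norm (app x u))\<^sup>2 \<le> tr (x * x) / 2 * (norm u)\<^sup>2"
proof -
  \<comment> \<open>For s = 1 and s = -1 these are the orthogonal projections onto the two
    eigenspaces of \<open>q\<close>.\<close>
  define P where "P s = (1/2) *\<^sub>R (1 + s *\<^sub>R q)" for s :: real
  have qq: "q * q = 1" "adj q = q" and xx: "adj x = x" "x * q = - (q * x)"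
    using q x by (auto simp: reflection_def tangent_at_def)
  have comm: "x * x * q = q * (x * x)"
  proof -
    have "x * x * q = x * - (q * x)"
      by (simp add: xx(2) mult.assoc)
    also have "\<dots> = - (x * q) * x"
      by (simp add: mult.assoc)
    finally show ?thesis
      by (simp add: xx(2) mult.assoc)
  qed
  \<comment> \<open>This is the equality of the two contributions to \<open>tr (x * x)\<close>:
    their difference is the trace of \<open>x * x * q\<close>.\<close>
  have tr0: "tr (x * x * q) = 0"
  proof -
    have "tr (x * x * q) = tr (x * - (q * x))"
      by (simp only: xx(2) mult.assoc)
    also have "\<dots> = - tr (x * q * x)"
      by (simp add: tr_simps mult.assoc)
    also have "\<dots> = - tr (x * x * q)"
      using tr_mult_commute[of "x * q" x] by (simp add: mult.assoc)
    finally show ?thesis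
      by simp
  qed
  have half: "(norm (app x (app (P s) u)))\<^sup>2 \<le> tr (x * x) / 2 * (norm (app (P s) u))\<^sup>2" if "s\<^sup>2 = 1" for s
  proof -
    have PP: "P s * P s = P s"
    proof -
      have "(s *\<^sub>R q) * (s *\<^sub>R q) = 1"
        using that by (simp add: qq power2_eq_square)
      then have "(1 + s *\<^sub>R q) * (1 + s *\<^sub>R q) = 2 *\<^sub>R (1 + s *\<^sub>R q)"
        unfolding scaleR_2 distrib_left distrib_right by simp
      then show ?thesis
        by (simp add: P_def)
    qed
    have adjP: "adj (P s) = P s"
      by (simp add: P_def adj_simps qq)
    have "tr (adj (x * P s) * (x * P s)) = tr (P s * (x * x * P s))"
      by (simp add: adj_mult adjP xx mult.assoc)
    also have "\<dots> = tr (x * x * P s)"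
      using tr_mult_commute[of "P s" "x * x * P s"] by (simp add: mult.assoc PP)
    also have "\<dots> = tr (x * x) / 2"
      by (simp add: P_def distrib_left tr_simps tr0)
    finally have "tr (adj (x * P s) * (x * P s)) = tr (x * x) / 2" .
    moreover have "app x (app (P s) u) = app (x * P s) (app (P s) u)"
      by (simp add: mult.assoc PP flip: app_mult)
    ultimately show ?thesis
      using norm_app_le_tr[of "x * P s" "app (P s) u"] by (simp only:)
  qed
  \<comment> \<open>Used with \<open>y = 1\<close> for the two components of \<open>u\<close>, and
    with \<open>y = x * x\<close> for their images under \<open>x\<close>.\<close>
  have orth: "app (P 1) u \<bullet> app (y * P (- 1)) u = 0" if "y * q = q * y" "adj y = y" for y
  proof -
    have "P 1 * (y * P (- 1)) = 0"
    proof -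
      have "P 1 * (y * P (- 1)) = P 1 * P (- 1) * y"
        using that(1) by (simp add: P_def distrib_left distrib_right left_diff_distrib right_diff_distrib mult.assoc)
      also have "P 1 * P (- 1) = 0"
        by (simp add: P_def distrib_left distrib_right left_diff_distrib right_diff_distrib qq)
      finally show ?thesis
        by simp
    qed
    moreover have "adj (P 1) = P 1"
      by (simp add: P_def adj_simps qq)
    ultimately show ?thesis
      by (simp add: inner_app app.zero_left flip: app_mult)
  qed
  have decomp: "u = app (P 1) u + app (P (- 1)) u"
  proof -
    have "P 1 + P (- 1) = (1/2) *\<^sub>R ((1 + q) + (1 - q))"
      by (simp add: P_def flip: scaleR_add_right)
    also have "(1 + q) + (1 - q) = 2 *\<^sub>R 1"
      unfolding scaleR_2 by simp
    finally show ?thesis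
      by (simp flip: app.add_left)
  qed
  have o1: "app (P 1) u \<bullet> app (P (- 1)) u = 0"
    using orth[of 1] by simp
  have o2: "app x (app (P 1) u) \<bullet> app x (app (P (- 1)) u) = 0"
    using orth[of "x * x"] comm by (simp add: inner_app xx app_mult adj_mult)
  have "(norm (app x u))\<^sup>2 = (norm (app x (app (P 1) u)))\<^sup>2 + (norm (app x (app (P (- 1)) u)))\<^sup>2"
    using arg_cong[OF decomp, of "app x"] norm_add_Pythagorean[of "app x (app (P 1) u)"] o2
    by (simp add: orthogonal_def app.add_right)
  also have "\<dots> \<le> tr (x * x) / 2 * (norm (app (P 1) u))\<^sup>2 + tr (x * x) / 2 * (norm (app (P (- 1)) u))\<^sup>2"
    by (intro add_mono half) auto
  also have "\<dots> = tr (x * x) / 2 * (norm u)\<^sup>2"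
    using arg_cong[OF decomp, of norm] norm_add_Pythagorean[of "app (P 1) u"] o1
    by (simp add: orthogonal_def distrib_left)
  finally show ?thesis .
qed

text \<open>It is \<open>x * x\<close> that is diagonalised, not \<open>x\<close>: since
  \<open>q * x\<close> squares to \<open>- (x * x)\<close>, its exponential acts on an eigenvector
  \<open>u\<close> through a rotation by the angle \<open>m u\<close>.\<close>

lemma tangent_eigenbasis:
  assumes x: "tangent_at q x"
  obtains B m where "orthonormal_basis B" "\<And>u. u \<in> B \<Longrightarrow> app (x * x) u = (m u)\<^sup>2 *\<^sub>R u"
    "\<And>u. 0 \<le> m u" "\<And>u. u \<in> B \<Longrightarrow> norm (app x u) = m u" "tr (x * x) = (\<Sum>u\<in>B. (m u)\<^sup>2)"
proof -
  have adj: "adj x = x" "adj (x * x) = x * x"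
    using x by (simp_all add: tangent_at_def adj_mult)
  obtain B l where B: "orthonormal_basis B" and l: "\<And>u. u \<in> B \<Longrightarrow> app (x * x) u = l u *\<^sub>R u"
    using symmetric_eigenbasis[OF adj(2)] by blast
  have "l u = (norm (app x u))\<^sup>2" if "u \<in> B" for u
  proof -
    have "l u = app (x * x) u \<bullet> u"
      using l[OF that] B that by (simp add: orthonormal_basis_def)
    then show ?thesis
      by (simp add: app_mult inner_app adj power2_norm_eq_inner)
  qed
  moreover from this have "tr (x * x) = (\<Sum>u\<in>B. (norm (app x u))\<^sup>2)"
    unfolding tr_orthonormal_basis[OF B] using l B by (auto intro!: sum.cong simp: orthonormal_basis_def)
  ultimately show thesis
    using that[of B "\<lambda>u. norm (app x u)"] B l by auto
qed

text \<open>With \<open>t * m\<close> as the argument of cosine and sine, the right side becomes a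
  curve \<open>w\<close> with \<open>w' = a w\<close> and \<open>w 0 = u\<close>, so
  \<open>exp (- t a) w\<close> is constant.\<close>

lemma app_exp_eigenvector:
  assumes "app (a * a) u = - (m\<^sup>2) *\<^sub>R u" "m \<noteq> 0"
  shows "app (exp a) u = cos m *\<^sub>R u + (sin m / m) *\<^sub>R app a u"
proof -
  define w where "w t = cos (t * m) *\<^sub>R u + (sin (t * m) / m) *\<^sub>R app a u" for t
  have w: "(w has_vector_derivative app a (w t)) (at t)" for t
  proof -
    have "(w has_vector_derivative (- sin (t * m) * m) *\<^sub>R u + (cos (t * m) * m / m) *\<^sub>R app a u) (at t)"
      unfolding w_def[abs_def]
      by (intro has_vector_derivative_add bounded_linear.has_vector_derivative[OF bounded_linear_scaleR_left])
         (auto simp flip: has_real_derivative_iff_has_vector_derivative intro!: derivative_eq_intros)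
    also have "(- sin (t * m) * m) *\<^sub>R u + (cos (t * m) * m / m) *\<^sub>R app a u = app a (w t)"
      using assms by (simp add: w_def app.add_right app.scaleR_right power2_eq_square flip: app_mult)
    finally show ?thesis .
  qed
  have "((\<lambda>t. app (exp (t *\<^sub>R - a)) (w t)) has_vector_derivative 0) (at t within UNIV)" for t
  proof -
    have "((\<lambda>t. app (exp (t *\<^sub>R - a)) (w t)) has_vector_derivative
        app (exp (t *\<^sub>R - a)) (app a (w t)) + app (exp (t *\<^sub>R - a) * - a) (w t)) (at t within UNIV)"
      by (intro app.has_vector_derivative w exp_scaleR_has_vector_derivative_right)
    then show ?thesis
      by (simp add: app_mult app.minus_left app.minus_right)
  qed
  then obtain k where k: "\<And>t. app (exp (t *\<^sub>R - a)) (w t) = k"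
    using has_vector_derivative_zero_constant[of UNIV "\<lambda>t. app (exp (t *\<^sub>R - a)) (w t)"] by auto
  have "app (exp (- a)) (w 1) = u"
    using k[of 0] k[of 1] by (simp add: w_def)
  then have "app (exp a) u = app (exp a * exp (- a)) (w 1)"
    by (simp add: app_mult)
  then show ?thesis
    by (simp add: exp_minus_inverse w_def)
qed

lemma app_exp_fixed: "app a u = 0 \<Longrightarrow> app (exp a) u = u"
proof -
  assume *: "app a u = 0"
  have "((\<lambda>t. app (exp (t *\<^sub>R a)) u) has_vector_derivative 0) (at t within UNIV)" for t
    using bounded_linear.has_vector_derivative[OF app.bounded_linear_left[of u]
        exp_scaleR_has_vector_derivative_right[of a t UNIV]] *
    by (simp add: app_mult app.zero_right)
  then obtain k where k: "\<And>t. app (exp (t *\<^sub>R a)) u = k"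
    using has_vector_derivative_zero_constant[of UNIV "\<lambda>t. app (exp (t *\<^sub>R a)) u"] by auto
  show ?thesis
    using k[of 0] k[of 1] by simp
qed

definition angle_mat :: "'n::finite matalg \<Rightarrow> 'n matalg \<Rightarrow> 'n matalg" where
  "angle_mat q p = (1/2) *\<^sub>R 1 - (1/4) *\<^sub>R (q * p + p * q)"

text \<open>For \<open>a = q * x\<close> one has \<open>q * p = exp a\<close> and
  \<open>p * q = exp (- a)\<close>. Hence \<open>angle_mat q p\<close> is (1 - cosh a) / 2 and half
  of \<open>p - q * p * q\<close> is q sinh a. On \<open>u\<close> the square of \<open>a\<close> is
  \<open>- m\<^sup>2\<close>, which turns hyperbolic functions of \<open>a\<close> into
  trigonometric functions of \<open>m\<close>. The second equation carries the factor
  \<open>m\<close> so that no division by 0 arises.\<close>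

lemma app_geodesic_curve:
  assumes q: "reflection q" and x: "tangent_at q x"
    and u: "app (x * x) u = m\<^sup>2 *\<^sub>R u" and xu: "norm (app x u) = m"
  defines "p \<equiv> geodesic_curve q x 1"
  shows "app (angle_mat q p) u = (sin (m / 2))\<^sup>2 *\<^sub>R u"
    and "m *\<^sub>R app ((1/2) *\<^sub>R (p - q * p * q)) u = sin m *\<^sub>R app x u"
proof -
  note qq = reflection_cancel[OF q]
  have q1: "q * q = 1"
    using q by (simp add: reflection_def)
  define a where "a = q * x"
  have p: "p = q * exp a"
    by (simp add: p_def geodesic_curve_def a_def)
  have qp: "q * p = exp a" and pq: "p * q = exp (- a)"
    using reflection_conj_exp[OF q x, of 1] by (simp_all add: p a_def qq)
  have "a * a = - (x * x)"
  proof -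
    have "a * a = q * (x * q) * x"
      by (simp add: a_def mult.assoc)
    also have "\<dots> = q * (- (q * x)) * x"
      using x by (simp add: tangent_at_def)
    finally show ?thesis
      by (simp add: mult.assoc qq)
  qed
  then have aa: "app (a * a) u = - (m\<^sup>2) *\<^sub>R u" "app ((- a) * (- a)) u = - (m\<^sup>2) *\<^sub>R u"
    using u by (simp_all add: app.minus_left)
  have Y: "app (angle_mat q p) u = (1/2) *\<^sub>R u - (1/4) *\<^sub>R (app (exp a) u + app (exp (- a)) u)"
    by (simp add: angle_mat_def qp pq app.diff_left app.scaleR_left app.add_left)
  have "q * p * q = q * exp (- a)"
    by (simp add: pq mult.assoc)
  then have Z: "app ((1/2) *\<^sub>R (p - q * p * q)) u = (1/2) *\<^sub>R app q (app (exp a) u - app (exp (- a)) u)"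
    by (simp add: p app.diff_left app.diff_right app.scaleR_left app_mult)
  have x_a: "x = q * a"
    by (simp add: a_def qq)
  show "app (angle_mat q p) u = (sin (m / 2))\<^sup>2 *\<^sub>R u"
  proof (cases "m = 0")
    case True
    then have "app a u = 0"
      using xu by (simp add: a_def app_mult app.zero_right)
    then show ?thesis
      using True by (simp add: Y app_exp_fixed app.minus_left scaleR_2[symmetric])
  next
    case False
    have "app (exp a) u + app (exp (- a)) u = (2 * cos m) *\<^sub>R u"
      unfolding app_exp_eigenvector[OF aa(1) False] app_exp_eigenvector[OF aa(2) False]
        mult_2 scaleR_left_distrib by (simp add: app.minus_left)
    then have "app (angle_mat q p) u = (1/2 - 1/4 * (2 * cos m)) *\<^sub>R u"
      by (simp add: Y scaleR_left_diff_distrib)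
    moreover have "1/2 - 1/4 * (2 * cos m) = (sin (m / 2))\<^sup>2"
      using cos_sin_half_sq[of m] by (simp add: field_simps)
    ultimately show ?thesis
      by simp
  qed
  show "m *\<^sub>R app ((1/2) *\<^sub>R (p - q * p * q)) u = sin m *\<^sub>R app x u"
  proof (cases "m = 0")
    case False
    have "app (exp a) u - app (exp (- a)) u = (2 * (sin m / m)) *\<^sub>R app a u"
      unfolding app_exp_eigenvector[OF aa(1) False] app_exp_eigenvector[OF aa(2) False]
        mult_2 scaleR_left_distrib by (simp add: app.minus_left)
    then show ?thesis
      using False by (simp add: Z x_a app_mult app.scaleR_right)
  qed simp
qed

lemma
  assumes q: "reflection q" and x: "tangent_at q x" and less: "tr (x * x) < 2 * pi\<^sup>2"
  defines "p \<equiv> geodesic_curve q x 1"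
  shows norm_angle_mat: "norm (angle_mat q p) < 1"
    and log_geodesic_curve: "(\<Sum>n. arc_coeff n *\<^sub>R ((1/2) *\<^sub>R (p - q * p * q) * angle_mat q p ^ n)) = x"
proof -
  obtain B m where B: "orthonormal_basis B" and m: "\<And>u. u \<in> B \<Longrightarrow> app (x * x) u = (m u)\<^sup>2 *\<^sub>R u"
    "\<And>u. 0 \<le> m u" "\<And>u. u \<in> B \<Longrightarrow> norm (app x u) = m u"
    using tangent_eigenbasis[OF x] by metis
  have m_pi: "m u < pi" if "u \<in> B" for u
  proof -
    have "norm u = 1"
      using B that by (simp add: orthonormal_basis_def norm_eq_1)
    then have "(m u)\<^sup>2 \<le> tr (x * x) / 2"
      using norm_app_tangent_le[OF q x, of u] m(3)[OF that] by simp
    then have "(m u)\<^sup>2 < pi\<^sup>2"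
      using less by simp
    then show ?thesis
      using pi_ge_zero power2_less_imp_less by blast
  qed
  define s where "s u = (sin (m u / 2))\<^sup>2" for u
  have s: "0 \<le> s u" "s u < 1" if "u \<in> B" for u
    using sin_half_sq_less_1[OF m(2) m_pi[OF that]] by (simp_all add: s_def)
  have Y: "app (angle_mat q p) u = s u *\<^sub>R u" if "u \<in> B" for u
    unfolding s_def p_def by (rule app_geodesic_curve(1)[OF q x m(1,3)]) (use that in auto)
  have fin: "finite B"
    using B by (simp add: orthonormal_basis_def)
  \<comment> \<open>Inserting 0 makes the bound nonnegative and the maximum that of a nonempty
    set.\<close>
  have "norm (angle_mat q p) \<le> Max (insert 0 (s ` B))"
    by (rule norm_matalg_eigenbasis_le[OF B Y]) (use fin s in \<open>auto intro: Max_ge\<close>)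
  also have "\<dots> < 1"
    using fin s by simp
  finally show norm: "norm (angle_mat q p) < 1" .
  define Z where "Z = (1/2) *\<^sub>R (p - q * p * q)"
  have summ: "summable (\<lambda>n. arc_coeff n *\<^sub>R angle_mat q p ^ n)"
  proof (rule summable_comparison_test'[of "\<lambda>n. norm (angle_mat q p) ^ n" 0])
    show "norm (arc_coeff n *\<^sub>R angle_mat q p ^ n) \<le> norm (angle_mat q p) ^ n" for n
      using arc_coeff_le_1[of n] arc_coeff_pos[of n] norm_power_ineq[of "angle_mat q p" n]
      by (simp add: mult_left_le_one_le order_trans[OF mult_left_le_one_le])
  qed (use norm in \<open>simp add: summable_geometric\<close>)
  have "(\<Sum>n. arc_coeff n *\<^sub>R (Z * angle_mat q p ^ n)) = Z * (\<Sum>n. arc_coeff n *\<^sub>R angle_mat q p ^ n)"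
    using suminf_mult[OF summ, of Z] by simp
  also have "\<dots> = x"
  proof (rule matalg_eq_orthonormal_basis[OF B])
    fix u assume u: "u \<in> B"
    have "app (\<Sum>n. arc_coeff n *\<^sub>R angle_mat q p ^ n) u = arc_series (s u) *\<^sub>R u"
      unfolding arc_series_def
      by (rule app_power_series_eigenvector[OF Y[OF u] summ summable_arc_coeff]) (use s[OF u] in simp)
    then have "app (Z * (\<Sum>n. arc_coeff n *\<^sub>R angle_mat q p ^ n)) u = arc_series (s u) *\<^sub>R app Z u"
      by (simp add: app_mult app.scaleR_right)
    also have "\<dots> = app x u"
    proof (cases "m u = 0")
      \<comment> \<open>For \<open>m u = 0\<close> the equation of \<open>app_geodesic_curve\<close>
        is void; here \<open>exp a\<close> and \<open>exp (- a)\<close> both fix \<open>u\<close>,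
        so \<open>Z\<close> annihilates it, as \<open>x\<close> does.\<close>
      case True
      have "app Z u = 0"
      proof -
        define a where "a = q * x"
        have "app a u = 0"
          using True m(3)[OF u] by (simp add: a_def app_mult app.zero_right)
        then have "app (exp a) u = u" "app (exp (- a)) u = u"
          by (simp_all add: app_exp_fixed app.minus_left)
        moreover have "q * p * q = q * exp (- a)" "p = q * exp a"
          using reflection_conj_exp[OF q x, of 1] by (simp_all add: p_def geodesic_curve_def a_def mult.assoc)
        ultimately show ?thesis
          by (simp add: Z_def app.scaleR_left app.diff_left app_mult)
      qed
      then show ?thesis
        using True m(3)[OF u] by simp
    next
      case False
      have "m u *\<^sub>R (arc_series (s u) *\<^sub>R app Z u) = arc_series (s u) *\<^sub>R (m u *\<^sub>R app Z u)"
        by (rule scaleR_left_commute)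
      also have "m u *\<^sub>R app Z u = sin (m u) *\<^sub>R app x u"
        using app_geodesic_curve(2)[OF q x m(1,3), OF u u] by (simp add: Z_def p_def)
      also have "arc_series (s u) *\<^sub>R (sin (m u) *\<^sub>R app x u) = (sin (m u) * arc_series (s u)) *\<^sub>R app x u"
        by (simp add: mult.commute)
      also have "\<dots> = m u *\<^sub>R app x u"
        using sin_arc_series[OF m(2) m_pi[OF u]] by (simp add: s_def)
      finally show ?thesis
        using False by (simp only: scaleR_cancel_left) simp
    qed
    finally show "app (Z * (\<Sum>n. arc_coeff n *\<^sub>R angle_mat q p ^ n)) u = app x u" .
  qed
  finally show "(\<Sum>n. arc_coeff n *\<^sub>R ((1/2) *\<^sub>R (p - q * p * q) * angle_mat q p ^ n)) = x"
    by (simp add: Z_def)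
qed

section \<open>The injectivity radius and the logarithm\<close>

lemma smooth_on_cong: "(\<And>x. x \<in> S \<Longrightarrow> f x = g x) \<Longrightarrow> smooth_on S f \<Longrightarrow> smooth_on S g"
  unfolding smooth_on_def by (metis IntD1)

lemma metric_norm_trace_metric: "metric_norm trace_metric v = sqrt (tr (of_mat v * of_mat v))"
  by (simp add: metric_norm_def trace_metric_def tr.rep_eq times_matalg.rep_eq)

lemma tangent_ball_iff:
  "v \<in> tangent_ball trace_metric (Grassmannian k) M (ereal (sqrt 2 * pi)) \<longleftrightarrow>
    v \<in> tangent_space (Grassmannian k) M \<and> tr (of_mat v * of_mat v) < 2 * pi\<^sup>2"
proof -
  have "sqrt 2 * pi = sqrt (2 * pi\<^sup>2)"
    by (simp add: real_sqrt_mult)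
  then show ?thesis
    by (simp add: tangent_ball_def metric_norm_trace_metric)
qed

text \<open>The left inverse \<open>l\<close> is an explicit power series in the ambient matrix. It
  yields injectivity and, since it converges near every point of the image, smoothness of the
  inverse without a description of that image.\<close>

lemma diffeomorphism_riem_exp_Grassmannian:
  fixes M :: "real^'n::finite^'n"
  shows "diffeomorphism_on_image (tangent_ball trace_metric (Grassmannian k) M (ereal (sqrt 2 * pi)))
    (riem_exp trace_metric (Grassmannian k) M)"
proof -
  let ?D = "tangent_ball trace_metric (Grassmannian k) M (ereal (sqrt 2 * pi))"
  let ?exp = "riem_exp trace_metric (Grassmannian k) M"
  define q where "q = of_mat M"
  define U where "U N = (1/2) *\<^sub>R (of_mat N - q * of_mat N * q)" for N
  define T where "T N = - ((1/4) *\<^sub>R (q * of_mat N + of_mat N * q))" for N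
  define l where "l N = to_mat (\<Sum>n. arc_coeff n *\<^sub>R ((U N + 0) * (T N + (1/2) *\<^sub>R 1) ^ n))" for N
  have D: "reflection q" "tangent_at q (of_mat v)" "tr (of_mat v * of_mat v) < 2 * pi\<^sup>2"
    "?exp v = to_mat (geodesic_curve q (of_mat v) 1)" if "v \<in> ?D" for v
    using that riem_exp_Grassmannian[of v k M]
    by (simp_all add: tangent_ball_iff tangent_space_Grassmannian Grassmannian_iff q_def)
  have TY: "T N + (1/2) *\<^sub>R 1 = angle_mat q (of_mat N)" for N
    by (simp add: T_def angle_mat_def)
  have left_inverse: "l (?exp v) = v" if "v \<in> ?D" for v
    using log_geodesic_curve[OF D(1-3)[OF that]] D(4)[OF that]
    unfolding l_def TY by (simp add: U_def)
  have inj: "inj_on ?exp ?D"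
    by (rule inj_on_inverseI[where g = l]) (rule left_inverse)
  have lin: "bounded_linear U" "bounded_linear T" "bounded_linear (\<lambda>N. q * of_mat N)"
    unfolding linear_conv_bounded_linear[symmetric]
    by (rule linearI; simp add: U_def T_def linear_add[OF linear_of_mat] linear_scale[OF linear_of_mat]
        algebra_simps)+
  have "smooth_on ?D (\<lambda>v. to_mat (q * exp (q * of_mat v)))"
    by (rule smooth_on_exp[OF lin(3) bounded_linear_to_mat])
  then have "smooth_on ?D ?exp"
    by (rule smooth_on_cong[rotated]) (simp add: D(4) geodesic_curve_def)
  moreover have "smooth_on (?exp ` ?D) l"
    unfolding l_def
  proof (rule smooth_on_power_series[OF lin(2,1) bounded_linear_to_mat])
    fix N assume "N \<in> ?exp ` ?D"
    then obtain v where v: "v \<in> ?D" "N = ?exp v"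
      by blast
    have "norm (T N + (1/2) *\<^sub>R 1) < 1"
      unfolding TY using norm_angle_mat[OF D(1-3)[OF v(1)]] D(4)[OF v(1)] v(2) by simp
    then obtain \<rho> where \<rho>: "norm (T N + (1/2) *\<^sub>R 1) < \<rho>" "\<rho> < 1"
      using dense by blast
    then have "\<bar>\<rho>\<bar> < 1"
      using norm_ge_zero[of "T N + (1/2) *\<^sub>R 1"] by linarith
    from summable_arc_coeff[OF this]
    show "\<exists>\<rho>>norm (T N + (1/2) *\<^sub>R 1). summable (\<lambda>n. \<bar>arc_coeff n\<bar> * \<rho> ^ n)"
      using \<rho>(1) arc_coeff_pos by (intro exI[of _ \<rho>]) (simp add: abs_of_pos)
  qed
  then have "smooth_on (?exp ` ?D) (inv_into ?D ?exp)"
    by (rule smooth_on_cong[rotated]) (use inj left_inverse in auto)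
  ultimately show ?thesis
    using inj by (simp add: diffeomorphism_on_image_def)
qed

text \<open>Two given vectors already lie in one ball of admissible radius, so injectivity passes to
  the supremum. A lower bound on the injectivity radius therefore suffices to evaluate
  \<open>riem_log\<close>.\<close>

lemma inj_on_injectivity_radius:
  "inj_on (riem_exp g M x) (tangent_ball g M x (injectivity_radius g M x))"
proof (rule inj_onI)
  fix v w
  assume v: "v \<in> tangent_ball g M x (injectivity_radius g M x)"
    and w: "w \<in> tangent_ball g M x (injectivity_radius g M x)"
    and eq: "riem_exp g M x v = riem_exp g M x w"
  have "max (ereal (metric_norm g v)) (ereal (metric_norm g w)) < injectivity_radius g M x"
    using v w by (simp add: tangent_ball_def)
  then obtain r where r: "diffeomorphism_on_image (tangent_ball g M x r) (riem_exp g M x)"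
    "max (ereal (metric_norm g v)) (ereal (metric_norm g w)) < r"
    unfolding injectivity_radius_def less_Sup_iff by blast
  have "v \<in> tangent_ball g M x r" "w \<in> tangent_ball g M x r"
    using v w r(2) by (auto simp: tangent_ball_def)
  then show "v = w"
    using r(1) eq by (auto simp: diffeomorphism_on_image_def inj_on_def)
qed

lemma riem_log_Grassmannian:
  assumes v: "v \<in> tangent_space (Grassmannian k) M" and less: "metric_norm trace_metric v < sqrt 2 * pi"
    and N: "riem_exp trace_metric (Grassmannian k) M v = N"
  shows "N \<in> log_domain trace_metric (Grassmannian k) M \<and> riem_log trace_metric (Grassmannian k) M N = v"
proof -
  have "tangent_ball trace_metric (Grassmannian k) M (ereal (sqrt 2 * pi)) \<subseteq> exp_domain trace_metric (Grassmannian k) M"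
    by (auto simp: exp_domain_Grassmannian tangent_ball_def)
  then have "ereal (sqrt 2 * pi) \<le> injectivity_radius trace_metric (Grassmannian k) M"
    unfolding injectivity_radius_def
    using diffeomorphism_riem_exp_Grassmannian by (intro Sup_upper) simp
  then have "v \<in> tangent_ball trace_metric (Grassmannian k) M (injectivity_radius trace_metric (Grassmannian k) M)"
    using v less by (auto simp: tangent_ball_def intro: less_le_trans[of _ "ereal (sqrt 2 * pi)"])
  then show ?thesis
    using N inv_into_f_f[OF inj_on_injectivity_radius] unfolding log_domain_def riem_log_def by blast
qed

section \<open>A lower bound for the geodesic distance\<close>

text \<open>\<open>y'\<close> need not commute with \<open>y t\<close>, and only cyclicity of the
  trace repairs this. The induction hence speaks of \<open>tr (D * z)\<close> for all
  \<open>z\<close> commuting with \<open>y t\<close>: the step passes from \<open>z\<close> to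
  \<open>z * y t\<close>, and \<open>z = 1\<close> is the claim.\<close>

lemma has_vector_derivative_tr_power:
  fixes y :: "real \<Rightarrow> 'n::finite matalg"
  assumes y: "(y has_vector_derivative y') (at t)"
  shows "((\<lambda>t. tr (y t ^ n)) has_vector_derivative real n * tr (y t ^ (n - 1) * y')) (at t)"
proof -
  have "\<exists>D. ((\<lambda>t. y t ^ n) has_vector_derivative D) (at t) \<and>
      (\<forall>z. z * y t = y t * z \<longrightarrow> tr (D * z) = real n * tr (y t ^ (n - 1) * (y' * z)))"
  proof (induction n)
    case 0
    show ?case
      by (intro exI[of _ 0]) (simp add: tr_simps)
  next
    case (Suc n)
    then obtain D where D: "((\<lambda>t. y t ^ n) has_vector_derivative D) (at t)"
      and trD: "\<And>z. z * y t = y t * z \<Longrightarrow> tr (D * z) = real n * tr (y t ^ (n - 1) * (y' * z))"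
      by blast
    have "((\<lambda>t. y t ^ Suc n) has_vector_derivative y t * D + y' * y t ^ n) (at t)"
      unfolding power_Suc by (rule has_vector_derivative_mult[OF y D])
    moreover have "tr ((y t * D + y' * y t ^ n) * z) = real (Suc n) * tr (y t ^ (Suc n - 1) * (y' * z))"
      if z: "z * y t = y t * z" for z
    proof -
      have "tr (y t * (D * z)) = tr (D * (z * y t))"
        using tr_mult_commute[of "y t" "D * z"] by (simp add: mult.assoc)
      also have "\<dots> = real n * tr (y t ^ (n - 1) * (y' * (z * y t)))"
        by (rule trD) (simp add: z mult.assoc)
      also have "\<dots> = real n * tr (y t * (y t ^ (n - 1) * (y' * z)))"
        using tr_mult_commute[of "y t ^ (n - 1) * (y' * z)" "y t"] by (simp add: mult.assoc)
      also have "\<dots> = real n * tr (y t ^ n * (y' * z))"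
        by (cases n) (simp_all add: mult.assoc)
      finally have 1: "tr (y t * (D * z)) = real n * tr (y t ^ n * (y' * z))" .
      have "y t ^ n * z = z * y t ^ n"
        by (rule power_commuting_commutes) (simp add: z)
      then have "tr (y' * y t ^ n * z) = tr ((y' * z) * y t ^ n)"
        by (simp add: mult.assoc)
      also have "\<dots> = tr (y t ^ n * (y' * z))"
        by (rule tr_mult_commute)
      finally show ?thesis
        using 1 by (simp add: distrib_right tr_simps mult.assoc)
    qed
    ultimately show ?case
      by blast
  qed
  then obtain D where D: "((\<lambda>t. y t ^ n) has_vector_derivative D) (at t)"
    and trD: "tr (D * 1) = real n * tr (y t ^ (n - 1) * (y' * 1))"
    using mult.left_neutral mult.right_neutral by metis
  show ?thesis
    using bounded_linear.has_vector_derivative[OF bounded_linear_tr D] trD by simp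
qed

definition arc_tail :: "nat \<Rightarrow> real" where
  "arc_tail m = (\<Sum>n. arc_sq_coeff (n + m))"

lemma arc_tail_pos: "0 < arc_tail (Suc m)"
  unfolding arc_tail_def using arc_coeff_pos
  by (intro suminf_pos summable_ignore_initial_segment summable_arc_sq_coeff_1)
     (simp add: arc_sq_coeff_def)

lemma arc_tail_tendsto: "(\<lambda>m. arc_tail (Suc m)) \<longlonglongrightarrow> 0"
  using LIMSEQ_Suc[OF suminf_exist_split2[OF summable_arc_sq_coeff_1]] by (simp add: arc_tail_def)

text \<open>The range up to \<open>m\<close> inclusive makes the derivative a sum of
  \<open>diffs arc_sq_coeff\<close> over \<open>n < m\<close>, matching
  \<open>arc_sq_partial_sum_deriv_bound\<close>.\<close>

definition dist_sq_partial :: "nat \<Rightarrow> 'n::finite matalg \<Rightarrow> 'n matalg \<Rightarrow> real" where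
  "dist_sq_partial m q p = (\<Sum>n<Suc m. arc_sq_coeff n * tr (angle_mat q p ^ n))"

text \<open>\<open>(q - p)\<^sup>2\<close> is 4 times \<open>angle_mat q p\<close> and
  \<open>(q + p)\<^sup>2\<close> is 4 times its complement to 1, and squares of symmetric matrices
  are positive semidefinite. No geodesic from \<open>q\<close> to \<open>p\<close> is involved, so
  this applies at every point of a curve.\<close>

lemma angle_mat_eigenbasis:
  assumes q: "reflection q" and p: "reflection p"
  obtains B y where "orthonormal_basis B" "\<And>u. u \<in> B \<Longrightarrow> app (angle_mat q p) u = y u *\<^sub>R u"
    "\<And>u. u \<in> B \<Longrightarrow> 0 \<le> y u \<and> y u \<le> 1"
proof -
  have qp: "q * q = 1" "p * p = 1" "adj q = q" "adj p = p"
    using q p by (auto simp: reflection_def)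
  have "adj (angle_mat q p) = angle_mat q p"
    by (simp add: angle_mat_def adj_simps adj_mult qp add.commute)
  then obtain B y where B: "orthonormal_basis B"
    and y: "\<And>u. u \<in> B \<Longrightarrow> app (angle_mat q p) u = y u *\<^sub>R u"
    using symmetric_eigenbasis by metis
  have "0 \<le> y u \<and> y u \<le> 1" if u: "u \<in> B" for u
  proof -
    have yu: "y u = app (angle_mat q p) u \<bullet> u" and uu: "u \<bullet> u = 1"
      using y[OF u] B u by (simp_all add: orthonormal_basis_def)
    have square: "0 \<le> app (z * z) u \<bullet> u" if "adj z = z" for z
      using that inner_app[of z "app z u" u] by (simp add: app_mult)
    have "(q - p) * (q - p) = 4 *\<^sub>R angle_mat q p"
      by (simp add: angle_mat_def left_diff_distrib right_diff_distrib qp scaleR_diff_right scaleR_2)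
    then have "0 \<le> 4 * y u"
      using square[of "q - p"] by (simp add: yu adj_simps qp app.scaleR_left)
    moreover have "(q + p) * (q + p) = 4 *\<^sub>R (1 - angle_mat q p)"
    proof -
      have "4 *\<^sub>R (1 - angle_mat q p) = 2 *\<^sub>R 1 + (q * p + p * q)"
        by (simp add: angle_mat_def scaleR_diff_right scaleR_add_right flip: scaleR_left_diff_distrib)
      then show ?thesis
        by (simp add: distrib_left distrib_right qp scaleR_2)
    qed
    then have "0 \<le> 4 * (1 - y u)"
      using square[of "q + p"] by (simp add: yu uu adj_simps qp app.scaleR_left app.diff_left inner_diff_left)
    ultimately show ?thesis
      by simp
  qed
  with B y show thesis
    by (rule that)
qed

lemma dist_sq_partial_eigenbasis:
  assumes B: "orthonormal_basis B" and y: "\<And>u. u \<in> B \<Longrightarrow> app (angle_mat q p) u = y u *\<^sub>R u"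
  shows "dist_sq_partial m q p = (\<Sum>u\<in>B. \<Sum>n<Suc m. arc_sq_coeff n * y u ^ n)"
proof -
  have "tr (angle_mat q p ^ n) = (\<Sum>u\<in>B. y u ^ n)" for n
    unfolding tr_orthonormal_basis[OF B]
    using B by (intro sum.cong) (simp_all add: app_power_eigenvector[OF y] orthonormal_basis_def)
  then show ?thesis
    unfolding dist_sq_partial_def by (subst sum.swap) (simp add: sum_distrib_left)
qed

lemma dist_sq_partial_ge_0:
  assumes "reflection q" "reflection p"
  shows "0 \<le> dist_sq_partial m q p"
proof -
  obtain B y where "orthonormal_basis B" "\<And>u. u \<in> B \<Longrightarrow> app (angle_mat q p) u = y u *\<^sub>R u"
    "\<And>u. u \<in> B \<Longrightarrow> 0 \<le> y u \<and> y u \<le> 1"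
    using angle_mat_eigenbasis[OF assms] by metis
  then show ?thesis
    by (subst dist_sq_partial_eigenbasis) (auto intro!: sum_nonneg mult_nonneg_nonneg arc_sq_coeff_ge_0 simp del: sum.lessThan_Suc)
qed

lemma commutes_polynomial:
  fixes z a :: "'a::real_algebra_1"
  assumes "z * a = a * z"
  shows "z * (\<Sum>n<m. c n *\<^sub>R a ^ n) = (\<Sum>n<m. c n *\<^sub>R a ^ n) * z"
  using power_commuting_commutes[OF assms[symmetric]]
  by (simp add: sum_distrib_left sum_distrib_right)

text \<open>The first variation of the squared distance: only the component of the gradient tangent
  at \<open>p\<close> matters, and its Frobenius norm is a polynomial in \<open>angle_mat q p\<close>, which is bounded
  on the spectrum.\<close>

lemma dist_sq_partial_derivative_bound:
  fixes q p d :: "'n::finite matalg" and m :: nat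
  assumes q: "reflection q" and p: "reflection p" and d: "tangent_at p d"
  defines "Y \<equiv> angle_mat q p"
  defines "W \<equiv> \<Sum>n<m. diffs arc_sq_coeff n *\<^sub>R Y ^ n"
  shows "\<bar>tr (W * (- ((1/4) *\<^sub>R (q * d + d * q))))\<bar>
    \<le> 2 * sqrt (dist_sq_partial m q p + arc_tail (Suc m) * tr (1 :: 'n matalg)) * sqrt (tr (d * d))"
proof -
  have qp: "q * q = 1" "p * p = 1" "adj q = q" "adj p = p" and dd: "adj d = d" "d * p = - (p * d)"
    using q p d by (auto simp: reflection_def tangent_at_def)
  note cancel = reflection_cancel[OF q] reflection_cancel[OF p]
  have Yq: "q * Y = Y * q" and Yp: "p * Y = Y * p"
    by (simp_all add: Y_def angle_mat_def algebra_simps qp cancel)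
  have Wq: "q * W = W * q" and Wp: "p * W = W * p"
    unfolding W_def by (intro commutes_polynomial Yq Yp)+
  have adjY: "adj Y = Y"
    by (simp add: Y_def angle_mat_def adj_simps adj_mult qp add.commute)
  then have adjW: "adj W = W"
    by (simp add: W_def adj_simps adj_power)
  \<comment> \<open>The orthogonal projection of \<open>q\<close> to the tangent space at
    \<open>p\<close>. The tangential gradient is a multiple of \<open>T * W\<close>, because
    \<open>W\<close> commutes with \<open>p\<close> and \<open>q\<close>.\<close>
  define T where "T = (1/2) *\<^sub>R (q - p * q * p)"
  have adjT: "adj T = T"
    by (simp add: T_def adj_simps adj_mult qp mult.assoc)
  have pqpW: "p * q * p * W = W * (p * q * p)"
    by (metis Wp Wq mult.assoc)
  have TW: "T * W = W * T"
    using Wq pqpW by (simp add: T_def left_diff_distrib right_diff_distrib)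
  \<comment> \<open>The matrix form of
    \<open>(sin \<phi>)\<^sup>2 = 4 * y * (1 - y)\<close>.\<close>
  have TT: "T * T = 4 *\<^sub>R (Y * (1 - Y))"
  proof -
    define s where "s = q * p + p * q"
    have ss: "s * s = q * p * q * p + p * q * p * q + 2 *\<^sub>R 1"
      by (simp add: s_def distrib_left distrib_right mult.assoc cancel qp scaleR_2)
    have "Y * (1 - Y) = ((1/2) *\<^sub>R 1 - (1/4) *\<^sub>R s) * ((1/2) *\<^sub>R 1 + (1/4) *\<^sub>R s)"
    proof -
      have "1 - Y = (1/2) *\<^sub>R 1 + (1/4) *\<^sub>R s"
      proof -
        have "(1 :: 'n matalg) = (1/2) *\<^sub>R 1 + (1/2) *\<^sub>R 1"
          by (simp flip: scaleR_left_distrib)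
        then have "1 - Y = ((1/2) *\<^sub>R 1 + (1/2) *\<^sub>R 1) - Y"
          by (rule arg_cong)
        then show ?thesis
          by (simp add: Y_def angle_mat_def s_def)
      qed
      then show ?thesis
        by (simp only:) (simp add: Y_def angle_mat_def s_def)
    qed
    also have "\<dots> = (1/4) *\<^sub>R 1 - (1/16) *\<^sub>R (s * s)"
      by (simp add: distrib_left left_diff_distrib scaleR_diff_right)
    also have "4 *\<^sub>R \<dots> = 1 - (1/4) *\<^sub>R (s * s)"
      by (simp add: scaleR_diff_right)
    also have "\<dots> = (1/4) *\<^sub>R (2 *\<^sub>R 1 - q * p * q * p - p * q * p * q)"
    proof -
      have "(1 :: 'n matalg) = (1/2) *\<^sub>R 1 + (1/2) *\<^sub>R 1"
        by (simp flip: scaleR_left_distrib)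
      then have "1 - (1/4) *\<^sub>R (s * s) = ((1/2) *\<^sub>R 1 + (1/2) *\<^sub>R 1) - (1/4) *\<^sub>R (s * s)"
        by (rule arg_cong)
      then show ?thesis
        by (simp only:) (simp add: ss scaleR_diff_right scaleR_add_right)
    qed
    also have "\<dots> = T * T"
      using scaleR_add_right[of "1/4" "1 :: 'n matalg" 1] unfolding scaleR_2
      by (simp add: T_def left_diff_distrib right_diff_distrib mult.assoc cancel qp scaleR_diff_right)
    finally show ?thesis ..
  qed
  have trWqd: "tr (W * (q * d + d * q)) = 2 * tr (T * W * d)"
  proof -
    have "tr (W * (d * q)) = tr (W * (q * d))"
      using tr_mult_commute[of "W * d" q] Wq by (simp add: mult.assoc flip: mult.assoc[of q W])
    moreover have "tr (p * q * p * W * d) = - tr (W * (q * d))"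
    proof -
      have "tr (p * q * p * W * d) = tr (q * p * W * (d * p))"
        using tr_mult_commute[of p "q * p * W * d"] by (simp add: mult.assoc)
      also have "\<dots> = - tr (q * (p * W * p) * d)"
        unfolding dd(2) by (simp add: tr_simps mult.assoc)
      also have "p * W * p = W"
        by (simp add: Wp qp mult.assoc)
      finally show ?thesis
        by (simp add: Wq mult.assoc flip: mult.assoc[of q W])
    qed
    moreover have "T * W * d = (1/2) *\<^sub>R (q * W * d - p * q * p * W * d)"
      by (simp add: T_def left_diff_distrib)
    ultimately show ?thesis
      by (simp add: distrib_left tr_simps Wq mult.assoc)
  qed
  obtain B y where B: "orthonormal_basis B" and y: "\<And>u. u \<in> B \<Longrightarrow> app Y u = y u *\<^sub>R u"
    and y01: "\<And>u. u \<in> B \<Longrightarrow> 0 \<le> y u \<and> y u \<le> 1"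
    using angle_mat_eigenbasis[OF q p] unfolding Y_def by metis
  define w where "w u = (\<Sum>n<m. diffs arc_sq_coeff n * y u ^ n)" for u
  have appW: "app W u = w u *\<^sub>R u" if "u \<in> B" for u
    by (simp add: W_def w_def app.sum_left app.scaleR_left app_power_eigenvector[OF y[OF that]] scaleR_left.sum)
  have uu: "u \<bullet> u = 1" if "u \<in> B" for u
    using B that by (simp add: orthonormal_basis_def)
  have "tr (adj (T * W) * (T * W)) = tr (4 *\<^sub>R (Y * (1 - Y)) * W * W)"
    by (simp add: adj_mult adjT adjW TT[symmetric]) (metis TW mult.assoc)
  also have "\<dots> = (\<Sum>u\<in>B. 4 * (y u * (1 - y u) * (w u)\<^sup>2))"
    unfolding tr_orthonormal_basis[OF B]
    by (intro sum.cong refl)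
       (simp add: app_mult app.scaleR_left app.scaleR_right app.diff_left app.diff_right appW y uu
         inner_diff_left power2_eq_square algebra_simps)
  \<comment> \<open>The scalar estimate is applied to each eigenvalue. Every basis vector
    contributes one tail, so the tails add up to \<open>arc_tail (Suc m) * tr 1\<close>.\<close>
  also have "\<dots> \<le> (\<Sum>u\<in>B. 16 * ((\<Sum>n<Suc m. arc_sq_coeff n * y u ^ n) + arc_tail (Suc m)))"
    using arc_sq_partial_sum_deriv_bound[of _ m] y01 unfolding w_def arc_tail_def by (intro sum_mono) fastforce
  also have "\<dots> = 16 * (dist_sq_partial m q p + arc_tail (Suc m) * tr (1 :: 'n matalg))"
    using B uu unfolding tr_orthonormal_basis[OF B]
    by (simp add: dist_sq_partial_eigenbasis[OF B y[unfolded Y_def]] sum.distrib flip: sum_distrib_left)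
  finally have "sqrt (tr (adj (T * W) * (T * W))) \<le>
      sqrt (16 * (dist_sq_partial m q p + arc_tail (Suc m) * tr (1 :: 'n matalg)))"
    by simp
  also have "\<dots> = 4 * sqrt (dist_sq_partial m q p + arc_tail (Suc m) * tr (1 :: 'n matalg))"
    using real_sqrt_unique[of 4 16] by (subst real_sqrt_mult) simp
  finally have TWnorm: "sqrt (tr (adj (T * W) * (T * W))) \<le>
      4 * sqrt (dist_sq_partial m q p + arc_tail (Suc m) * tr (1 :: 'n matalg))" .
  have "tr (W * (- ((1/4) *\<^sub>R (q * d + d * q)))) = - (1/2) * tr (adj (T * W) * d)"
    using trWqd by (simp add: tr_simps adj_mult adjT adjW TW)
  then have "\<bar>tr (W * (- ((1/4) *\<^sub>R (q * d + d * q))))\<bar> = 1/2 * \<bar>tr (adj (T * W) * d)\<bar>"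
    by (simp add: abs_mult)
  also have "\<dots> \<le> 1/2 * (sqrt (tr (adj (T * W) * (T * W))) * sqrt (tr (adj d * d)))"
    by (intro mult_left_mono tr_Cauchy_Schwarz) simp
  also have "\<dots> \<le> 1/2 * (4 * sqrt (dist_sq_partial m q p + arc_tail (Suc m) * tr (1 :: 'n matalg)) * sqrt (tr (adj d * d)))"
    by (intro mult_left_mono mult_right_mono TWnorm real_sqrt_ge_zero tr_adj_mult_ge_0) simp
  finally show ?thesis
    by (simp add: dd mult_ac)
qed

lemma has_vector_derivative_dist_sq_partial:
  fixes p :: "real \<Rightarrow> 'n::finite matalg"
  assumes p: "(p has_vector_derivative d) (at t)"
  shows "((\<lambda>t. dist_sq_partial m q (p t)) has_vector_derivative
    tr ((\<Sum>n<m. diffs arc_sq_coeff n *\<^sub>R angle_mat q (p t) ^ n) * (- ((1/4) *\<^sub>R (q * d + d * q))))) (at t)"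
proof -
  let ?d = "- ((1/4) *\<^sub>R (q * d + d * q))"
  let ?Y = "angle_mat q (p t)"
  have "((\<lambda>t. angle_mat q (p t)) has_vector_derivative 0 - (1/4) *\<^sub>R (q * d + d * q)) (at t)"
    unfolding angle_mat_def
    by (intro has_vector_derivative_diff has_vector_derivative_const has_vector_derivative_add p
        bounded_linear.has_vector_derivative[OF bounded_linear_scaleR_right]
        has_vector_derivative_mult_left has_vector_derivative_mult_right)
  then have "((\<lambda>t. angle_mat q (p t)) has_vector_derivative ?d) (at t)"
    by simp
  then have "((\<lambda>t. dist_sq_partial m q (p t)) has_vector_derivative
      (\<Sum>n<Suc m. arc_sq_coeff n * (real n * tr (?Y ^ (n - 1) * ?d)))) (at t)"
    unfolding dist_sq_partial_def
    by (intro has_vector_derivative_sum has_vector_derivative_mult_right has_vector_derivative_tr_power)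
  also have "(\<Sum>n<Suc m. arc_sq_coeff n * (real n * tr (?Y ^ (n - 1) * ?d))) =
      tr ((\<Sum>n<m. diffs arc_sq_coeff n *\<^sub>R ?Y ^ n) * ?d)"
    unfolding sum.lessThan_Suc_shift sum_distrib_right tr_simps(6)
    by (simp add: diffs_def tr_simps mult_ac)
  finally show ?thesis .
qed

text \<open>The gradient estimate bounds the derivative of \<open>sqrt (E t)\<close> by the speed,
  since the factor \<open>2 * sqrt (E t)\<close> cancels. The positive shift keeps the root
  differentiable where \<open>dist_sq_partial\<close> vanishes. Integration over the curve gives the
  claim, and the shift remains as the value of E at time 0.\<close>

lemma curve_length_bound:
  fixes c :: "real \<Rightarrow> real^'n::finite^'n"
  assumes c: "valid_path c" "path_image c \<subseteq> Grassmannian k" "pathstart c = M" "pathfinish c = N"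
    and L: "((\<lambda>t. metric_norm trace_metric (vector_derivative c (at t))) has_integral L) {0..1}"
  defines "\<epsilon> \<equiv> \<lambda>m. arc_tail (Suc m) * tr (1 :: 'n matalg)"
  shows "sqrt (dist_sq_partial m (of_mat M) (of_mat N) + \<epsilon> m) \<le> sqrt (\<epsilon> m) + L"
proof -
  define q where "q = of_mat M"
  define p where "p t = of_mat (c t)" for t
  have refl: "reflection (p t)" if "t \<in> {0..1}" for t
    using subsetD[OF c(2), of "c t"] that by (simp add: p_def path_image_def Grassmannian_iff)
  have p01: "p 0 = q" "p 1 = of_mat N"
    using c(3,4) by (auto simp: p_def q_def pathstart_def pathfinish_def)
  have q: "reflection q"
    using refl[of 0] p01 by simp
  have \<epsilon>: "0 < \<epsilon> m"
    using arc_tail_pos[of m] by (simp add: \<epsilon>_def tr.rep_eq one_matalg.rep_eq trace_I)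
  define E where "E t = dist_sq_partial m q (p t) + \<epsilon> m" for t
  have E: "0 < E t" if "t \<in> {0..1}" for t
    using dist_sq_partial_ge_0[OF q refl[OF that], of m] \<epsilon> by (simp add: E_def)
  obtain S where S: "finite S" "c C1_differentiable_on {0..1} - S" and cont: "continuous_on {0..1} c"
    using c(1) unfolding valid_path_def piecewise_C1_differentiable_on_def by blast
  let ?s = "\<lambda>t. metric_norm trace_metric (vector_derivative c (at t))"
  let ?f = "\<lambda>t. sqrt (E t)"
  have deriv: "(?f has_vector_derivative vector_derivative ?f (at t)) (at t) \<and> vector_derivative ?f (at t) \<le> ?s t"
    if t: "t \<in> {0<..<1} - S" for t
  proof -
    define d where "d = of_mat (vector_derivative c (at t))"
    have "c differentiable at t"
      using S(2) t unfolding C1_differentiable_on_eq by auto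
    then have dp: "(p has_vector_derivative d) (at t)"
      unfolding p_def[abs_def] d_def by (intro has_vector_derivative_of_mat) (simp add: vector_derivative_works)
    have tan: "tangent_at (p t) d"
      by (rule reflection_curve_derivative[OF dp, of "{0<..<1}"]) (use t refl in auto)
    define D where "D = tr ((\<Sum>n<m. diffs arc_sq_coeff n *\<^sub>R angle_mat q (p t) ^ n) * (- ((1/4) *\<^sub>R (q * d + d * q))))"
    have Et: "0 < E t"
      using t by (intro E) auto
    have "(E has_real_derivative D) (at t)"
      unfolding E_def[abs_def] has_real_derivative_iff_has_vector_derivative D_def
      using has_vector_derivative_add[OF has_vector_derivative_dist_sq_partial[OF dp, of m q] has_vector_derivative_const]
      by simp
    then have "(?f has_real_derivative D * (inverse (sqrt (E t)) / 2)) (at t)"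
      using DERIV_chain2[where f = sqrt and g = E, OF DERIV_real_sqrt[OF Et]] by (simp add: mult.commute)
    then have f: "(?f has_vector_derivative D * (inverse (sqrt (E t)) / 2)) (at t)"
      by (simp add: has_real_derivative_iff_has_vector_derivative)
    have "D \<le> \<bar>D\<bar>"
      by simp
    also have "\<bar>D\<bar> \<le> 2 * sqrt (E t) * ?s t"
      using dist_sq_partial_derivative_bound[OF q refl tan, of m] t
      by (simp add: D_def E_def \<epsilon>_def d_def metric_norm_trace_metric)
    finally have "D * (inverse (sqrt (E t)) / 2) \<le> ?s t"
      using Et by (simp add: field_simps)
    then show ?thesis
      using f unfolding vector_derivative_at[OF f] by simp
  qed
  have contp: "continuous_on {0..1} p"
    unfolding p_def[abs_def] by (rule bounded_linear.continuous_on[OF bounded_linear_of_mat cont])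
  have "continuous_on {0..1} ?f"
    unfolding E_def dist_sq_partial_def angle_mat_def
    by (intro continuous_intros bounded_linear.continuous_on[OF bounded_linear_tr] contp)
  then have "((\<lambda>t. vector_derivative ?f (at t)) has_integral (?f 1 - ?f 0)) {0..1}"
    using deriv S(1) by (intro fundamental_theorem_of_calculus_interior_strong[of S]) auto
  then have "((\<lambda>t. if t \<in> S \<union> {0, 1} then 0 else vector_derivative ?f (at t)) has_integral (?f 1 - ?f 0)) {0..1}"
    by (rule has_integral_spike_finite[of "S \<union> {0, 1}", rotated 2]) (use S(1) in auto)
  moreover have "((\<lambda>t. if t \<in> S \<union> {0, 1} then 0 else ?s t) has_integral L) {0..1}"
    using L by (rule has_integral_spike_finite[of "S \<union> {0, 1}", rotated 2]) (use S(1) in auto)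
  ultimately have "?f 1 - ?f 0 \<le> L"
    by (rule has_integral_le) (use deriv in auto)
  moreover have "angle_mat q q = 0"
    using q by (simp add: angle_mat_def reflection_def flip: scaleR_2)
  then have "dist_sq_partial m q q = 0"
    by (auto simp: dist_sq_partial_def power_0_left arc_sq_coeff_def tr_simps intro!: sum.neutral)
  ultimately show ?thesis
    by (simp add: E_def p01 q_def)
qed

text \<open>As m grows, the partial sums tend to the squared norm of \<open>v\<close> and the shift
  to 0. The assumption bounds the operator norm by \<pi>, not the Frobenius norm, because the latter
  is what the estimate is meant to control.\<close>

lemma geodesic_dist_Grassmannian_ge:
  fixes M :: "real^'n::finite^'n"
  assumes v: "v \<in> tangent_space (Grassmannian k) M"
    and le_pi: "\<And>u. norm (app (of_mat v) u) \<le> pi * norm u"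
  shows "ereal (metric_norm trace_metric v)
    \<le> geodesic_dist trace_metric (Grassmannian k) M (riem_exp trace_metric (Grassmannian k) M v)"
proof -
  define q x where "q = of_mat M" and "x = of_mat v"
  define p where "p = geodesic_curve q x 1"
  have q: "reflection q" and x: "tangent_at q x"
    using v by (simp_all add: tangent_space_Grassmannian Grassmannian_iff q_def x_def)
  obtain B l where B: "orthonormal_basis B" and l: "\<And>u. u \<in> B \<Longrightarrow> app (x * x) u = (l u)\<^sup>2 *\<^sub>R u"
    "\<And>u. 0 \<le> l u" "\<And>u. u \<in> B \<Longrightarrow> norm (app x u) = l u" and trx: "tr (x * x) = (\<Sum>u\<in>B. (l u)\<^sup>2)"
    using tangent_eigenbasis[OF x] by metis
  have Y: "app (angle_mat q p) u = (sin (l u / 2))\<^sup>2 *\<^sub>R u" if "u \<in> B" for u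
    unfolding p_def by (rule app_geodesic_curve(1)[OF q x l(1,3)]) (use that in auto)
  have l_pi: "l u \<le> pi" if "u \<in> B" for u
  proof -
    have "norm u = 1"
      using B that by (simp add: orthonormal_basis_def norm_eq_1)
    then show ?thesis
      using le_pi[of u] l(3)[OF that] by (simp add: x_def)
  qed
  have eq: "dist_sq_partial m q p = (\<Sum>u\<in>B. \<Sum>n<Suc m. arc_sq_coeff n * (sin (l u / 2))\<^sup>2 ^ n)" for m
    by (rule dist_sq_partial_eigenbasis[OF B Y])
  have "(\<lambda>m. dist_sq_partial m q p) \<longlonglongrightarrow> tr (x * x)"
    unfolding eq trx
    by (intro tendsto_sum LIMSEQ_Suc)
       (use arc_sq_sums[OF l(2) l_pi] in \<open>simp add: sums_def\<close>)
  then have lim: "(\<lambda>m. sqrt (dist_sq_partial m q p + arc_tail (Suc m) * tr (1 :: 'n matalg))) \<longlonglongrightarrow> sqrt (tr (x * x) + 0 * tr (1 :: 'n matalg))"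
    by (intro tendsto_intros arc_tail_tendsto)
  have lim0: "(\<lambda>m. sqrt (arc_tail (Suc m) * tr (1 :: 'n matalg)) + L) \<longlonglongrightarrow> sqrt (0 * tr (1 :: 'n matalg)) + L" for L
    by (intro tendsto_intros arc_tail_tendsto)
  have "sqrt (tr (x * x)) \<le> L"
    if "valid_path c" "path_image c \<subseteq> Grassmannian k" "pathstart c = M" "pathfinish c = to_mat p"
      "((\<lambda>t. metric_norm trace_metric (vector_derivative c (at t))) has_integral L) {0..1}" for L c
    using LIMSEQ_le[OF lim lim0] curve_length_bound[OF that] by (simp add: q_def)
  moreover have "riem_exp trace_metric (Grassmannian k) M v = to_mat p"
    using riem_exp_Grassmannian[OF v] by (simp add: p_def q_def x_def)
  ultimately show ?thesis
    unfolding geodesic_dist_def metric_norm_trace_metric x_def[symmetric]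
    by (intro Inf_greatest) auto
qed

section \<open>Block matrices and the CS decomposition\<close>

lemma block_mat_nth [simp]:
  "block_mat A B C D $ Inl i $ Inl j = A $ i $ j" "block_mat A B C D $ Inl i $ Inr l = B $ i $ l"
  "block_mat A B C D $ Inr k $ Inl j = C $ k $ j" "block_mat A B C D $ Inr k $ Inr l = D $ k $ l"
  by (simp_all add: block_mat_def)

lemma block_mat_eqI:
  fixes M N :: "real^('k::finite + 'l::finite)^('k + 'l)"
  assumes "\<And>i j. M $ Inl i $ Inl j = N $ Inl i $ Inl j" "\<And>i l. M $ Inl i $ Inr l = N $ Inl i $ Inr l"
    "\<And>k j. M $ Inr k $ Inl j = N $ Inr k $ Inl j" "\<And>k l. M $ Inr k $ Inr l = N $ Inr k $ Inr l"
  shows "M = N"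
proof -
  have "M $ i $ j = N $ i $ j" for i j
    using assms by (cases i; cases j) auto
  then show ?thesis
    by (simp add: vec_eq_iff)
qed

lemma sum_UNIV_Plus: "(\<Sum>i\<in>(UNIV :: ('a::finite + 'b::finite) set). f i) = (\<Sum>i\<in>UNIV. f (Inl i)) + (\<Sum>i\<in>UNIV. f (Inr i))"
  by (simp add: sum.Plus o_def flip: UNIV_Plus_UNIV)

lemma block_mat_mult:
  "block_mat A B C D ** block_mat A' B' C' D' =
    block_mat (A ** A' + B ** C') (A ** B' + B ** D') (C ** A' + D ** C') (C ** B' + D ** D')"
  by (rule block_mat_eqI) (simp_all add: matrix_matrix_mult_def sum_UNIV_Plus)

lemma transpose_block_mat:
  "transpose (block_mat A B C D) = block_mat (transpose A) (transpose C) (transpose B) (transpose D)"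
  by (rule block_mat_eqI) (simp_all add: transpose_def)

lemma block_mat_scaleR: "r *\<^sub>R block_mat A B C D = block_mat (r *\<^sub>R A) (r *\<^sub>R B) (r *\<^sub>R C) (r *\<^sub>R D)"
  by (rule block_mat_eqI) simp_all

lemma block_mat_one: "block_mat (mat 1) 0 0 (mat 1) = mat 1"
  by (rule block_mat_eqI) (simp_all add: mat_def)

lemma matrix_mult_0 [simp]: "(0 :: real^'m^'n) ** A = 0" "A ** (0 :: real^'m^'n) = 0"
  by (simp_all add: vec_eq_iff matrix_matrix_mult_def)

lemma matrix_mult_minus [simp]: "(- A) ** B = - (A ** B)" "A ** (- B) = - (A ** B)" for A :: "real^'m^'n"
  by (simp_all add: vec_eq_iff matrix_matrix_mult_def sum_negf)

lemma transpose_minus: "transpose (- A) = - transpose A" for A :: "real^'m^'n"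
  by (simp add: vec_eq_iff transpose_def)

lemma transpose_zero [simp]: "transpose (0 :: real^'m^'n) = 0"
  by (simp add: vec_eq_iff transpose_def)

text \<open>These matrices form the stabiliser of the signature. For this reason W and Z drop out of
  \<open>Q1\<close>, and \<open>V0\<close> may be multiplied by diag (U, V) without changing
  \<open>Q0\<close>.\<close>

lemma signature_conj_block_diag:
  assumes "orthogonal_matrix A" "orthogonal_matrix B"
  shows "block_mat A 0 0 B ** signature_mat ** transpose (block_mat A 0 0 B) = signature_mat"
  using assms
  by (simp add: signature_mat_def transpose_block_mat block_mat_mult orthogonal_matrix_def)

lemma orthogonal_block_diag:
  assumes "orthogonal_matrix A" "orthogonal_matrix B"
  shows "orthogonal_matrix (block_mat A 0 0 B)"
  using assms
  by (simp add: orthogonal_matrix transpose_block_mat block_mat_mult block_mat_one)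

lemma signature_mat_square: "signature_mat ** signature_mat = mat 1"
  by (simp add: signature_mat_def block_mat_mult block_mat_one)

lemma transpose_signature_mat: "transpose signature_mat = signature_mat"
  by (simp add: signature_mat_def transpose_block_mat transpose_minus)

section \<open>CS matrices as a one-parameter group\<close>

context
  fixes e :: "'k::finite \<Rightarrow> 'l::finite"
  assumes e: "inj e"
begin

lemma diag_pad_zero_mult_transpose:
  "diag_pad_zero e f ** transpose (diag_pad_zero e g) = diag_mat (\<lambda>i. f i * g i)"
proof -
  have "(\<Sum>l\<in>UNIV. (if l = e i then f i else 0) * (if l = e j then g j else 0)) = (if i = j then f i * g i else 0)" for i j
  proof -
    have "(\<Sum>l\<in>UNIV. (if l = e i then f i else 0) * (if l = e j then g j else 0)) =
        (\<Sum>l\<in>UNIV. if l = e i then (if e i = e j then f i * g j else 0) else 0)"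
      by (intro sum.cong) auto
    then show ?thesis
      using e by (auto simp: inj_eq)
  qed
  then show ?thesis
    by (simp add: vec_eq_iff matrix_matrix_mult_def diag_pad_zero_def transpose_def diag_mat_def)
qed

lemma transpose_diag_pad_zero_mult:
  "transpose (diag_pad_zero e f) ** diag_pad_zero e g =
    diag_mat (\<lambda>l. if l \<in> range e then f (inv e l) * g (inv e l) else 0)"
proof -
  have "(\<Sum>i\<in>UNIV. (if l = e i then f i else 0) * (if l' = e i then g i else 0)) =
      (if l = l' then if l \<in> range e then f (inv e l) * g (inv e l) else 0 else 0)" for l l'
  proof (cases "l \<in> range e")
    case True
    then obtain i where i: "l = e i"
      by blast
    have "(\<Sum>i'\<in>UNIV. (if l = e i' then f i' else 0) * (if l' = e i' then g i' else 0)) =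
        (\<Sum>i'\<in>UNIV. if i' = i then (if l' = e i then f i * g i else 0) else 0)"
      using e by (intro sum.cong) (auto simp: i inj_eq)
    then show ?thesis
      using e i by (auto simp: inv_f_f inj_eq)
  next
    case False
    then have "(\<Sum>i\<in>UNIV. (if l = e i then f i else 0) * (if l' = e i then g i else 0)) = 0"
      by (intro sum.neutral) auto
    with False show ?thesis
      by auto
  qed
  then show ?thesis
    by (simp add: vec_eq_iff matrix_matrix_mult_def diag_pad_zero_def transpose_def diag_mat_def)
qed

lemma diag_mat_mult_diag_pad_zero: "diag_mat f ** diag_pad_zero e g = diag_pad_zero e (\<lambda>i. f i * g i)"
proof -
  have "(\<Sum>j\<in>UNIV. (if i = j then f i else 0) * (if l = e j then g j else 0)) = (if l = e i then f i * g i else 0)" for i l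
  proof -
    have "(\<Sum>j\<in>UNIV. (if i = j then f i else 0) * (if l = e j then g j else 0)) =
        (\<Sum>j\<in>UNIV. if i = j then (if l = e i then f i * g i else 0) else 0)"
      by (intro sum.cong) auto
    then show ?thesis
      by simp
  qed
  then show ?thesis
    by (simp add: vec_eq_iff matrix_matrix_mult_def diag_pad_zero_def diag_mat_def)
qed

lemma diag_pad_zero_mult_diag_pad_one:
  "diag_pad_zero e f ** diag_pad_one e g = diag_pad_zero e (\<lambda>i. f i * g i)"
proof -
  have "(\<Sum>l\<in>UNIV. (if l = e i then f i else 0) * (if l = l' then if l \<in> range e then g (inv e l) else 1 else 0)) =
      (if l' = e i then f i * g i else 0)" for i l'
  proof -
    have "(\<Sum>l\<in>UNIV. (if l = e i then f i else 0) * (if l = l' then if l \<in> range e then g (inv e l) else 1 else 0)) =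
        (\<Sum>l\<in>UNIV. if l = e i then (if l' = e i then f i * g i else 0) else 0)"
      using e by (intro sum.cong) (auto simp: inv_f_f)
    then show ?thesis
      by simp
  qed
  then show ?thesis
    by (simp add: vec_eq_iff matrix_matrix_mult_def diag_pad_zero_def diag_pad_one_def diag_mat_def)
qed

lemma transpose_diag_mat: "transpose (diag_mat f) = diag_mat f"
  by (auto simp: vec_eq_iff transpose_def diag_mat_def)

lemma transpose_diag_pad_one: "transpose (diag_pad_one e f) = diag_pad_one e f"
  by (auto simp: vec_eq_iff transpose_def diag_pad_one_def diag_mat_def)

lemma transpose_diag_pad_zero_mult_diag_mat:
  "transpose (diag_pad_zero e f) ** diag_mat g = transpose (diag_pad_zero e (\<lambda>i. f i * g i))"
  by (rule transpose_iff[THEN iffD1])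
     (simp add: matrix_transpose_mul transpose_diag_mat diag_mat_mult_diag_pad_zero mult.commute)

lemma diag_pad_one_mult_transpose_diag_pad_zero:
  "diag_pad_one e g ** transpose (diag_pad_zero e f) = transpose (diag_pad_zero e (\<lambda>i. f i * g i))"
  by (rule transpose_iff[THEN iffD1])
     (simp add: matrix_transpose_mul transpose_diag_pad_one diag_pad_zero_mult_diag_pad_one)

lemma CS_mat_0: "CS_mat e (\<lambda>i. 0) = mat 1"
  by (rule block_mat_eqI)
     (auto simp: CS_mat_def diag_mat_def diag_pad_zero_def diag_pad_one_def transpose_def mat_def)

text \<open>The infinitesimal generator: \<open>CS_mat\<close> with the angles
  \<open>t * \<theta> i\<close> is the exponential of t times this skew-symmetric matrix.\<close>

definition CS_gen :: "('k \<Rightarrow> real) \<Rightarrow> real^('k+'l)^('k+'l)" where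
  "CS_gen \<theta> = block_mat 0 (diag_pad_zero e \<theta>) (- transpose (diag_pad_zero e \<theta>)) 0"

lemma CS_gen_commute: "CS_gen \<theta> ** CS_mat e \<eta> = CS_mat e \<eta> ** CS_gen \<theta>"
  by (simp add: CS_gen_def CS_mat_def block_mat_mult diag_pad_zero_mult_transpose transpose_diag_pad_zero_mult
      diag_mat_mult_diag_pad_zero diag_pad_zero_mult_diag_pad_one transpose_diag_pad_zero_mult_diag_mat
      diag_pad_one_mult_transpose_diag_pad_zero mult.commute cong: if_cong)

lemma CS_gen_square:
  "CS_gen \<theta> ** CS_gen \<theta> = - diag_mat (\<lambda>j. case j of Inl i \<Rightarrow> (\<theta> i)\<^sup>2
     | Inr l \<Rightarrow> if l \<in> range e then (\<theta> (inv e l))\<^sup>2 else 0)"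
  by (rule block_mat_eqI)
     (auto simp: CS_gen_def block_mat_mult diag_pad_zero_mult_transpose transpose_diag_pad_zero_mult
       diag_mat_def power2_eq_square)

lemma transpose_CS_gen: "transpose (CS_gen \<theta>) = - CS_gen \<theta>"
  by (rule block_mat_eqI) (auto simp: CS_gen_def transpose_def)

lemma CS_gen_signature: "CS_gen \<theta> ** signature_mat = - (signature_mat ** CS_gen \<theta>)"
  by (rule block_mat_eqI) (simp_all add: CS_gen_def signature_mat_def block_mat_mult)

lemma has_vector_derivative_matI:
  fixes f :: "real \<Rightarrow> real^'m::finite^'n::finite"
  assumes "\<And>i j. ((\<lambda>t. f t $ i $ j) has_real_derivative f' $ i $ j) (at t)"
  shows "(f has_vector_derivative f') (at t)"
  unfolding has_vector_derivative_def
proof (subst has_derivative_componentwise_within, intro ballI)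
  fix b :: "real^'m^'n" assume "b \<in> Basis"
  then obtain i j where b: "b = axis i (axis j 1)"
    by (auto simp: Basis_vec_def)
  show "((\<lambda>t. f t \<bullet> b) has_derivative (\<lambda>x. (x *\<^sub>R f') \<bullet> b)) (at t)"
    using assms[of i j] by (simp add: b inner_axis has_field_derivative_def mult.commute[of _ "f' $ i $ j"])
qed

lemma CS_mat_derivative:
  "((\<lambda>t. CS_mat e (\<lambda>i. t * \<theta> i)) has_vector_derivative CS_mat e (\<lambda>i. t * \<theta> i) ** CS_gen \<theta>) (at t)"
proof (rule has_vector_derivative_matI)
  have eq: "CS_mat e (\<lambda>i. t * \<theta> i) ** CS_gen \<theta> = block_mat
      (diag_mat (\<lambda>i. - sin (t * \<theta> i) * \<theta> i)) (diag_pad_zero e (\<lambda>i. cos (t * \<theta> i) * \<theta> i))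
      (- transpose (diag_pad_zero e (\<lambda>i. cos (t * \<theta> i) * \<theta> i)))
      (diag_mat (\<lambda>l. if l \<in> range e then - sin (t * \<theta> (inv e l)) * \<theta> (inv e l) else 0))"
    by (rule block_mat_eqI; simp add: CS_gen_def CS_mat_def block_mat_mult diag_pad_zero_mult_transpose
        transpose_diag_pad_zero_mult diag_mat_mult_diag_pad_zero diag_pad_one_mult_transpose_diag_pad_zero
        mult.commute; auto simp: diag_mat_def mult.commute)
  show "((\<lambda>t. CS_mat e (\<lambda>i. t * \<theta> i) $ a $ b) has_real_derivative
      (CS_mat e (\<lambda>i. t * \<theta> i) ** CS_gen \<theta>) $ a $ b) (at t)" for a b
    unfolding eq unfolding CS_mat_def
    by (cases a; cases b)
       (auto simp: diag_mat_def diag_pad_zero_def diag_pad_one_def transpose_def intro!: derivative_eq_intros)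
qed

end

lemma norm_diag_mat_le:
  fixes f :: "'n::finite \<Rightarrow> real"
  assumes "\<And>i. 0 \<le> f i \<and> f i \<le> r"
  shows "app (of_mat (diag_mat f)) u \<bullet> u \<le> r * (norm u)\<^sup>2"
proof -
  have "(diag_mat f *v u) $ i = f i * u $ i" for i
    by (simp add: diag_mat_def matrix_vector_mult_def if_distrib[of "\<lambda>z. z * _"] cong: if_cong)
  then have "app (of_mat (diag_mat f)) u \<bullet> u = (\<Sum>i\<in>UNIV. f i * (u $ i)\<^sup>2)"
    by (simp add: app.rep_eq inner_vec_def power2_eq_square mult.assoc)
  also have "\<dots> \<le> (\<Sum>i\<in>UNIV. r * (u $ i)\<^sup>2)"
    using assms by (intro sum_mono mult_right_mono) auto
  also have "\<dots> = r * (norm u)\<^sup>2"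
    unfolding power2_norm_eq_inner inner_vec_def sum_distrib_left by (simp add: power2_eq_square)
  finally show ?thesis .
qed

lemma norm_app_orthogonal: "adj g * g = 1 \<Longrightarrow> norm (app g u) = norm u"
  by (simp add: norm_eq_sqrt_inner inner_app flip: app_mult)

lemma of_mat_mult: "of_mat (A ** B) = of_mat A * of_mat B"
  by (rule to_mat_inject[THEN iffD1]) (simp add: times_matalg.rep_eq)

lemma of_mat_transpose: "of_mat (transpose A) = adj (of_mat A)"
  by (rule to_mat_inject[THEN iffD1]) (simp add: adj.rep_eq)

lemma of_mat_one: "of_mat (mat 1) = 1"
  by (rule to_mat_inject[THEN iffD1]) (simp add: one_matalg.rep_eq)

lemma of_mat_minus: "of_mat (- A) = - of_mat A"
  by (rule to_mat_inject[THEN iffD1]) (simp add: uminus_matalg.rep_eq)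

lemma of_mat_scaleR: "of_mat (r *\<^sub>R A) = r *\<^sub>R of_mat A"
  by (rule to_mat_inject[THEN iffD1]) (simp add: scaleR_matalg.rep_eq)

lemmas of_mat_simps = of_mat_mult of_mat_transpose of_mat_one of_mat_minus of_mat_scaleR

lemma orthogonal_of_mat:
  assumes "orthogonal_matrix A"
  shows "adj (of_mat A) * of_mat A = 1" "of_mat A * adj (of_mat A) = 1"
  using assms by (simp_all add: orthogonal_matrix_def flip: of_mat_simps)

text \<open>With \<open>K = CS_gen e \<theta>\<close>, the curve \<open>t \<mapsto> g exp (t K) S exp (t K)\<^sup>T g\<^sup>T\<close> is the geodesic from
  \<open>g S g\<^sup>T\<close> with initial velocity \<open>- 2 g S K g\<^sup>T\<close>.\<close>

lemma CS_geodesic: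
  fixes g :: "('k::finite + 'l::finite) matalg" and e :: "'k \<Rightarrow> 'l" and \<theta> :: "'k \<Rightarrow> real"
  assumes e: "inj e" and g: "adj g * g = 1" "g * adj g = 1"
  defines "S \<equiv> of_mat signature_mat" and "K \<equiv> of_mat (CS_gen e \<theta>)"
  defines "q \<equiv> g * S * adj g" and "x \<equiv> - (2 *\<^sub>R (g * (S * K) * adj g))"
  shows "tangent_at q x"
    and "geodesic_curve q x 1 = g * of_mat (CS_mat e \<theta>) * S * adj (of_mat (CS_mat e \<theta>)) * adj g"
    and "(\<And>i. 0 \<le> \<theta> i \<and> \<theta> i \<le> pi / 2) \<Longrightarrow> norm (app x u) \<le> pi * norm u"
proof -
  have SS: "S * S = 1" "S * (S * y) = y" and adjS: "adj S = S" for y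
  proof -
    show "S * S = 1" "adj S = S"
      by (simp_all add: S_def signature_mat_square transpose_signature_mat flip: of_mat_simps)
    then show "S * (S * y) = y"
      by (simp flip: mult.assoc)
  qed
  have KS: "K * S = - (S * K)" and adjK: "adj K = - K"
    using CS_gen_signature[OF e] transpose_CS_gen[OF e]
    by (simp_all add: S_def K_def flip: of_mat_simps)
  have KSy: "K * (S * y) = - (S * (K * y))" for y
    using KS by (simp flip: mult.assoc)
  have gg: "adj g * (g * y) = y" "g * (adj g * y) = y" for y
    using g by (simp_all flip: mult.assoc)
  have "adj x = x"
    by (simp add: x_def adj_simps adj_mult adjS adjK KS mult.assoc)
  moreover have "x * q = - (q * x)"
    by (simp add: x_def q_def mult.assoc gg KSy)
  ultimately show "tangent_at q x"
    by (simp add: tangent_at_def)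
  define C where "C t = of_mat (CS_mat e (\<lambda>i. t * \<theta> i))" for t
  \<comment> \<open>The derivative of \<open>c\<close> falls on both copies of \<open>C\<close>.
    Since \<open>S\<close> anticommutes with \<open>K\<close>, the two contributions agree, which is
    the origin of the factor 2; \<open>c\<close> and the geodesic curve then solve the same linear
    equation, as \<open>A = q * x\<close>.\<close>
  define A where "A = - (2 *\<^sub>R (g * K * adj g))"
  define c where "c t = g * C t * S * adj (C t) * adj g" for t
  have C': "(C has_vector_derivative C t * K) (at t)" for t
    unfolding C_def[abs_def] K_def of_mat_mult[symmetric]
    by (intro has_vector_derivative_of_mat CS_mat_derivative[OF e])
  have "K * C t = C t * K" for t
    using CS_gen_commute[OF e, of \<theta> "\<lambda>i. t * \<theta> i"] by (simp add: C_def K_def flip: of_mat_mult)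
  then have "adj (K * C t) = adj (C t * K)" for t
    by simp
  then have adjCK: "adj (C t) * K = K * adj (C t)" for t
    by (simp add: adj_mult adjK)
  have "(c has_vector_derivative c t * A) (at t)" for t
  proof -
    have "((\<lambda>t. C t * S * adj (C t)) has_vector_derivative
        (C t * S) * adj (C t * K) + (C t * K * S) * adj (C t)) (at t)"
      by (intro has_vector_derivative_mult C' bounded_linear.has_vector_derivative[OF bounded_linear_adj]
          has_vector_derivative_mult_left)
    then have "((\<lambda>t. g * (C t * S * adj (C t)) * adj g) has_vector_derivative
        g * ((C t * S) * adj (C t * K) + (C t * K * S) * adj (C t)) * adj g) (at t)"
      by (intro has_vector_derivative_mult_left has_vector_derivative_mult_right)
    moreover have "g * ((C t * S) * adj (C t * K) + (C t * K * S) * adj (C t)) * adj g = c t * A"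
    proof -
      have "(C t * S) * adj (C t * K) + (C t * K * S) * adj (C t) = - (2 *\<^sub>R (C t * S * (K * adj (C t))))"
        by (simp add: adj_mult adjK KSy mult.assoc scaleR_2)
      also have "g * \<dots> * adj g = c t * A"
        by (simp add: c_def A_def mult.assoc gg flip: adjCK)
      finally show ?thesis .
    qed
    ultimately show ?thesis
      by (simp add: c_def[abs_def] mult.assoc)
  qed
  then have "c 1 = c 0 * exp (1 *\<^sub>R A)"
    by (intro linear_ode_unique[of "-1" 2]) auto
  moreover have "c 0 = q"
    by (simp add: c_def C_def CS_mat_0[OF e] of_mat_one q_def)
  moreover have "A = q * x"
    by (simp add: A_def q_def x_def mult.assoc gg SS)
  ultimately show "geodesic_curve q x 1 = g * of_mat (CS_mat e \<theta>) * S * adj (of_mat (CS_mat e \<theta>)) * adj g"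
    by (simp add: geodesic_curve_def c_def C_def)
  show "norm (app x u) \<le> pi * norm u" if \<theta>: "\<And>i. 0 \<le> \<theta> i \<and> \<theta> i \<le> pi / 2"
  proof -
    have sq: "0 \<le> (\<theta> i)\<^sup>2 \<and> (\<theta> i)\<^sup>2 \<le> (pi / 2)\<^sup>2" for i
      using \<theta>[of i] by (auto intro!: power_mono simp del: power_divide)
    \<comment> \<open>By skew-symmetry the squared norm of \<open>K w\<close> is the quadratic form
      of \<open>- K * K\<close>, which is diagonal with entries \<open>(\<theta> i)\<^sup>2\<close>
      and 0.\<close>
    have K_le: "norm (app K w) \<le> pi / 2 * norm w" for w
    proof -
      have "(norm (app K w))\<^sup>2 = app (- (K * K)) w \<bullet> w"
        using inner_app[of K "app K w" w] adjK
        by (simp add: power2_norm_eq_inner app_mult app.minus_left inner_commute)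
      also have "\<dots> \<le> (pi / 2)\<^sup>2 * (norm w)\<^sup>2"
        unfolding K_def of_mat_mult[symmetric] CS_gen_square[OF e] of_mat_minus minus_minus
        by (rule norm_diag_mat_le) (use sq in \<open>auto split: sum.split\<close>)
      finally have "(norm (app K w))\<^sup>2 \<le> (pi / 2 * norm w)\<^sup>2"
        by (simp only: power_mult_distrib)
      then show ?thesis
        by (rule power2_le_imp_le) simp
    qed
    have "norm (app x u) = 2 * norm (app g (app S (app K (app (adj g) u))))"
      by (simp add: x_def app.minus_left app.scaleR_left app_mult)
    also have "\<dots> = 2 * norm (app K (app (adj g) u))"
      using SS(1) adjS by (simp add: norm_app_orthogonal g)
    also have "\<dots> \<le> 2 * (pi / 2 * norm (app (adj g) u))"
      by (intro mult_left_mono K_le) simp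
    also have "\<dots> = pi * norm u"
      using norm_app_orthogonal[of "adj g" u] g by simp
    finally show ?thesis .
  qed
qed

theorem corollary4p7:
  fixes Q0 Q1 V0 V1 :: "real^('k::finite + 'l::finite)^('k + 'l)"
    and U W :: "real^'k^'k" and V Z :: "real^'l^'l"
    and \<theta> :: "'k \<Rightarrow> real" and e :: "'k \<Rightarrow> 'l" and B :: "real^'l^'k"
  assumes k_ge: "1 \<le> CARD('k)" and k_le: "2 * CARD('k) \<le> CARD('k + 'l)"
    and Q0_in: "Q0 \<in> Grassmannian CARD('k)" and Q1_in: "Q1 \<in> Grassmannian CARD('k)"
    and dist: "geodesic_dist trace_metric (Grassmannian CARD('k)) Q0 Q1 < ereal (sqrt 2 * pi)"
    and orth_V0: "orthogonal_matrix V0" and orth_V1: "orthogonal_matrix V1"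
    and Q0_eq: "Q0 = V0 ** signature_mat ** transpose V0"
    and Q1_eq: "Q1 = V1 ** signature_mat ** transpose V1"
    and inj_e: "inj e"
    and orth_U: "orthogonal_matrix U" and orth_W: "orthogonal_matrix W"
    and orth_V: "orthogonal_matrix V" and orth_Z: "orthogonal_matrix Z"
    and \<theta>_range: "\<And>i. 0 \<le> \<theta> i \<and> \<theta> i \<le> pi / 2"
    and CS: "transpose V0 ** V1 = block_mat U 0 0 V ** CS_mat e \<theta> ** transpose (block_mat W 0 0 Z)"
    and B_eq: "B = - 2 *\<^sub>R (U ** diag_pad_zero e \<theta> ** transpose V)"
  shows "Q1 \<in> log_domain trace_metric (Grassmannian CARD('k)) Q0 \<and>
         riem_log trace_metric (Grassmannian CARD('k)) Q0 Q1
           = V0 ** block_mat 0 B (transpose B) 0 ** transpose V0"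
proof -
  define D E where "D = block_mat U 0 0 V" and "E = block_mat W 0 0 Z"
  define g where "g = of_mat (V0 ** D)"
  define S where "S = of_mat (signature_mat :: real^('k + 'l)^('k + 'l))"
  define K where "K = of_mat (CS_gen e \<theta>)"
  define C where "C = of_mat (CS_mat e \<theta>)"
  define v where "v = V0 ** block_mat 0 B (transpose B) 0 ** transpose V0"
  have orth_D: "orthogonal_matrix D" and orth_E: "orthogonal_matrix E"
    unfolding D_def E_def by (intro orthogonal_block_diag orth_U orth_V orth_W orth_Z)+
  have g: "adj g * g = 1" "g * adj g = 1"
    using orthogonal_of_mat[OF orthogonal_matrix_mul[OF orth_V0 orth_D]] by (simp_all add: g_def)
  have ESE: "E ** signature_mat ** transpose E = signature_mat"
    and DSD: "D ** signature_mat ** transpose D = signature_mat"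
    unfolding D_def E_def by (intro signature_conj_block_diag orth_U orth_V orth_W orth_Z)+
  have ESE': "transpose E ** signature_mat ** E = signature_mat"
    using signature_conj_block_diag[of "transpose W" "transpose Z"] orth_W orth_Z
    by (simp add: E_def transpose_block_mat)
  have q: "of_mat Q0 = g * S * adj g"
    using DSD by (simp add: Q0_eq g_def S_def matrix_transpose_mul matrix_mul_assoc flip: of_mat_simps)
       (simp add: matrix_mul_assoc[symmetric])
  have V1: "of_mat V1 = g * C * adj (of_mat E)"
  proof -
    have "V1 = V0 ** (transpose V0 ** V1)"
      using orth_V0 by (simp add: matrix_mul_assoc orthogonal_matrix_def)
    then have "V1 = V0 ** (D ** CS_mat e \<theta> ** transpose E)"
      unfolding CS D_def E_def .
    then show ?thesis
      by (simp add: g_def C_def of_mat_simps mult.assoc)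
  qed
  have p: "of_mat Q1 = g * C * S * adj C * adj g"
  proof -
    have "adj (of_mat E) * (S * of_mat E) = S"
      using ESE' by (simp add: S_def matrix_mul_assoc flip: of_mat_simps)
    then have "adj (of_mat E) * (S * (of_mat E * y)) = S * y" for y
      by (metis mult.assoc)
    then show ?thesis
      by (simp add: Q1_eq of_mat_simps V1 adj_mult mult.assoc flip: S_def)
  qed
  \<comment> \<open>Multiplication by the signature flips the sign of the lower left block of the
    generator, turning the skew-symmetric matrix into a symmetric one; conjugation by
    \<open>D\<close> then inserts U and V.\<close>
  have x: "of_mat v = - (2 *\<^sub>R (g * (S * K) * adj g))"
  proof -
    have "D ** (signature_mat ** CS_gen e \<theta>) ** transpose D =
        block_mat 0 (U ** diag_pad_zero e \<theta> ** transpose V) (transpose (U ** diag_pad_zero e \<theta> ** transpose V)) 0"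
      by (simp add: D_def signature_mat_def CS_gen_def[OF inj_e] transpose_block_mat block_mat_mult
          matrix_transpose_mul matrix_mul_assoc)
    then have "block_mat 0 B (transpose B) 0 = - 2 *\<^sub>R (D ** (signature_mat ** CS_gen e \<theta>) ** transpose D)"
      by (simp only: B_eq transpose_scalar block_mat_scaleR scaleR_zero_right)
    then show ?thesis
      by (simp add: v_def g_def S_def K_def of_mat_simps adj_mult mult.assoc)
  qed
  note geo = CS_geodesic[OF inj_e g, of \<theta>, folded S_def K_def, folded q x]
  have v: "v \<in> tangent_space (Grassmannian CARD('k)) Q0"
    using Q0_in geo(1) by (simp add: tangent_space_Grassmannian)
  have exp: "riem_exp trace_metric (Grassmannian CARD('k)) Q0 v = Q1"
  proof -
    have "geodesic_curve (of_mat Q0) (of_mat v) 1 = of_mat Q1"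
      unfolding p C_def by (rule geo(2))
    then show ?thesis
      by (simp add: riem_exp_Grassmannian[OF v])
  qed
  \<comment> \<open>Here the bound on the distance becomes a bound on \<open>v\<close>: no curve is
    shorter than \<open>v\<close>, so \<open>v\<close> lies in the ball on which the exponential map
    is known to be a diffeomorphism.\<close>
  have "ereal (metric_norm trace_metric v) \<le> geodesic_dist trace_metric (Grassmannian CARD('k)) Q0 Q1"
    using geodesic_dist_Grassmannian_ge[OF v geo(3)[OF \<theta>_range]] exp by simp
  then have "metric_norm trace_metric v < sqrt 2 * pi"
    using dist by (metis ereal_less_eq(3) le_less_trans less_ereal.simps(1))
  from riem_log_Grassmannian[OF v this exp] show ?thesis
    by (simp add: v_def)
qed

end
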